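(* Let $g\in L^2(\mathbb{R}^{2d},\mathbb{H})$ be a non-zero quaternion window function and let $f\in L^2(\mathbb{R}^{2d},\mathbb{H})$ with $f\neq0$. Let $U$ be a measurable subset of $\mathbb{R}^{2d}\times\mathbb{R}^{2d}$ and $\varepsilon\ge0$. If $\mathcal{G}_g(f)$ is $\varepsilon$-concentrated on $U$, then for every $p>2$, $$C_{p,q}^{\frac{2p}{2-p}}\,(1-\varepsilon^2)^{\frac{p}{p-2}}\le\mu_{4d}(U),$$ where $C_{p,q}=\left(\frac4p\right)^{\frac dp}\left(\frac1q\right)^{\frac dq}$ and $\frac1p+\frac1q=1$.
   Context: $d\ge 1$ is an integer and $\mathbb{H}$ is the algebra of quaternions with units $i,j,k$. On $\mathbb{R}^n$, $d\mu_n(x)=dx/(2\pi)^{n/2}$, $\|F\|_{2,n}=\big(\int_{\mathbb{R}^n}|F|^2d\mu_n\big)^{1/2}$, and $\mathbb{R}^{2d}\times\mathbb{R}^{2d}$ is identified with $\mathbb{R}^{4d}$. The two sided quaternion windowed Fourier transform of $f$ with respect to $g$ is $$\mathcal{G}_g(f)(x,w)=\int_{\mathbb{R}^{2d}}e^{-i\,s\cdot u}f(y)\overline{g(y-x)}e^{-j\,t\cdot v}\,d\mu_{2d}(y),\quad x\in\mathbb{R}^{2d},\ w=(u,v),\ y=(s,t)\in\mathbb{R}^d\times\mathbb{R}^d.$$ A function $F\in L^2(\mathbb{R}^{2d}\times\mathbb{R}^{2d},\mathbb{H})$ is $\varepsilon$-concentrated on a measurable set $U\subseteq\mathbb{R}^{2d}\times\mathbb{R}^{2d}$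 if $\big(\int_{U^c}|F|^2d\mu_{4d}\big)^{1/2}\le\varepsilon\|F\|_{2,4d}$, where $U^c$ is the complement of $U$.
   Formalization: The formal theorem assumes also ε ≤ 1; for ε > 1 the power of the negative number 1 − ε² is in general undefined, and for p = 4 with U empty the stated inequality is false. *)

theory Defs
  imports "HOL-Analysis.Analysis"
begin

section \<open>Quaternions\<close>

codatatype quat = Quat (q_re: real) (q_i: real) (q_j: real) (q_k: real)

lemma quat_eqI [intro?]:
  "q_re x = q_re y \<Longrightarrow> q_i x = q_i y \<Longrightarrow> q_j x = q_j y \<Longrightarrow> q_k x = q_k y \<Longrightarrow> x = y"
  by (rule quat.expand) simp

lemma quat_eq_iff:
  "x = y \<longleftrightarrow> q_re x = q_re y \<and> q_i x = q_i y \<and> q_j x = q_j y \<and> q_k x = q_k y"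
  by (auto intro: quat.expand)

instantiation quat :: ab_group_add
begin

primcorec zero_quat where
  "q_re 0 = 0" | "q_i 0 = 0" | "q_j 0 = 0" | "q_k 0 = 0"

primcorec plus_quat where
  "q_re (x + y) = q_re x + q_re y"
| "q_i (x + y) = q_i x + q_i y"
| "q_j (x + y) = q_j x + q_j y"
| "q_k (x + y) = q_k x + q_k y"

primcorec uminus_quat where
  "q_re (- x) = - q_re x" | "q_i (- x) = - q_i x" | "q_j (- x) = - q_j x" | "q_k (- x) = - q_k x"

primcorec minus_quat where
  "q_re (x - y) = q_re x - q_re y"
| "q_i (x - y) = q_i x - q_i y"
| "q_j (x - y) = q_j x - q_j y"
| "q_k (x - y) = q_k x - q_k y"

instance
  by standard (simp_all add: quat_eq_iff)

end

instantiation quat :: ring_1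
begin

primcorec one_quat where
  "q_re 1 = 1" | "q_i 1 = 0" | "q_j 1 = 0" | "q_k 1 = 0"

primcorec times_quat where
  "q_re (x * y) = q_re x * q_re y - q_i x * q_i y - q_j x * q_j y - q_k x * q_k y"
| "q_i (x * y) = q_re x * q_i y + q_i x * q_re y + q_j x * q_k y - q_k x * q_j y"
| "q_j (x * y) = q_re x * q_j y - q_i x * q_k y + q_j x * q_re y + q_k x * q_i y"
| "q_k (x * y) = q_re x * q_k y + q_i x * q_j y - q_j x * q_i y + q_k x * q_re y"

instance
  by standard (simp_all add: quat_eq_iff algebra_simps)

end

instantiation quat :: real_algebra_1
begin

primcorec scaleR_quat where
  "q_re (scaleR r x) = r * q_re x"
| "q_i (scaleR r x) = r * q_i x"
| "q_j (scaleR r x) = r * q_j x"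
| "q_k (scaleR r x) = r * q_k x"

instance
  by standard (simp_all add: quat_eq_iff algebra_simps)

end

instantiation quat :: real_div_algebra
begin

primcorec inverse_quat where
  "q_re (inverse x) = q_re x / ((q_re x)\<^sup>2 + (q_i x)\<^sup>2 + (q_j x)\<^sup>2 + (q_k x)\<^sup>2)"
| "q_i (inverse x) = - q_i x / ((q_re x)\<^sup>2 + (q_i x)\<^sup>2 + (q_j x)\<^sup>2 + (q_k x)\<^sup>2)"
| "q_j (inverse x) = - q_j x / ((q_re x)\<^sup>2 + (q_i x)\<^sup>2 + (q_j x)\<^sup>2 + (q_k x)\<^sup>2)"
| "q_k (inverse x) = - q_k x / ((q_re x)\<^sup>2 + (q_i x)\<^sup>2 + (q_j x)\<^sup>2 + (q_k x)\<^sup>2)"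

definition "x div y = x * inverse y" for x y :: quat

instance
proof
  fix x y :: quat
  show "x div y = x * inverse y"
    by (simp add: divide_quat_def)
  show "inverse (0::quat) = 0"
    by (simp add: quat_eq_iff)
  assume "x \<noteq> 0"
  then have nz: "(q_re x)\<^sup>2 + (q_i x)\<^sup>2 + (q_j x)\<^sup>2 + (q_k x)\<^sup>2 \<noteq> 0"
    by (simp add: quat_eq_iff add_nonneg_eq_0_iff)
  define N where "N = (q_re x)\<^sup>2 + (q_i x)\<^sup>2 + (q_j x)\<^sup>2 + (q_k x)\<^sup>2"
  have "N \<noteq> 0" and N: "q_re x * q_re x + q_i x * q_i x + q_j x * q_j x + q_k x * q_k x = N"
    using nz by (simp_all add: N_def power2_eq_square)
  then show "inverse x * x = 1" and "x * inverse x = 1"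
    by (simp_all add: quat_eq_iff flip: N_def) (simp_all add: field_simps)
qed

end

instantiation quat :: real_inner
begin

definition inner_quat_def:
  "inner x y = q_re x * q_re y + q_i x * q_i y + q_j x * q_j y + q_k x * q_k y"

definition norm_quat_def: "norm (x::quat) = sqrt (inner x x)"

definition dist_quat_def: "dist x y = norm (x - y)" for x y :: quat

definition sgn_quat_def: "sgn x = x /\<^sub>R norm x" for x :: quat

definition uniformity_quat_def [code del]:
  "(uniformity :: (quat \<times> quat) filter) = (INF e\<in>{0 <..}. principal {(x, y). dist x y < e})"

definition open_quat_def [code del]:
  "open (U :: quat set) \<longleftrightarrow> (\<forall>x\<in>U. eventually (\<lambda>(x', y). x' = x \<longrightarrow> y \<in> U) uniformity)"

instance
proof
  fix x y z :: quat and r :: real and U :: "quat set"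
  show "inner x y = inner y x"
    by (simp add: inner_quat_def algebra_simps)
  show "inner (x + y) z = inner x z + inner y z"
    by (simp add: inner_quat_def algebra_simps)
  show "inner (r *\<^sub>R x) y = r * inner x y"
    by (simp add: inner_quat_def algebra_simps)
  show "0 \<le> inner x x"
    by (simp add: inner_quat_def)
  show "inner x x = 0 \<longleftrightarrow> x = 0"
    by (auto simp add: inner_quat_def quat_eq_iff add_nonneg_eq_0_iff)
  show "norm x = sqrt (inner x x)"
    by (rule norm_quat_def)
  show "dist x y = norm (x - y)"
    by (rule dist_quat_def)
  show "sgn x = x /\<^sub>R norm x"
    by (rule sgn_quat_def)
  show "(uniformity :: (quat \<times> quat) filter) = (INF e\<in>{0 <..}. principal {(x, y). dist x y < e})"
    by (rule uniformity_quat_def)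
  show "open U \<longleftrightarrow> (\<forall>x\<in>U. eventually (\<lambda>(x', y). x' = x \<longrightarrow> y \<in> U) uniformity)"
    by (rule open_quat_def)
qed

end

lemma norm_quat_eq: "norm x = sqrt ((q_re x)\<^sup>2 + (q_i x)\<^sup>2 + (q_j x)\<^sup>2 + (q_k x)\<^sup>2)"
  by (simp add: norm_quat_def inner_quat_def power2_eq_square)

instance quat :: real_normed_div_algebra
proof
  fix x y :: quat
  show "norm (x * y) = norm x * norm y"
    unfolding norm_quat_eq real_sqrt_mult[symmetric] times_quat.simps
    by (rule arg_cong[of _ _ sqrt]) algebra
qed

definition quat_i :: quat where "quat_i = Quat 0 1 0 0"
definition quat_j :: quat where "quat_j = Quat 0 0 1 0"
definition quat_k :: quat where "quat_k = Quat 0 0 0 1"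

lemma quat_unit_sel [simp]:
  "q_re quat_i = 0" "q_i quat_i = 1" "q_j quat_i = 0" "q_k quat_i = 0"
  "q_re quat_j = 0" "q_i quat_j = 0" "q_j quat_j = 1" "q_k quat_j = 0"
  "q_re quat_k = 0" "q_i quat_k = 0" "q_j quat_k = 0" "q_k quat_k = 1"
  by (simp_all add: quat_i_def quat_j_def quat_k_def)

lemma quat_unit_mult [simp]:
  "quat_i * quat_i = - 1" "quat_j * quat_j = - 1" "quat_k * quat_k = - 1"
  "quat_i * quat_j = quat_k" "quat_j * quat_k = quat_i" "quat_k * quat_i = quat_j"
  "quat_j * quat_i = - quat_k" "quat_k * quat_j = - quat_i" "quat_i * quat_k = - quat_j"
  by (simp_all add: quat_eq_iff)

instantiation quat :: euclidean_space
begin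

definition Basis_quat_def: "Basis = {1, quat_i, quat_j, quat_k}"

instance
proof
  show "(Basis :: quat set) \<noteq> {}" and "finite (Basis :: quat set)"
    by (simp_all add: Basis_quat_def)
  show "inner u v = (if u = v then 1 else 0)" if "u \<in> Basis" "v \<in> Basis" for u v :: quat
    using that unfolding Basis_quat_def
    by (elim insertE emptyE) (simp_all add: inner_quat_def, simp_all add: quat_eq_iff)
  show "(\<forall>u\<in>Basis. inner x u = 0) \<longleftrightarrow> x = 0" for x :: quat
    unfolding Basis_quat_def by (simp add: inner_quat_def) (simp add: quat_eq_iff)
qed

end

primcorec qcnj :: "quat \<Rightarrow> quat" where
  "q_re (qcnj x) = q_re x"
| "q_i (qcnj x) = - q_i x"
| "q_j (qcnj x) = - q_j x"
| "q_k (qcnj x) = - q_k x"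

lemma mult_qcnj: "x * qcnj x = of_real ((norm x)\<^sup>2)"
  by (simp add: norm_quat_eq of_real_def quat_eq_iff) (simp add: power2_eq_square)

lemma quat_exp_unit:
  fixes u :: quat
  assumes u: "u * u = - 1"
  shows "exp (t *\<^sub>R u) = cos t *\<^sub>R 1 + sin t *\<^sub>R u"
proof -
  have pow: "u ^ n = fact n *\<^sub>R (cos_coeff n *\<^sub>R 1 + sin_coeff n *\<^sub>R u)" for n
  proof (induct n)
    case 0
    show ?case by simp
  next
    case (Suc n)
    have "u ^ Suc n = fact n *\<^sub>R (cos_coeff n *\<^sub>R u + sin_coeff n *\<^sub>R (u * u))"
      by (simp add: Suc distrib_left)
    also have "\<dots> = fact (Suc n) *\<^sub>R (cos_coeff (Suc n) *\<^sub>R 1 + sin_coeff (Suc n) *\<^sub>R u)"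
      by (simp add: u sin_coeff_Suc cos_coeff_Suc scaleR_add_right scaleR_diff_right)
    finally show ?case .
  qed
  have summand: "(t *\<^sub>R u) ^ n /\<^sub>R fact n
      = (cos_coeff n *\<^sub>R t ^ n) *\<^sub>R 1 + (sin_coeff n *\<^sub>R t ^ n) *\<^sub>R u" for n
  proof -
    have cancel: "inverse (fact n) * (t ^ n * (fact n * c)) = c * t ^ n" for c :: real
      by (simp add: field_simps)
    show ?thesis
      by (simp add: pow scaleR_add_right) (simp only: cancel)
  qed
  have "(\<lambda>n. (t *\<^sub>R u) ^ n /\<^sub>R fact n) sums (cos t *\<^sub>R 1 + sin t *\<^sub>R u)"
    unfolding summand
    by (intro sums_add sums_scaleR_left cos_converges sin_converges)
  then show ?thesis
    using exp_converges sums_unique2 by blast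
qed

section \<open>Normalized Lebesgue measure and square-integrable functions\<close>

definition mu :: "'a::euclidean_space measure" where
  "mu = density lebesgue (\<lambda>_. ennreal (1 / (2 * pi) powr (real DIM('a) / 2)))"

definition L2_quat :: "('a::euclidean_space \<Rightarrow> quat) set" where
  "L2_quat = {F. F \<in> borel_measurable mu \<and> integrable mu (\<lambda>x. (norm (F x))\<^sup>2)}"

definition norm2 :: "('a::euclidean_space \<Rightarrow> quat) \<Rightarrow> real" where
  "norm2 F = sqrt (\<integral>x. (norm (F x))\<^sup>2 \<partial>mu)"

(* Meaningful for F in L2_quat and measurable U only: the Bochner integral of a
   non-integrable function is 0. *)
definition concentrated :: "real \<Rightarrow> ('a::euclidean_space) set \<Rightarrow> ('a \<Rightarrow> quat) \<Rightarrow> bool" where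
  "concentrated \<epsilon> U F \<longleftrightarrow> sqrt (\<integral>z\<in>- U. (norm (F z))\<^sup>2 \<partial>mu) \<le> \<epsilon> * norm2 F"

section \<open>Two-sided quaternion windowed Fourier transform\<close>

(* Arguments: the window g first, then f. *)
definition qwft ::
  "((real^'n) \<times> (real^'n) \<Rightarrow> quat) \<Rightarrow> ((real^'n) \<times> (real^'n) \<Rightarrow> quat) \<Rightarrow>
     ((real^'n) \<times> (real^'n)) \<times> ((real^'n) \<times> (real^'n)) \<Rightarrow> quat" where
  "qwft g f = (\<lambda>(x, (u, v)).
     \<integral>y. (case y of (s, t) \<Rightarrow>
        exp (- (s \<bullet> u) *\<^sub>R quat_i) * f y * qcnj (g (y - x)) * exp (- (t \<bullet> v) *\<^sub>R quat_j)) \<partial>mu)"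

definition lieb_const :: "nat \<Rightarrow> real \<Rightarrow> real \<Rightarrow> real" where
  "lieb_const d p q = (4 / p) powr (real d / p) * (1 / q) powr (real d / q)"

end

theory Submission
  imports Defs "HOL-Probability.Characteristic_Functions"
begin

text \<open>
  For fixed \<open>x\<close> the windowed transform is the two-sided Fourier transform of \<open>h\<^sub>x(y) = f(y) g(y - x)\<^sup>*\<close>.
  With \<open>m(x)\<close> the measure of the slice of \<open>U\<close> over \<open>x\<close> and \<open>\<nu>(x)\<close> the energy of the transform on it, duality
  and Plancherel give \<open>\<nu> \<le> c (m \<nu>)\<^bsup>(2 - q)/2\<^esup> \<integral>|h\<^sub>x|\<^sup>q\<close>. Integrating over \<open>x\<close>, the right-hand side is a
  trilinear convolution form in \<open>|f|\<^sup>2\<close>, \<open>|g|\<^sup>2\<close> and \<open>(m \<nu>)\<^bsup>1/2\<^esup>\<close> with exponents \<open>q/2\<close>, \<open>q/2\<close>, \<open>2 - q\<close>, and the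
  sharp Young inequality (Barthe's transport proof in dimension one, then tensorisation) bounds it by the
  integral of \<open>(m \<nu>)\<^bsup>1/2\<^esup>\<close>, hence by Cauchy-Schwarz by the measure of \<open>U\<close> and the energy on \<open>U\<close> itself. Since the total
  energy is \<open>\<parallel>f\<parallel>\<^sup>2 \<parallel>g\<parallel>\<^sup>2\<close> by Plancherel, this is the claim; the constant \<open>C\<^sub>p\<^sub>,\<^sub>q\<close> is exactly the one of Young's inequality.
\<close>

section \<open>Continuous functions are dense in the integrable functions\<close>

text \<open>A bound on the p-norm of the transform would call for Hausdorff-Young on
  quaternion-valued functions, hence for interpolation. Estimating only the energy on slices of
  \<open>U\<close> avoids this; the price is a bound that varies with \<open>x\<close> through
  \<open>m \<nu>\<close>. It is affordable because the exponents q/2, q/2 and 2 - q sum to 2, the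
  homogeneity of a convolution form, so that the varying factor can be the third function in Young's
  inequality. The energy on \<open>U\<close> then stands on both sides, on the right with exponent 1
  - q/2 < 1, and dividing by that power leaves a lower bound for the measure. In the normalisation
  of \<open>mu\<close> the slice estimate carries the constant 1. Hence Young's inequality in
  dimension 2d is the only source of a constant, and the q-th root of its constant is C_{p,q}.
  Noncommutativity is met by working with the real inner product throughout: for fixed
  \<open>y\<close> and \<open>w\<close> the two-sided kernel is a real-orthogonal map, and its left
  and right phases never have to be interchanged.\<close>

definition L1_approximable :: "('a::euclidean_space \<Rightarrow> 'b::{banach, second_countable_topology}) \<Rightarrow> bool" where
  "L1_approximable h \<longleftrightarrow> (\<forall>e>0. \<exists>g. continuous_on UNIV g \<and> bounded (range g) \<and> integrable lborel g
     \<and> (LBINT x. norm (h x - g x)) < e)"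

lemma L1_approximableI:
  assumes "integrable lborel h"
    and "\<And>e. e > 0 \<Longrightarrow> \<exists>h'. integrable lborel h' \<and> L1_approximable h' \<and> (LBINT x. norm (h x - h' x)) < e"
  shows "L1_approximable h"
  unfolding L1_approximable_def
proof (intro allI impI)
  fix e :: real assume "e > 0"
  then have e2: "e / 2 > 0" by simp
  obtain h' where h': "integrable lborel h'" "L1_approximable h'" "(LBINT x. norm (h x - h' x)) < e / 2"
    using assms(2)[OF e2] by blast
  obtain g where g: "continuous_on UNIV g" "bounded (range g)" "integrable lborel g"
     "(LBINT x. norm (h' x - g x)) < e / 2"
    using h'(2) e2 unfolding L1_approximable_def by blast
  have "(LBINT x. norm (h x - g x)) \<le> (LBINT x. norm (h x - h' x) + norm (h' x - g x))"
    using assms(1) h' g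
    by (intro integral_mono integrable_norm Bochner_Integration.integrable_add Bochner_Integration.integrable_diff)
       (auto intro: norm_diff_triangle_le[OF order_refl order_refl])
  also have "\<dots> = (LBINT x. norm (h x - h' x)) + (LBINT x. norm (h' x - g x))"
    using assms(1) h' g by (intro Bochner_Integration.integral_add integrable_norm Bochner_Integration.integrable_diff) auto
  also have "\<dots> < e" using h' g by linarith
  finally show "\<exists>g. continuous_on UNIV g \<and> bounded (range g) \<and> integrable lborel g
     \<and> (LBINT x. norm (h x - g x)) < e" using g by blast
qed

lemma L1_approximable_limit:
  assumes lim: "(\<lambda>n. \<integral>x. norm (h x - s n x) \<partial>lborel) \<longlonglongrightarrow> 0"
    and "integrable lborel h" "\<And>n::nat. integrable lborel (s n)" "\<And>n. L1_approximable (s n)"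
  shows "L1_approximable h"
proof (rule L1_approximableI)
  fix e :: real assume "e > 0"
  then have "eventually (\<lambda>n. (LBINT x. norm (h x - s n x)) < e) sequentially"
    using lim by (simp add: order_tendsto_iff)
  then obtain n where "(LBINT x. norm (h x - s n x)) < e"
    by (auto simp: eventually_sequentially)
  then show "\<exists>h'. integrable lborel h' \<and> L1_approximable h' \<and> (LBINT x. norm (h x - h' x)) < e"
    using assms by blast
qed fact

text \<open>Multiples of the distance to the complement, cut off at 1, are continuous, vanish off
  \<open>U\<close> and converge to its indicator; \<open>indicator U\<close> dominates them.\<close>

lemma L1_approximable_open:
  fixes U :: "'a::euclidean_space set" and c :: "'b::{banach, second_countable_topology}"
  assumes U: "open U" "emeasure lborel U < \<infinity>"
  shows "L1_approximable (\<lambda>x. indicator U x *\<^sub>R c)"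
proof -
  \<comment> \<open>\<open>infdist\<close> to the empty set is 0, so the functions
    \<open>s n\<close> would vanish identically if \<open>U\<close> were the whole space. Finite
    measure excludes this.\<close>
  have ne: "- U \<noteq> {}"
    using U by (metis Compl_empty_eq double_complement emeasure_lborel_UNIV infinity_ennreal_def less_irrefl)
  define s where "s = (\<lambda>(n::nat) x. min 1 (real n * infdist x (- U)) *\<^sub>R c)"
  have zero: "s n x = 0" if "x \<notin> U" for n x
    using that by (simp add: s_def)
  have cont: "continuous_on UNIV (s n)" for n
    unfolding s_def by (intro continuous_intros)
  have [measurable]: "s n \<in> borel_measurable borel" for n
    by (rule borel_measurable_continuous_onI[OF cont])
  have [measurable]: "U \<in> sets borel" using U by simp
  have le: "norm (s n x) \<le> indicator U x * norm c" for n x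
    by (cases "x \<in> U") (auto simp: zero s_def infdist_nonneg intro!: mult_left_le_one_le)
  have intU: "integrable lborel (\<lambda>x. indicator U x * norm c)"
    using U by (intro integrable_mult_left) (simp add: integrable_indicator_iff)
  have intUc: "integrable lborel (\<lambda>x. indicator U x *\<^sub>R c)"
    using U by (intro integrable_scaleR_left) (simp add: integrable_indicator_iff)
  have ints: "integrable lborel (s n)" for n
    by (rule Bochner_Integration.integrable_bound[OF intU]) (use le in \<open>auto simp: abs_mult\<close>)
  have bdd: "bounded (range (s n))" for n
  proof -
    have "norm (s n x) \<le> norm c" for x using le[of n x] by (cases "x \<in> U") auto
    then show ?thesis by (auto simp: bounded_iff)
  qed
  have tend: "(\<lambda>n. s n x) \<longlonglongrightarrow> indicator U x *\<^sub>R c" for x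
  proof (cases "x \<in> U")
    case True
    have pos: "infdist x (- U) > 0"
      using U(1) True ne by (metis Compl_iff closed_Compl in_closed_iff_infdist_zero infdist_nonneg order_less_le)
    obtain N where N: "1 \<le> real N * infdist x (- U)"
      using reals_Archimedean3[OF pos] by (auto intro: less_imp_le)
    have "eventually (\<lambda>n. s n x = indicator U x *\<^sub>R c) sequentially"
      using eventually_ge_at_top[of N]
    proof eventually_elim
      case (elim n)
      have "1 \<le> real n * infdist x (- U)"
        using N elim pos by (meson less_imp_le mult_right_mono of_nat_mono order_trans)
      then show ?case using True by (simp add: s_def)
    qed
    then show ?thesis by (rule tendsto_eventually)
  qed (simp add: zero)
  show ?thesis
  proof (rule L1_approximable_limit[of _ s])
    have "(\<lambda>n. \<integral>x. norm (indicator U x *\<^sub>R c - s n x) \<partial>lborel) \<longlonglongrightarrow> (\<integral>x. 0 \<partial>(lborel::'a measure))"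
    proof (rule integral_dominated_convergence[where w = "\<lambda>x. 2 * (indicator U x * norm c)"])
      show "integrable lborel (\<lambda>x. 2 * (indicator U x * norm c))" using intU by simp
      show "AE x in lborel. norm (norm (indicator U x *\<^sub>R c - s n x)) \<le> 2 * (indicator U x * norm c)" for n
      proof (rule AE_I2)
        fix x show "norm (norm (indicator U x *\<^sub>R c - s n x)) \<le> 2 * (indicator U x * norm c)"
          using norm_triangle_ineq4[of "indicator U x *\<^sub>R c" "s n x"] le[of n x] by simp
      qed
      show "AE x in lborel. (\<lambda>n. norm (indicator U x *\<^sub>R c - s n x)) \<longlonglongrightarrow> 0"
      proof (rule AE_I2)
        fix x show "(\<lambda>n. norm (indicator U x *\<^sub>R c - s n x)) \<longlonglongrightarrow> 0"
          using tendsto_norm[OF tendsto_diff[OF tendsto_const[of "indicator U x *\<^sub>R c"] tend[of x]]] by simp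
      qed
    qed measurable
    then show "(\<lambda>n. \<integral>x. norm (indicator U x *\<^sub>R c - s n x) \<partial>lborel) \<longlonglongrightarrow> 0" by simp
    show "L1_approximable (s n)" for n
      unfolding L1_approximable_def using cont bdd ints by (intro allI impI exI[of _ "s n"]) auto
  qed (use intUc ints in auto)
qed

text \<open>Outer regularity replaces a measurable set of finite measure by an open one. Sums and
  dominated limits then carry the property to all integrable functions.\<close>

lemma L1_approximable:
  fixes h :: "'a::euclidean_space \<Rightarrow> 'b::{banach, second_countable_topology}"
  assumes "integrable lborel h"
  shows "L1_approximable h"
  using assms
proof (induction rule: integrable_induct)
  case (base A c)
  have [measurable]: "A \<in> sets borel" using base by simp
  have intA: "integrable lborel (\<lambda>x. indicator A x *\<^sub>R c)"
    using base by (intro integrable_scaleR_left) (simp add: integrable_indicator_iff)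
  show ?case
  proof (rule L1_approximableI[OF intA])
    fix e :: real assume e: "e > 0"
    define d where "d = e / (norm c + 1)"
    have d: "d > 0" using e by (simp add: d_def add_nonneg_pos)
    obtain U where U: "open U" "A \<subseteq> U" "emeasure lborel (U - A) < d"
      using outer_regular_lborel[of A d] d by auto
    have [measurable]: "U \<in> sets borel" using U by simp
    have "emeasure lborel U \<le> emeasure lborel A + emeasure lborel (U - A)"
      using U(2) by (metis Un_Diff_cancel2 \<open>A \<in> sets borel\<close> \<open>U \<in> sets borel\<close> emeasure_subadditive
          le_iff_sup sets.Diff sets_lborel sup_commute Un_Diff_cancel)
    also have "\<dots> < \<infinity>" using base U(3) by (auto simp: less_top[symmetric] top_unique)
    finally have fin: "emeasure lborel U < \<infinity>" .
    have intU: "integrable lborel (\<lambda>x. indicator U x *\<^sub>R c)"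
      using fin by (intro integrable_scaleR_left) (simp add: integrable_indicator_iff)
    have "(LBINT x. norm (indicator A x *\<^sub>R c - indicator U x *\<^sub>R c)) = (LBINT x. indicator (U - A) x * norm c)"
      using U(2) by (intro Bochner_Integration.integral_cong) (auto simp: indicator_def)
    also have "\<dots> = measure lborel (U - A) * norm c" by simp
    also have "\<dots> \<le> d * norm c"
      using U(3) d by (intro mult_right_mono) (auto simp: measure_def enn2real_leI less_imp_le)
    also have "\<dots> < e"
    proof -
      have "norm c + 1 > 0" by (simp add: add_nonneg_pos)
      then show ?thesis using e by (simp add: d_def divide_less_eq)
    qed
    finally show "\<exists>h'. integrable lborel h' \<and> L1_approximable h' \<and> (LBINT x. norm (indicator A x *\<^sub>R c - h' x)) < e"
      using L1_approximable_open[OF U(1) fin] intU by blast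
  qed
next
  case (add f g)
  show ?case unfolding L1_approximable_def
  proof (intro allI impI)
    fix e :: real assume "e > 0"
    then have e2: "e / 2 > 0" by simp
    obtain f' where f': "continuous_on UNIV f'" "bounded (range f')" "integrable lborel f'" "(LBINT x. norm (f x - f' x)) < e/2"
      using add.IH(1) e2 unfolding L1_approximable_def by blast
    obtain g' where g': "continuous_on UNIV g'" "bounded (range g')" "integrable lborel g'" "(LBINT x. norm (g x - g' x)) < e/2"
      using add.IH(2) e2 unfolding L1_approximable_def by blast
    have "(LBINT x. norm (f x + g x - (f' x + g' x))) \<le> (LBINT x. norm (f x - f' x) + norm (g x - g' x))"
      using add.hyps(1,2) f' g' by (intro integral_mono) (auto intro: norm_diff_triangle_ineq)
    also have "\<dots> = (LBINT x. norm (f x - f' x)) + (LBINT x. norm (g x - g' x))"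
      using add.hyps(1,2) f' g' by (intro Bochner_Integration.integral_add) auto
    also have "\<dots> < e" using f' g' by linarith
    finally show "\<exists>k. continuous_on UNIV k \<and> bounded (range k) \<and> integrable lborel k
     \<and> (LBINT x. norm (f x + g x - k x)) < e"
      using f' g' by (intro exI[of _ "\<lambda>x. f' x + g' x"]) (auto intro!: continuous_intros bounded_plus_comp)
  qed
next
  case (lim f s)
  show ?case
  proof (rule L1_approximable_limit[of _ s])
    note [measurable] = borel_measurable_integrable[OF lim.hyps(4)] borel_measurable_integrable[OF lim.hyps(1)]
    have "(\<lambda>n. \<integral>x. norm (f x - s n x) \<partial>lborel) \<longlonglongrightarrow> (\<integral>x. 0 \<partial>(lborel::'a measure))"
    proof (rule integral_dominated_convergence[where w = "\<lambda>x. 3 * norm (f x)"])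
      show "integrable lborel (\<lambda>x. 3 * norm (f x))" using lim by simp
      show "AE x in lborel. norm (norm (f x - s n x)) \<le> 3 * norm (f x)" for n
      proof (rule AE_I2)
        fix x show "norm (norm (f x - s n x)) \<le> 3 * norm (f x)"
          using norm_triangle_ineq4[of "f x" "s n x"] lim.hyps(3)[of x n] by simp
      qed
      show "AE x in lborel. (\<lambda>n. norm (f x - s n x)) \<longlonglongrightarrow> 0"
      proof (rule AE_I2)
        fix x show "(\<lambda>n. norm (f x - s n x)) \<longlonglongrightarrow> 0"
          using tendsto_norm[OF tendsto_diff[OF tendsto_const[of "f x"] lim.hyps(2)[of x]]] by simp
      qed
    qed measurable
    then show "(\<lambda>n. \<integral>x. norm (f x - s n x) \<partial>lborel) \<longlonglongrightarrow> 0" by simp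
  qed (use lim in auto)
qed

text \<open>This serves two purposes: it reduces Young's inequality to continuous densities, whose
  transport maps are differentiable, and it gives continuity of the autocorrelation at 0, where
  boundedness of \<open>g\<close> provides the dominating function.\<close>

lemma integrable_approx_continuous:
  fixes h :: "'a::euclidean_space \<Rightarrow> 'b::{banach, second_countable_topology}"
  assumes "integrable lborel h" "0 < e"
  obtains g where "continuous_on UNIV g" "bounded (range g)" "integrable lborel g"
    "(LBINT x. norm (h x - g x)) < e"
  using L1_approximable[OF assms(1)] assms(2) unfolding L1_approximable_def by blast

section \<open>The sharp Young inequality\<close>

definition cumul :: "(real \<Rightarrow> real) \<Rightarrow> real \<Rightarrow> real" where
  "cumul F x = (LINT t:{..x}|lborel. F t)"

context
  fixes F :: "real \<Rightarrow> real"
  assumes F_cont: "continuous_on UNIV F" and F_pos: "\<And>x. 0 < F x" and F_int: "integrable lborel F"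
begin

lemma set_integrable_F: "A \<in> sets borel \<Longrightarrow> set_integrable lborel A F"
  using F_int unfolding set_integrable_def by (intro integrable_mult_indicator) auto

lemma cumul_has_derivative: "(cumul F has_real_derivative F x) (at x)"
proof -
  \<comment> \<open>The half-line is split at \<open>x - 1\<close>, so that near \<open>x\<close>
    only an integral over a compact interval varies and the fundamental theorem of calculus
    applies.\<close>
  have eq: "cumul F u = cumul F (x - 1) + integral {x - 1..u} F" if "u \<in> {x-1..x+1}" for u
  proof -
    have "{..u} = {..x-1} \<union> {x-1<..u}" using that by auto
    then have "cumul F u = (LINT t:{..x-1} \<union> {x-1<..u}|lborel. F t)"
      unfolding cumul_def by simp
    also have "\<dots> = cumul F (x - 1) + (LINT t:{x-1<..u}|lborel. F t)"
      unfolding cumul_def by (intro set_integral_Un set_integrable_F) auto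
    also have "(LINT t:{x-1<..u}|lborel. F t) = integral {x-1<..u} F"
      by (intro set_borel_integral_eq_integral set_integrable_F) auto
    also have "\<dots> = integral {x-1..u} F"
      by (rule integral_spike_set) (auto intro: negligible_subset[of "{x-1}"])
    finally show ?thesis .
  qed
  have "((\<lambda>u. cumul F (x - 1) + integral {x - 1..u} F) has_real_derivative 0 + F x) (at x within {x-1..x+1})"
    using F_cont by (intro DERIV_add DERIV_const integral_has_real_derivative continuous_on_subset[OF F_cont]) auto
  then have "(cumul F has_real_derivative F x) (at x within {x-1..x+1})"
    unfolding add_0
    by (rule has_field_derivative_transform_within[where d = 1]) (simp, simp, rule eq[symmetric])
  then have "(cumul F has_real_derivative F x) (at x within {x-1<..<x+1})"
    by (rule has_field_derivative_subset) auto
  then show ?thesis by (simp add: at_within_open[of x "{x-1<..<x+1}"])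
qed

lemma cumul_strict_mono: "x < y \<Longrightarrow> cumul F x < cumul F y"
  by (rule DERIV_pos_imp_increasing) (use cumul_has_derivative F_pos in blast)+

lemma cumul_isCont: "isCont (cumul F) x"
  using cumul_has_derivative DERIV_isCont by blast

lemma cumul_at_top: "(cumul F \<longlongrightarrow> integral\<^sup>L lborel F) at_top"
  using tendsto_integral_at_top[OF _ F_int] unfolding cumul_def set_lebesgue_integral_def by simp

lemma cumul_at_bot: "(\<lambda>n. cumul F (- real n)) \<longlonglongrightarrow> 0"
proof -
  have [measurable]: "F \<in> borel_measurable borel" using F_int by (auto dest: borel_measurable_integrable)
  have "(\<lambda>n. \<integral>t. indicator {..- real n} t *\<^sub>R F t \<partial>lborel) \<longlonglongrightarrow> (\<integral>t. 0 \<partial>(lborel::real measure))"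
  proof (rule integral_dominated_convergence[where w = "\<lambda>x. norm (F x)"])
    show "integrable lborel (\<lambda>x. norm (F x))" using F_int by simp
    show "AE x in lborel. (\<lambda>n. indicator {..- real n} x *\<^sub>R F x) \<longlonglongrightarrow> 0"
    proof (rule AE_I2)
      fix x
      obtain N where N: "- x < real N" using reals_Archimedean2 by blast
      show "(\<lambda>n. indicator {..- real n} x *\<^sub>R F x) \<longlonglongrightarrow> 0"
      proof (rule tendsto_eventually, rule eventually_mono[OF eventually_ge_at_top[of N]])
        fix n assume "N \<le> n"
        then have "- x < real n" using N by linarith
        then show "indicator {..- real n} x *\<^sub>R F x = 0" by (auto simp: indicator_def)
      qed
    qed
    show "AE x in lborel. norm (indicator {..- real n} x *\<^sub>R F x) \<le> norm (F x)" for n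
      by (auto split: split_indicator)
  qed measurable
  then show ?thesis unfolding cumul_def set_lebesgue_integral_def by simp
qed

lemma cumul_bounds: "0 < cumul F x" "cumul F x < integral\<^sup>L lborel F"
proof -
  have "0 \<le> cumul F y" for y
    unfolding cumul_def set_lebesgue_integral_def
    using less_imp_le[OF F_pos] by (intro Bochner_Integration.integral_nonneg) simp
  from this[of "x - 1"] show "0 < cumul F x" using cumul_strict_mono[of "x - 1" x] by linarith
  have "cumul F (x + 1) \<le> integral\<^sup>L lborel F"
  proof (rule tendsto_lowerbound[OF cumul_at_top])
    show "eventually (\<lambda>y. cumul F (x + 1) \<le> cumul F y) at_top"
      using eventually_gt_at_top[of "x + 1"]
      by eventually_elim (rule less_imp_le, rule cumul_strict_mono)
  qed simp
  then show "cumul F x < integral\<^sup>L lborel F" using cumul_strict_mono[of x "x+1"] by linarith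
qed

lemma cumul_surj:
  assumes "0 < v" "v < integral\<^sup>L lborel F"
  shows "\<exists>x. cumul F x = v"
proof -
  obtain n where n: "cumul F (- real n) < v"
    using eventually_happens'[OF sequentially_bot order_tendstoD(2)[OF cumul_at_bot assms(1)]] by blast
  obtain N where N: "\<And>y. y \<ge> N \<Longrightarrow> v < cumul F y"
    using order_tendstoD(1)[OF cumul_at_top assms(2)] unfolding eventually_at_top_linorder by blast
  have "\<exists>x. - real n \<le> x \<and> x \<le> max N (- real n) \<and> cumul F x = v"
  proof (rule IVT)
    show "v \<le> cumul F (max N (- real n))" using N[of "max N (- real n)"] by simp
    show "\<forall>x. - real n \<le> x \<and> x \<le> max N (- real n) \<longrightarrow> isCont (cumul F) x"
      using cumul_isCont by blast
  qed (use n in simp_all)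
  then show ?thesis by blast
qed

end

text \<open>The map is the inverse of \<open>cumul G\<close> after \<open>cumul F\<close>.
  Differentiating \<open>cumul G (T x) = cumul F x\<close> gives the stated derivative, the
  one-dimensional Monge-Ampere equation; equal masses make the composition meaningful.\<close>

lemma monotone_transport:
  fixes F G :: "real \<Rightarrow> real"
  assumes F: "continuous_on UNIV F" "\<And>x. 0 < F x" "integrable lborel F"
    and G: "continuous_on UNIV G" "\<And>x. 0 < G x" "integrable lborel G"
    and eq: "integral\<^sup>L lborel F = integral\<^sup>L lborel G"
  obtains T where "\<And>x. (T has_real_derivative F x / G (T x)) (at x)"
proof -
  \<comment> \<open>Outside the open interval from 0 to the total mass the value of \<open>S\<close>
    is arbitrary. Every \<open>cumul F x\<close> lies inside it.\<close>
  define S where "S v = (THE t. cumul G t = v)" for v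
  have inj: "cumul G s = cumul G t \<Longrightarrow> s = t" for s t
    using cumul_strict_mono[OF G, of s t] cumul_strict_mono[OF G, of t s] by (cases s t rule: linorder_cases) auto
  have S: "S (cumul G t) = t" for t
    unfolding S_def by (rule the_equality) (auto dest: inj)
  have contS: "isCont S (cumul G t)" for t
    by (rule isCont_inverse_function[OF zero_less_one S cumul_isCont[OF G]])
  have surj: "cumul G (S v) = v" if v: "0 < v" "v < integral\<^sup>L lborel G" for v
  proof -
    obtain t where "cumul G t = v" using cumul_surj[OF G v] by blast
    then show ?thesis using S[of t] by simp
  qed
  have derS: "(S has_real_derivative inverse (G (S v))) (at v)" if v: "0 < v" "v < integral\<^sup>L lborel G" for v
  proof (rule DERIV_inverse_function[where f = "cumul G" and a = 0 and b = "integral\<^sup>L lborel G"])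
    show "(cumul G has_real_derivative G (S v)) (at (S v))" by (rule cumul_has_derivative[OF G])
    show "G (S v) \<noteq> 0" using G(2)[of "S v"] by simp
    show "isCont S v" using contS[of "S v"] surj[OF v] by simp
  qed (use v surj in auto)
  show thesis
  proof (rule that[of "\<lambda>x. S (cumul F x)"])
    fix x
    have "((\<lambda>x. S (cumul F x)) has_real_derivative inverse (G (S (cumul F x))) * F x) (at x)"
      using cumul_bounds[OF F, of x] eq
      by (intro DERIV_chain2[OF derS cumul_has_derivative[OF F]]) auto
    then show "((\<lambda>x. S (cumul F x)) has_real_derivative F x / G (S (cumul F x))) (at x)"
      by (simp add: field_simps)
  qed
qed

section \<open>Gaussian integrals and change of variables in the plane\<close>

lemma integrable_gauss: "integrable lborel (\<lambda>x::real. exp (- x\<^sup>2))"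
  and integral_gauss: "(LBINT x. exp (- x\<^sup>2)) = sqrt pi"
  using has_bochner_integral_even_function[OF gaussian_moment_0] by (auto simp: has_bochner_integral_iff)

lemma nn_integral_gauss_scaled:
  assumes "0 < c"
  shows "(\<integral>\<^sup>+x. ennreal (exp (- c * (x - m)\<^sup>2)) \<partial>lborel) = ennreal (sqrt (pi / c))"
proof -
  have "(\<integral>\<^sup>+x. ennreal (exp (- x\<^sup>2)) \<partial>lborel) = ennreal (sqrt pi)"
    using integrable_gauss integral_gauss by (subst nn_integral_eq_integral) auto
  then have "ennreal (sqrt pi) = ennreal \<bar>sqrt c\<bar> * (\<integral>\<^sup>+x. ennreal (exp (- ((- sqrt c * m) + sqrt c * x)\<^sup>2)) \<partial>lborel)"
    using assms by (subst (asm) nn_integral_real_affine[of _ "sqrt c" "- sqrt c * m"]) auto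
  also have "(\<lambda>x. exp (- ((- sqrt c * m) + sqrt c * x)\<^sup>2)) = (\<lambda>x. exp (- c * (x - m)\<^sup>2))"
  proof
    fix x
    have "((- sqrt c * m) + sqrt c * x)\<^sup>2 = (sqrt c)\<^sup>2 * (x - m)\<^sup>2"
      unfolding power_mult_distrib[symmetric] by (simp add: algebra_simps)
    then show "exp (- ((- sqrt c * m) + sqrt c * x)\<^sup>2) = exp (- c * (x - m)\<^sup>2)" using assms by simp
  qed
  finally have *: "ennreal (sqrt pi) = ennreal \<bar>sqrt c\<bar> * (\<integral>\<^sup>+x. ennreal (exp (- c * (x - m)\<^sup>2)) \<partial>lborel)" .
  have "ennreal (sqrt (pi / c)) = ennreal (1 / sqrt c) * ennreal (sqrt pi)"
    using assms by (simp add: ennreal_mult[symmetric] real_sqrt_divide)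
  also have "\<dots> = (ennreal (1 / sqrt c) * ennreal (sqrt c)) * (\<integral>\<^sup>+x. ennreal (exp (- c * (x - m)\<^sup>2)) \<partial>lborel)"
    using assms by (subst *) (simp add: mult.assoc)
  also have "ennreal (1 / sqrt c) * ennreal (sqrt c) = 1"
    using assms by (simp add: ennreal_mult[symmetric])
  finally show ?thesis by simp
qed

text \<open>The change of variables takes place on \<open>real^2\<close>, whereas Young's form is an
  iterated integral over two real variables; this identification connects them.\<close>

lemma lborel_real2: "(lborel :: (real^2) measure) =
   distr (lborel \<Otimes>\<^sub>M lborel) borel (\<lambda>(x, y). x *\<^sub>R axis 1 1 + y *\<^sub>R axis 2 1)" (is "_ = distr _ _ ?\<phi>")
proof (rule lborel_eqI)
  have [measurable]: "?\<phi> \<in> borel_measurable (lborel \<Otimes>\<^sub>M lborel)"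
    by measurable
  fix l u :: "real^2" assume lu': "\<And>b. b \<in> Basis \<Longrightarrow> l \<bullet> b \<le> u \<bullet> b"
  have lu: "l $ i \<le> u $ i" for i
    using lu'[of "axis i 1"] by (simp add: inner_axis)
  have "?\<phi> -` box l u = {l $ 1<..<u $ 1} \<times> {l $ 2<..<u $ 2}"
    by (auto simp: mem_box_cart axis_def forall_2)
  then have "emeasure (distr (lborel \<Otimes>\<^sub>M lborel) borel ?\<phi>) (box l u)
      = emeasure (lborel \<Otimes>\<^sub>M lborel) ({l $ 1<..<u $ 1} \<times> {l $ 2<..<u $ 2})"
    by (subst emeasure_distr) (auto simp: space_pair_measure)
  also have "\<dots> = ennreal (u $ 1 - l $ 1) * ennreal (u $ 2 - l $ 2)"
    using lu by (subst lborel.emeasure_pair_measure_Times) auto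
  also have "\<dots> = (\<Prod>b\<in>Basis. ennreal ((u - l) \<bullet> b))"
    by (simp add: Basis_vec_def UNIV_2 inner_axis axis_eq_axis mult.commute)
  also have "\<dots> = ennreal (\<Prod>b\<in>Basis. (u - l) \<bullet> b)"
    using lu' by (intro prod_ennreal) (simp add: inner_diff_left)
  finally show "emeasure (distr (lborel \<Otimes>\<^sub>M lborel) borel ?\<phi>) (box l u) = ennreal (\<Prod>b\<in>Basis. (u - l) \<bullet> b)" .
qed simp

lemma nn_integral_real2:
  assumes [measurable]: "f \<in> borel_measurable borel"
  shows "(\<integral>\<^sup>+w. f (w :: real^2) \<partial>lborel) = (\<integral>\<^sup>+x. \<integral>\<^sup>+y. f (x *\<^sub>R axis 1 1 + y *\<^sub>R axis 2 1) \<partial>lborel \<partial>lborel)"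
proof -
  have "(\<integral>\<^sup>+w. f w \<partial>lborel) = (\<integral>\<^sup>+p. f (case p of (x, y) \<Rightarrow> x *\<^sub>R axis 1 1 + y *\<^sub>R axis 2 1) \<partial>(lborel \<Otimes>\<^sub>M lborel))"
    unfolding lborel_real2 by (rule nn_integral_distr) measurable
  also have "\<dots> = (\<integral>\<^sup>+x. \<integral>\<^sup>+y. f (case (x, y) of (x, y) \<Rightarrow> x *\<^sub>R axis 1 1 + y *\<^sub>R axis 2 1) \<partial>lborel \<partial>lborel)"
    by (rule lborel.nn_integral_fst[symmetric]) measurable
  finally show ?thesis by simp
qed

text \<open>The left-hand side is the integral of \<open>q\<close> over the range of
  \<open>g\<close>. An inequality is enough for the transport argument, so surjectivity is never
  discussed.\<close>

lemma nn_integral_change_of_variables_le: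
  fixes g :: "real^'m::{finite,wellorder} \<Rightarrow> real^'m::_" and q :: "real^'m::_ \<Rightarrow> real"
  assumes q: "integrable lborel q" "\<And>x. 0 \<le> q x"
    and [measurable]: "q \<in> borel_measurable borel" "g \<in> borel_measurable borel"
      "(\<lambda>x. det (matrix (g' x))) \<in> borel_measurable borel"
    and der: "\<And>x. (g has_derivative g' x) (at x)" and inj: "inj g"
  shows "(\<integral>\<^sup>+x. ennreal (\<bar>det (matrix (g' x))\<bar> * q (g x)) \<partial>lborel) \<le> (\<integral>\<^sup>+x. ennreal (q x) \<partial>lborel)"
proof -
  \<comment> \<open>The change-of-variables theorem is formulated for integrands with values in a
    Cartesian power, so \<open>q\<close> is viewed as a function into \<open>real^1\<close>.\<close>
  define f :: "real^'m::_ \<Rightarrow> real^1" where "f x = vec (q x)" for x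
  have qI: "(q has_integral integral\<^sup>L lborel q) UNIV"
    using q(1) by (rule has_integral_integral_lborel)
  have q_abs: "q absolutely_integrable_on UNIV"
    using q qI by (intro nonnegative_absolutely_integrable_1) auto
  have f_abs: "f absolutely_integrable_on UNIV"
    using q_abs unfolding f_def
    by (subst absolutely_integrable_componentwise_iff) (auto simp: Basis_vec_def inner_axis)
  have rng: "range g \<in> sets lebesgue"
    using der by (intro differentiable_image_in_sets_lebesgue) (auto simp: differentiable_on_def differentiable_def)
  have f_rng: "f absolutely_integrable_on range g"
    by (rule set_integrable_subset[OF f_abs rng]) simp
  have "(\<lambda>x. \<bar>det (matrix (g' x))\<bar> *\<^sub>R f (g x)) absolutely_integrable_on UNIV \<and>
           integral UNIV (\<lambda>x. \<bar>det (matrix (g' x))\<bar> *\<^sub>R f (g x)) = integral (range g) f"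
    by (rule iffD2[OF has_absolute_integral_change_of_variables[OF _ der inj]]) (use f_rng in simp_all)
  then have "((\<lambda>x. \<bar>det (matrix (g' x))\<bar> *\<^sub>R f (g x)) has_integral integral (range g) f) UNIV"
    using integrable_integral[OF set_lebesgue_integral_eq_integral(1)] by force
  from has_integral_linear[OF this bounded_linear_vec_nth[of 1]]
  have I1: "((\<lambda>x. \<bar>det (matrix (g' x))\<bar> * q (g x)) has_integral integral (range g) f $ 1) UNIV"
    by (simp add: o_def f_def)
  have "(f has_integral integral (range g) f) (range g)"
    by (rule integrable_integral[OF set_lebesgue_integral_eq_integral(1)[OF f_rng]])
  from has_integral_linear[OF this bounded_linear_vec_nth[of 1]]
  have I2: "(q has_integral integral (range g) f $ 1) (range g)"
    by (simp add: o_def f_def)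
  have "integral (range g) f $ 1 \<le> integral\<^sup>L lborel q"
    using q by (intro has_integral_subset_le[OF _ I2 qI]) simp_all
  moreover have "(\<integral>\<^sup>+x. ennreal (\<bar>det (matrix (g' x))\<bar> * q (g x)) \<partial>lborel) = ennreal (integral (range g) f $ 1)"
    using I1 q by (intro nn_integral_has_integral_lborel) auto
  moreover have "(\<integral>\<^sup>+x. ennreal (q x) \<partial>lborel) = ennreal (integral\<^sup>L lborel q)"
    using q by (intro nn_integral_eq_integral) auto
  ultimately show ?thesis by (simp add: ennreal_leI)
qed

text \<open>The integrand on the left is \<open>q\<close> composed with the map
  \<open>(y, z) \<mapsto> (a T1 y + b T3 (y + z), a T2 z + b T3 (y + z))\<close>, times the Jacobian of that map;
  the map is injective because the three functions are increasing.\<close>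

lemma nn_integral_transport_le:
  fixes T1 T2 T3 D1 D2 D3 :: "real \<Rightarrow> real" and q :: "real \<Rightarrow> real \<Rightarrow> real"
  assumes T: "\<And>x. (T1 has_real_derivative D1 x) (at x)" "\<And>x. (T2 has_real_derivative D2 x) (at x)"
      "\<And>x. (T3 has_real_derivative D3 x) (at x)"
    and pos: "\<And>x. 0 < D1 x" "\<And>x. 0 < D2 x" "\<And>x. 0 < D3 x"
    and meas[measurable]: "D1 \<in> borel_measurable borel" "D2 \<in> borel_measurable borel" "D3 \<in> borel_measurable borel"
    and ab: "0 < a" "0 < b"
    and q[measurable]: "case_prod q \<in> borel_measurable borel" and q0: "\<And>x y. 0 \<le> q x y"
    and fin: "(\<integral>\<^sup>+x. \<integral>\<^sup>+y. ennreal (q x y) \<partial>lborel \<partial>lborel) < \<infinity>"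
  shows "(\<integral>\<^sup>+y. \<integral>\<^sup>+z. ennreal ((a\<^sup>2 * (D1 y * D2 z) + a * b * (D3 (y + z) * (D1 y + D2 z))) *
            q (a * T1 y + b * T3 (y + z)) (a * T2 z + b * T3 (y + z))) \<partial>lborel \<partial>lborel)
         \<le> (\<integral>\<^sup>+x. \<integral>\<^sup>+y. ennreal (q x y) \<partial>lborel \<partial>lborel)"
proof -
  have contT: "continuous_on UNIV T1" "continuous_on UNIV T2" "continuous_on UNIV T3"
    using T[THEN DERIV_isCont] by (simp_all add: continuous_at_imp_continuous_on)
  note [measurable] = contT[THEN borel_measurable_continuous_onI]
  have smono: "strict_mono T" if "\<And>x. (T has_real_derivative D x) (at x)" "\<And>x. 0 < D x" for T D
    by (rule strict_monoI, rule DERIV_pos_imp_increasing) (use that in blast)+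
  note sm = smono[OF T(1) pos(1)] smono[OF T(2) pos(2)] smono[OF T(3) pos(3)]
  define g :: "real^2 \<Rightarrow> real^2" where
    "g w = (a * T1 (w $ 1) + b * T3 (w $ 1 + w $ 2)) *\<^sub>R axis 1 1 + (a * T2 (w $ 2) + b * T3 (w $ 1 + w $ 2)) *\<^sub>R axis 2 1" for w
  define g' :: "real^2 \<Rightarrow> real^2 \<Rightarrow> real^2" where
    "g' w h = (a * (D1 (w $ 1) * h $ 1) + b * (D3 (w $ 1 + w $ 2) * (h $ 1 + h $ 2))) *\<^sub>R axis 1 1
        + (a * (D2 (w $ 2) * h $ 2) + b * (D3 (w $ 1 + w $ 2) * (h $ 1 + h $ 2))) *\<^sub>R axis 2 1" for w h
  define Q :: "real^2 \<Rightarrow> real" where "Q w = q (w $ 1) (w $ 2)" for w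
  have [measurable]: "(\<lambda>w::real^2. w $ i) \<in> borel_measurable borel" for i
    by (intro borel_measurable_continuous_onI continuous_intros)
  have qm: "(\<lambda>x. q (f1 x) (f2 x)) \<in> borel_measurable M" if "f1 \<in> borel_measurable M" "f2 \<in> borel_measurable M" for f1 f2 and M :: "'z measure"
  proof -
    have "(\<lambda>x. case_prod q (f1 x, f2 x)) \<in> borel_measurable M"
      by (rule measurable_compose[OF _ q]) (use that in measurable)
    then show ?thesis by simp
  qed
  have [measurable]: "Q \<in> borel_measurable borel" "g \<in> borel_measurable borel"
    unfolding Q_def g_def by (intro qm) measurable
  have der: "(g has_derivative g' w) (at w)" for w
  proof -
    have c: "((\<lambda>w::real^2. T (p w)) has_derivative (\<lambda>h. D (p w) * p h)) (at w)"
      if "bounded_linear p" "\<And>x. (T has_real_derivative D x) (at x)" for T D and p :: "real^2 \<Rightarrow> real"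
      using has_derivative_compose[OF bounded_linear.has_derivative[OF that(1), OF has_derivative_ident] that(2)[unfolded has_field_derivative_def]]
      by simp
    have bl: "bounded_linear (\<lambda>w::real^2. w $ i)" "bounded_linear (\<lambda>w::real^2. w $ 1 + w $ 2)" for i
      by (auto intro!: bounded_linear_add bounded_linear_vec_nth)
    show ?thesis unfolding g_def g'_def
      by (intro has_derivative_add has_derivative_scaleR_left has_derivative_mult_right
          c[OF bl(1) T(1)] c[OF bl(1) T(2)] c[OF bl(2) T(3)])
  qed
  have det: "det (matrix (g' w)) = a\<^sup>2 * (D1 (w$1) * D2 (w$2)) + a * b * (D3 (w$1 + w$2) * (D1 (w$1) + D2 (w$2)))" for w
    unfolding det_2 by (simp add: matrix_def g'_def axis_def power2_eq_square algebra_simps)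
  have inj: "inj g"
  proof (rule injI)
    fix v w assume eq: "g v = g w"
    have e1: "a * T1 (v $ 1) + b * T3 (v $ 1 + v $ 2) = a * T1 (w $ 1) + b * T3 (w $ 1 + w $ 2)"
      using arg_cong[OF eq, of "\<lambda>x. x $ 1"] by (simp add: g_def axis_def)
    have e2: "a * T2 (v $ 2) + b * T3 (v $ 1 + v $ 2) = a * T2 (w $ 2) + b * T3 (w $ 1 + w $ 2)"
      using arg_cong[OF eq, of "\<lambda>x. x $ 2"] by (simp add: g_def axis_def)
    have mon: "c * T x < c * T y \<longleftrightarrow> x < y" if "strict_mono T" "0 < c" for c x y :: real and T :: "real \<Rightarrow> real"
      using that by (simp add: strict_mono_less)
    \<comment> \<open>A smaller first coordinate has to be compensated by a larger \<open>T3\<close>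
      term in the first equation. Then the sum of the coordinates is larger, hence so is the second
      coordinate, and both terms on the left of the second equation exceed those on the
      right.\<close>
    have step: "x $ 1 \<ge> y $ 1"
      if f1: "a * T1 (x $ 1) + b * T3 (x $ 1 + x $ 2) = a * T1 (y $ 1) + b * T3 (y $ 1 + y $ 2)"
        and f2: "a * T2 (x $ 2) + b * T3 (x $ 1 + x $ 2) = a * T2 (y $ 2) + b * T3 (y $ 1 + y $ 2)" for x y :: "real^2"
    proof (rule ccontr)
      assume "\<not> x $ 1 \<ge> y $ 1"
      then have lt: "x $ 1 < y $ 1" by simp
      then have "a * T1 (x $ 1) < a * T1 (y $ 1)" using mon[OF sm(1) ab(1)] by blast
      then have T3: "b * T3 (y $ 1 + y $ 2) < b * T3 (x $ 1 + x $ 2)" using f1 by linarith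
      then have "y $ 1 + y $ 2 < x $ 1 + x $ 2" using mon[OF sm(3) ab(2)] by blast
      then have "y $ 2 < x $ 2" using lt by linarith
      then have "a * T2 (y $ 2) < a * T2 (x $ 2)" using mon[OF sm(2) ab(1)] by blast
      then show False using f2 T3 by linarith
    qed
    have one: "v $ 1 = w $ 1" using step[OF e1 e2] step[OF e1[symmetric] e2[symmetric]] by simp
    have two: "v $ 2 = w $ 2"
    proof (rule linorder_cases[of "v $ 2" "w $ 2"])
      assume "v $ 2 < w $ 2"
      then have "a * T2 (v $ 2) < a * T2 (w $ 2)" "b * T3 (v $ 1 + v $ 2) < b * T3 (w $ 1 + w $ 2)"
        using mon[OF sm(2) ab(1)] mon[OF sm(3) ab(2)] one by auto
      then show ?thesis using e2 by linarith
    next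
      assume "w $ 2 < v $ 2"
      then have "a * T2 (w $ 2) < a * T2 (v $ 2)" "b * T3 (w $ 1 + w $ 2) < b * T3 (v $ 1 + v $ 2)"
        using mon[OF sm(2) ab(1)] mon[OF sm(3) ab(2)] one by auto
      then show ?thesis using e2 by linarith
    qed
    show "v = w" using one two by (simp add: vec_eq_iff forall_2)
  qed
  have Q: "(\<integral>\<^sup>+w. ennreal (Q w) \<partial>lborel) = (\<integral>\<^sup>+x. \<integral>\<^sup>+y. ennreal (q x y) \<partial>lborel \<partial>lborel)"
    by (subst nn_integral_real2) (measurable, simp add: Q_def axis_def)
  have "(\<integral>\<^sup>+w. ennreal (\<bar>det (matrix (g' w))\<bar> * Q (g w)) \<partial>lborel) \<le> (\<integral>\<^sup>+w. ennreal (Q w) \<partial>lborel)"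
  proof (rule nn_integral_change_of_variables_le)
    show "integrable lborel Q"
      using fin Q q0 by (intro integrableI_nonneg) (measurable, auto simp: Q_def)
    show "Q \<in> borel_measurable borel" "g \<in> borel_measurable borel" by measurable
    show "(\<lambda>x. det (matrix (g' x))) \<in> borel_measurable borel" unfolding det by measurable
    show "\<And>x. 0 \<le> Q x" by (simp add: Q_def q0)
  qed (fact der inj)+
  also have "(\<integral>\<^sup>+w. ennreal (\<bar>det (matrix (g' w))\<bar> * Q (g w)) \<partial>lborel) =
     (\<integral>\<^sup>+y. \<integral>\<^sup>+z. ennreal ((a\<^sup>2 * (D1 y * D2 z) + a * b * (D3 (y + z) * (D1 y + D2 z))) *
            q (a * T1 y + b * T3 (y + z)) (a * T2 z + b * T3 (y + z))) \<partial>lborel \<partial>lborel)"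
  proof (subst nn_integral_real2)
    show "(\<lambda>w. ennreal (\<bar>det (matrix (g' w))\<bar> * Q (g w))) \<in> borel_measurable borel"
      unfolding det by measurable
    have "0 \<le> a\<^sup>2 * (D1 y * D2 z) + a * b * (D3 (y + z) * (D1 y + D2 z))" for y z
      using ab less_imp_le[OF pos(1)] less_imp_le[OF pos(2)] less_imp_le[OF pos(3)] by simp
    then show "(\<integral>\<^sup>+ x. \<integral>\<^sup>+ y. ennreal (\<bar>det (matrix (g' (x *\<^sub>R axis 1 1 + y *\<^sub>R axis 2 1)))\<bar> * Q (g (x *\<^sub>R axis 1 1 + y *\<^sub>R axis 2 1))) \<partial>lborel \<partial>lborel) =
     (\<integral>\<^sup>+y. \<integral>\<^sup>+z. ennreal ((a\<^sup>2 * (D1 y * D2 z) + a * b * (D3 (y + z) * (D1 y + D2 z))) *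
            q (a * T1 y + b * T3 (y + z)) (a * T2 z + b * T3 (y + z))) \<partial>lborel \<partial>lborel)"
      unfolding det Q_def g_def by (simp add: axis_def)
  qed
  finally show ?thesis unfolding Q .
qed

section \<open>The one-dimensional inequality for continuous positive densities\<close>

text \<open>Constant of the sharp one-dimensional Young inequality
  \<open>\<integral>\<integral> F(y)\<^sup>\<alpha> G(z)\<^sup>\<alpha> H(y + z)\<^sup>\<beta> \<le> K (\<integral>F)\<^sup>\<alpha> (\<integral>G)\<^sup>\<alpha> (\<integral>H)\<^sup>\<beta>\<close> with \<open>2 \<alpha> + \<beta> = 2\<close>.\<close>

definition young_const :: "real \<Rightarrow> real" where
  "young_const \<alpha> = \<alpha> powr (- \<alpha>) * 2 powr (\<alpha> - 1) * (2 * \<alpha> - 1) powr (\<alpha> - 1 / 2)"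

text \<open>The exponents sum to 2, the number of integrations in the form below. This makes Young's
  inequality invariant under dilations.\<close>

abbreviation weighted :: "real \<Rightarrow> real \<Rightarrow> real \<Rightarrow> real \<Rightarrow> real" where
  "weighted \<alpha> a b c \<equiv> a powr \<alpha> * b powr \<alpha> * c powr (2 - 2 * \<alpha>)"

text \<open>The operation \<open>p\<close> stands for addition. It is a parameter because
  tensorisation passes through pairs and extensional functions, where sums are formed componentwise
  by explicit terms.\<close>

abbreviation trilinear ::
  "'a measure \<Rightarrow> ('a \<Rightarrow> 'a \<Rightarrow> 'a) \<Rightarrow> real \<Rightarrow> ('a \<Rightarrow> real) \<Rightarrow> ('a \<Rightarrow> real) \<Rightarrow> ('a \<Rightarrow> real) \<Rightarrow> ennreal" where
  "trilinear M p \<alpha> F G H \<equiv> (\<integral>\<^sup>+y. \<integral>\<^sup>+z. ennreal (weighted \<alpha> (F y) (G z) (H (p y z))) \<partial>M \<partial>M)"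

lemma young_const_nonneg: "0 \<le> young_const \<alpha>"
  by (simp add: young_const_def)

text \<open>Weighted AM-GM for the three products of two derivatives in the Jacobian, with weights
  \<open>2 \<alpha> - 1\<close>, \<open>1 - \<alpha>\<close>, \<open>1 - \<alpha>\<close>.\<close>

lemma jacobian_lower_bound:
  fixes d1 d2 d3 \<alpha> :: real
  assumes \<alpha>: "1 / 2 < \<alpha>" "\<alpha> < 1" and d: "0 < d1" "0 < d2" "0 < d3"
  shows "\<alpha> powr (2 * \<alpha> - 1) * (2 * \<alpha> * (2 * \<alpha> - 1)) powr (1 - \<alpha>) * (weighted \<alpha> d1 d2 d3)
    \<le> \<alpha> * (2 * \<alpha> - 1) * (d1 * d2) + sqrt (2 * \<alpha> * (2 * \<alpha> - 1)) * (1 - \<alpha>) * (d3 * (d1 + d2))"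
proof -
  define s where "s = 2 * \<alpha> * (2 * \<alpha> - 1)"
  have s: "0 < s" using \<alpha> by (simp add: s_def)
  \<comment> \<open>The products \<open>d3 * d1\<close> and \<open>d3 * d2\<close> have equal weight
    and are first replaced by their geometric mean, which is \<open>Y / sqrt s\<close>. Two-term
    Young with weights \<open>2 * \<alpha> - 1\<close> and \<open>2 - 2 * \<alpha>\<close> then
    suffices.\<close>
  define X where "X = \<alpha> * (d1 * d2)"
  define Y where "Y = sqrt s * (d3 * sqrt (d1 * d2))"
  have "X powr (2 * \<alpha> - 1) * Y powr (2 - 2 * \<alpha>) \<le> (2 * \<alpha> - 1) * X + (2 - 2 * \<alpha>) * Y"
    using \<alpha> d s by (intro Youngs_inequality_0) (auto simp: X_def Y_def)
  also have "(2 - 2 * \<alpha>) * Y \<le> sqrt s * (1 - \<alpha>) * (d3 * (d1 + d2))"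
  proof -
    have "2 * sqrt (d1 * d2) \<le> d1 + d2"
      using arith_geo_mean_sqrt[of d1 d2] d by simp
    then have "(sqrt s * (1 - \<alpha>) * d3) * (2 * sqrt (d1 * d2)) \<le> (sqrt s * (1 - \<alpha>) * d3) * (d1 + d2)"
      using \<alpha> d s by (intro mult_left_mono) auto
    then show ?thesis by (simp add: Y_def algebra_simps)
  qed
  also have "X powr (2 * \<alpha> - 1) * Y powr (2 - 2 * \<alpha>)
     = \<alpha> powr (2 * \<alpha> - 1) * s powr (1 - \<alpha>) * (weighted \<alpha> d1 d2 d3)"
  proof -
    have e: "x powr (2 * \<alpha> - 1) * x powr (1 - \<alpha>) = x powr \<alpha>" if "x > 0" for x :: real
      using that by (simp add: powr_add[symmetric])
    have h: "sqrt x powr (2 - 2 * \<alpha>) = x powr (1 - \<alpha>)" if "x > 0" for x :: real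
    proof -
      have "sqrt x powr (2 - 2 * \<alpha>) = (x powr (1/2)) powr (2 - 2 * \<alpha>)" using that by (simp add: powr_half_sqrt)
      also have "\<dots> = x powr (1 - \<alpha>)" by (simp add: powr_powr algebra_simps)
      finally show ?thesis .
    qed
    have "X powr (2 * \<alpha> - 1) * Y powr (2 - 2 * \<alpha>) =
       \<alpha> powr (2 * \<alpha> - 1) * s powr (1 - \<alpha>) * ((d1 powr (2 * \<alpha> - 1) * d1 powr (1 - \<alpha>)) * (d2 powr (2 * \<alpha> - 1) * d2 powr (1 - \<alpha>)) * d3 powr (2 - 2 * \<alpha>))"
      using \<alpha> d s by (simp add: X_def Y_def powr_mult h real_sqrt_mult)
    then show ?thesis using d by (simp add: e)
  qed
  finally show ?thesis by (simp add: X_def s_def algebra_simps)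
qed

text \<open>The left-hand side is the smallest value of the right-hand side over all triples with the same
  two combinations \<open>a t1 + b t3\<close>, \<open>a t2 + b t3\<close>. The constants \<open>a\<close> and \<open>b\<close> are those for which this and
  the AM-GM step are equalities for the same linear transport maps.\<close>

lemma gaussian_form_le:
  fixes \<alpha> t1 t2 t3 :: real
  assumes \<alpha>: "1 / 2 < \<alpha>" "\<alpha> < 1"
  defines "a \<equiv> sqrt (\<alpha> * (2 * \<alpha> - 1))" and "b \<equiv> sqrt 2 * (1 - \<alpha>)"
  shows "\<alpha> / (2 * \<alpha> - 1) * ((a * t1 + b * t3) - (1 - \<alpha>) / \<alpha> * (a * t2 + b * t3))\<^sup>2 + (a * t2 + b * t3)\<^sup>2 / \<alpha>
    \<le> \<alpha> * t1\<^sup>2 + \<alpha> * t2\<^sup>2 + (2 - 2 * \<alpha>) * t3\<^sup>2"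
proof -
  define r where "r = sqrt (2 * \<alpha> * (2 * \<alpha> - 1))"
  have a2: "a * a = \<alpha> * (2 * \<alpha> - 1)" and b2: "b * b = 2 * (1 - \<alpha>) * (1 - \<alpha>)"
    using \<alpha> by (simp_all add: a_def b_def algebra_simps)
  have ab: "a * b = r * (1 - \<alpha>)"
    unfolding a_def b_def r_def mult.assoc[of 2] real_sqrt_mult[of 2] by (simp only: mult_ac)
  have r2: "r * r = 2 * \<alpha> * (2 * \<alpha> - 1)"
    using \<alpha> by (simp add: r_def)
  define u v where "u = a * t1 + b * t3" and "v = a * t2 + b * t3"
  have uu: "u * u = \<alpha> * (2 * \<alpha> - 1) * t1\<^sup>2 + 2 * (r * (1 - \<alpha>)) * (t1 * t3) + 2 * (1 - \<alpha>) * (1 - \<alpha>) * t3\<^sup>2"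
  proof -
    have "u * u = (a * a) * t1\<^sup>2 + 2 * (a * b) * (t1 * t3) + (b * b) * t3\<^sup>2" by (simp add: u_def power2_eq_square algebra_simps)
    then show ?thesis by (simp only: a2 b2 ab)
  qed
  have vv: "v * v = \<alpha> * (2 * \<alpha> - 1) * t2\<^sup>2 + 2 * (r * (1 - \<alpha>)) * (t2 * t3) + 2 * (1 - \<alpha>) * (1 - \<alpha>) * t3\<^sup>2"
  proof -
    have "v * v = (a * a) * t2\<^sup>2 + 2 * (a * b) * (t2 * t3) + (b * b) * t3\<^sup>2" by (simp add: v_def power2_eq_square algebra_simps)
    then show ?thesis by (simp only: a2 b2 ab)
  qed
  have uv: "u * v = \<alpha> * (2 * \<alpha> - 1) * (t1 * t2) + (r * (1 - \<alpha>)) * ((t1 + t2) * t3) + 2 * (1 - \<alpha>) * (1 - \<alpha>) * t3\<^sup>2"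
  proof -
    have "u * v = (a * a) * (t1 * t2) + (a * b) * ((t1 + t2) * t3) + (b * b) * t3\<^sup>2" by (simp add: u_def v_def power2_eq_square algebra_simps)
    then show ?thesis by (simp only: a2 b2 ab)
  qed
  define Q where "Q = (\<alpha> * (u * u) + \<alpha> * (v * v) - 2 * (1 - \<alpha>) * (u * v)) / (2 * \<alpha> - 1)"
  have nz: "2 * \<alpha> - 1 \<noteq> 0" "\<alpha> \<noteq> 0" using \<alpha> by auto
  have Q: "\<alpha> / (2 * \<alpha> - 1) * (u - (1 - \<alpha>) / \<alpha> * v)\<^sup>2 + v\<^sup>2 / \<alpha> = Q"
    using nz by (simp add: Q_def divide_simps power2_eq_square) (simp add: algebra_simps)
  \<comment> \<open>The right-hand side of the claim exceeds the left by exactly this quantity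
    divided by \<open>\<alpha>\<close>. It vanishes when \<open>T1\<close> and \<open>T2\<close> are
    linear with a common slope \<open>d\<close> and \<open>T3\<close> is linear with slope
    \<open>\<alpha> * d / r\<close>; for these slopes \<open>jacobian_lower_bound\<close> is an
    equality as well, which is why no sharpness is lost.\<close>
  have sq: "0 \<le> (1 - \<alpha>) * (\<alpha> * (t1 + t2) - r * t3)\<^sup>2"
    using \<alpha> by simp
  have sqe: "(\<alpha> * (t1 + t2) - r * t3)\<^sup>2 = \<alpha> * \<alpha> * (t1 + t2)\<^sup>2 - 2 * \<alpha> * r * ((t1 + t2) * t3) + (r * r) * t3\<^sup>2"
    by (simp add: power2_eq_square algebra_simps)
  have "(2 * \<alpha> - 1) * \<alpha> * (\<alpha> * t1\<^sup>2 + \<alpha> * t2\<^sup>2 + (2 - 2 * \<alpha>) * t3\<^sup>2)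
      - \<alpha> * (\<alpha> * (u * u) + \<alpha> * (v * v) - 2 * (1 - \<alpha>) * (u * v)) = (2 * \<alpha> - 1) * (1 - \<alpha>) * (\<alpha> * (t1 + t2) - r * t3)\<^sup>2"
    unfolding uu vv uv sqe r2 by (simp add: power2_eq_square algebra_simps)
  also have "\<dots> \<ge> 0" using sq \<alpha> by (simp add: mult.assoc)
  finally have "\<alpha> * (\<alpha> * (u * u) + \<alpha> * (v * v) - 2 * (1 - \<alpha>) * (u * v)) \<le> \<alpha> * ((2 * \<alpha> - 1) * (\<alpha> * t1\<^sup>2 + \<alpha> * t2\<^sup>2 + (2 - 2 * \<alpha>) * t3\<^sup>2))"
    by (simp add: mult_ac)
  then have "Q \<le> \<alpha> * t1\<^sup>2 + \<alpha> * t2\<^sup>2 + (2 - 2 * \<alpha>) * t3\<^sup>2"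
    using \<alpha> unfolding Q_def by (subst pos_divide_le_eq) (simp_all add: mult_ac)
  then show ?thesis using Q by (simp add: u_def v_def)
qed

text \<open>The quadratic form is kept with the square in \<open>u\<close> completed, so the inner
  integral is a shifted Gaussian whose value does not depend on the shift.\<close>

lemma nn_integral_gaussian_form:
  fixes \<alpha> :: real
  assumes \<alpha>: "1 / 2 < \<alpha>" "\<alpha> < 1"
  shows "(\<integral>\<^sup>+v. \<integral>\<^sup>+u. ennreal (exp (- (\<alpha> / (2 * \<alpha> - 1) * (u - (1 - \<alpha>) / \<alpha> * v)\<^sup>2 + v\<^sup>2 / \<alpha>))) \<partial>lborel \<partial>lborel)
     = ennreal (pi * sqrt (2 * \<alpha> - 1))"
proof -
  define c where "c = \<alpha> / (2 * \<alpha> - 1)"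
  have c: "c > 0" using \<alpha> by (simp add: c_def)
  have "(\<integral>\<^sup>+u. ennreal (exp (- (c * (u - (1 - \<alpha>) / \<alpha> * v)\<^sup>2 + v\<^sup>2 / \<alpha>))) \<partial>lborel)
      = ennreal (sqrt (pi / c)) * ennreal (exp (- (1 / \<alpha>) * (v - 0)\<^sup>2))" for v
  proof -
    have "(\<integral>\<^sup>+u. ennreal (exp (- (c * (u - (1 - \<alpha>) / \<alpha> * v)\<^sup>2 + v\<^sup>2 / \<alpha>))) \<partial>lborel)
      = (\<integral>\<^sup>+u. ennreal (exp (- c * (u - (1 - \<alpha>) / \<alpha> * v)\<^sup>2)) * ennreal (exp (- (1 / \<alpha>) * (v - 0)\<^sup>2)) \<partial>lborel)"
      by (intro nn_integral_cong) (simp add: ennreal_mult[symmetric] mult_exp_exp)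
    also have "\<dots> = (\<integral>\<^sup>+u. ennreal (exp (- c * (u - (1 - \<alpha>) / \<alpha> * v)\<^sup>2)) \<partial>lborel) * ennreal (exp (- (1 / \<alpha>) * (v - 0)\<^sup>2))"
      by (rule nn_integral_multc) measurable
    also have "(\<integral>\<^sup>+u. ennreal (exp (- c * (u - (1 - \<alpha>) / \<alpha> * v)\<^sup>2)) \<partial>lborel) = ennreal (sqrt (pi / c))"
      by (rule nn_integral_gauss_scaled[OF c])
    finally show ?thesis .
  qed
  then have "(\<integral>\<^sup>+v. \<integral>\<^sup>+u. ennreal (exp (- (c * (u - (1 - \<alpha>) / \<alpha> * v)\<^sup>2 + v\<^sup>2 / \<alpha>))) \<partial>lborel \<partial>lborel)
      = (\<integral>\<^sup>+v. ennreal (sqrt (pi / c)) * ennreal (exp (- (1 / \<alpha>) * (v - 0)\<^sup>2)) \<partial>lborel)" by simp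
  also have "\<dots> = ennreal (sqrt (pi / c)) * (\<integral>\<^sup>+v. ennreal (exp (- (1 / \<alpha>) * (v - 0)\<^sup>2)) \<partial>lborel)"
    by (rule nn_integral_cmult) measurable
  also have "(\<integral>\<^sup>+v. ennreal (exp (- (1 / \<alpha>) * (v - 0)\<^sup>2)) \<partial>lborel) = ennreal (sqrt (pi / (1 / \<alpha>)))"
    using \<alpha> by (intro nn_integral_gauss_scaled) simp
  also have "ennreal (sqrt (pi / c)) * ennreal (sqrt (pi / (1 / \<alpha>))) = ennreal (sqrt (pi / c * (pi / (1 / \<alpha>))))"
    using \<alpha> c by (simp add: ennreal_mult[symmetric] real_sqrt_mult real_sqrt_divide)
  also have "pi / c * (pi / (1 / \<alpha>)) = pi\<^sup>2 * (2 * \<alpha> - 1)"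
    using \<alpha> by (simp add: c_def power2_eq_square field_simps)
  also have "sqrt (pi\<^sup>2 * (2 * \<alpha> - 1)) = pi * sqrt (2 * \<alpha> - 1)"
    by (simp add: real_sqrt_mult)
  finally show ?thesis by (simp add: c_def)
qed

text \<open>This is where the constant originates: \<open>sqrt (2 * \<alpha> - 1)\<close> comes from
  the Gaussian integral of the quadratic form, the denominator from the AM-GM bound on the
  Jacobian.\<close>

lemma young_const_alt:
  assumes \<alpha>: "1 / 2 < \<alpha>" "\<alpha> < (1::real)"
  shows "sqrt (2 * \<alpha> - 1) / (\<alpha> powr (2 * \<alpha> - 1) * (2 * \<alpha> * (2 * \<alpha> - 1)) powr (1 - \<alpha>)) = young_const \<alpha>"
proof -
  have s: "sqrt (2 * \<alpha> - 1) = (2 * \<alpha> - 1) powr (1/2)" using \<alpha> by (subst powr_half_sqrt) auto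
  have m: "(2 * \<alpha> * (2 * \<alpha> - 1)) powr (1 - \<alpha>) = 2 powr (1 - \<alpha>) * \<alpha> powr (1 - \<alpha>) * (2 * \<alpha> - 1) powr (1 - \<alpha>)"
    using \<alpha> by (simp only: powr_mult)
  have "sqrt (2 * \<alpha> - 1) / (\<alpha> powr (2 * \<alpha> - 1) * (2 * \<alpha> * (2 * \<alpha> - 1)) powr (1 - \<alpha>))
     = (2 * \<alpha> - 1) powr (1/2) * (\<alpha> powr (- (2 * \<alpha> - 1)) * (2 powr (-(1-\<alpha>)) * \<alpha> powr (-(1-\<alpha>)) * (2 * \<alpha> - 1) powr (- (1 - \<alpha>))))"
    unfolding s m divide_inverse inverse_mult_distrib powr_minus ..
  also have "\<dots> = (\<alpha> powr (- (2 * \<alpha> - 1)) * \<alpha> powr (-(1-\<alpha>))) * 2 powr (-(1-\<alpha>)) * ((2 * \<alpha> - 1) powr (1/2) * (2 * \<alpha> - 1) powr (- (1 - \<alpha>)))"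
    by (simp only: mult_ac)
  also have "\<dots> = young_const \<alpha>"
    unfolding young_const_def powr_add[symmetric] by (simp add: algebra_simps)
  finally show ?thesis .
qed

text \<open>Each function is written as the derivative of its transport map times the Gaussian at
  the image point. The weighted product of the derivatives is bounded by the Jacobian, that of the
  Gaussians by \<open>q\<close> at the image. Together they form the integrand of a change of
  variables, whose integral is at most that of \<open>q\<close>. The mass \<open>sqrt pi\<close> is
  that of \<open>exp (- x\<^sup>2)\<close>.\<close>

lemma young_real_normalized:
  fixes F G H :: "real \<Rightarrow> real"
  assumes F: "continuous_on UNIV F" "\<And>x. 0 < F x" "integrable lborel F" "integral\<^sup>L lborel F = sqrt pi"
    and G: "continuous_on UNIV G" "\<And>x. 0 < G x" "integrable lborel G" "integral\<^sup>L lborel G = sqrt pi"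
    and H: "continuous_on UNIV H" "\<And>x. 0 < H x" "integrable lborel H" "integral\<^sup>L lborel H = sqrt pi"
    and \<alpha>: "1 / 2 < \<alpha>" "\<alpha> < 1"
  shows "trilinear lborel (+) \<alpha> F G H
    \<le> ennreal (young_const \<alpha> * pi)"
proof -
  define \<gamma> :: "real \<Rightarrow> real" where "\<gamma> x = exp (- x\<^sup>2)" for x
  have \<gamma>: "continuous_on UNIV \<gamma>" "\<And>x. 0 < \<gamma> x" "integrable lborel \<gamma>" "integral\<^sup>L lborel \<gamma> = sqrt pi"
    using integrable_gauss integral_gauss unfolding \<gamma>_def by (auto intro!: continuous_intros)
  obtain T1 where T1: "\<And>x. (T1 has_real_derivative F x / \<gamma> (T1 x)) (at x)"
    using monotone_transport[OF F(1-3) \<gamma>(1-3)] F(4) \<gamma>(4) by auto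
  obtain T2 where T2: "\<And>x. (T2 has_real_derivative G x / \<gamma> (T2 x)) (at x)"
    using monotone_transport[OF G(1-3) \<gamma>(1-3)] G(4) \<gamma>(4) by auto
  obtain T3 where T3: "\<And>x. (T3 has_real_derivative H x / \<gamma> (T3 x)) (at x)"
    using monotone_transport[OF H(1-3) \<gamma>(1-3)] H(4) \<gamma>(4) by auto
  have contT: "continuous_on UNIV T1" "continuous_on UNIV T2" "continuous_on UNIV T3"
    using DERIV_isCont[OF T1] DERIV_isCont[OF T2] DERIV_isCont[OF T3] by (simp_all add: continuous_at_imp_continuous_on)
  note [measurable] = contT[THEN borel_measurable_continuous_onI] F(1)[THEN borel_measurable_continuous_onI]
    G(1)[THEN borel_measurable_continuous_onI] H(1)[THEN borel_measurable_continuous_onI] \<gamma>(1)[THEN borel_measurable_continuous_onI]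
  define D1 where "D1 x = F x / \<gamma> (T1 x)" for x
  define D2 where "D2 x = G x / \<gamma> (T2 x)" for x
  define D3 where "D3 x = H x / \<gamma> (T3 x)" for x
  have D: "0 < D1 x" "0 < D2 x" "0 < D3 x" for x
    using F(2) G(2) H(2) \<gamma>(2) by (auto simp: D1_def D2_def D3_def)
  have [measurable]: "D1 \<in> borel_measurable borel" "D2 \<in> borel_measurable borel" "D3 \<in> borel_measurable borel"
    unfolding D1_def D2_def D3_def by measurable
  define a where "a = sqrt (\<alpha> * (2 * \<alpha> - 1))"
  define b where "b = sqrt 2 * (1 - \<alpha>)"
  have ab: "0 < a" "0 < b" using \<alpha> by (auto simp: a_def b_def)
  have a2: "a\<^sup>2 = \<alpha> * (2 * \<alpha> - 1)" using \<alpha> by (simp add: a_def)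
  have ab': "a * b = sqrt (2 * \<alpha> * (2 * \<alpha> - 1)) * (1 - \<alpha>)"
    unfolding a_def b_def mult.assoc[of 2] real_sqrt_mult[of 2] by (simp only: mult_ac)
  define q where "q u v = exp (- (\<alpha> / (2 * \<alpha> - 1) * (u - (1 - \<alpha>) / \<alpha> * v)\<^sup>2 + v\<^sup>2 / \<alpha>))" for u v
  have [measurable]: "case_prod q \<in> borel_measurable borel"
    unfolding q_def borel_prod[symmetric] by measurable
  have q0: "0 \<le> q u v" for u v by (simp add: q_def)
  have Iq: "(\<integral>\<^sup>+u. \<integral>\<^sup>+v. ennreal (q u v) \<partial>lborel \<partial>lborel) = ennreal (pi * sqrt (2 * \<alpha> - 1))"
    unfolding nn_integral_gaussian_form[OF \<alpha>, symmetric]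
    by (subst lborel_pair.Fubini') (auto simp: q_def)
  define \<kappa> where "\<kappa> = \<alpha> powr (2 * \<alpha> - 1) * (2 * \<alpha> * (2 * \<alpha> - 1)) powr (1 - \<alpha>)"
  have \<kappa>: "0 < \<kappa>" using \<alpha> by (simp add: \<kappa>_def)
  define Jac where "Jac y z = (a\<^sup>2 * (D1 y * D2 z) + a * b * (D3 (y + z) * (D1 y + D2 z))) *
            q (a * T1 y + b * T3 (y + z)) (a * T2 z + b * T3 (y + z))" for y z
  have pw: "weighted \<alpha> (F y) (G z) (H (y + z)) \<le> 1 / \<kappa> * Jac y z" for y z
  proof -
    have e: "\<gamma> x powr c = exp (- (c * x\<^sup>2))" for x c by (simp add: \<gamma>_def powr_def)
    have "weighted \<alpha> (F y) (G z) (H (y + z)) =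
weighted \<alpha> (D1 y * \<gamma> (T1 y)) (D2 z * \<gamma> (T2 z)) (D3 (y + z) * \<gamma> (T3 (y + z)))"
      using \<gamma>(2) by (simp add: D1_def D2_def D3_def less_imp_neq[THEN not_sym])
    also have "\<dots> = (weighted \<alpha> (D1 y) (D2 z) (D3 (y + z))) *
       (weighted \<alpha> (\<gamma> (T1 y)) (\<gamma> (T2 z)) (\<gamma> (T3 (y + z))))"
      using D \<gamma>(2) by (simp add: powr_mult less_imp_le mult_ac)
    also have "weighted \<alpha> (\<gamma> (T1 y)) (\<gamma> (T2 z)) (\<gamma> (T3 (y + z))) =
      exp (- (\<alpha> * (T1 y)\<^sup>2 + \<alpha> * (T2 z)\<^sup>2 + (2 - 2 * \<alpha>) * (T3 (y + z))\<^sup>2))"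
      unfolding e mult_exp_exp by (rule arg_cong[of _ _ exp]) simp
    also have "\<dots> \<le> q (a * T1 y + b * T3 (y + z)) (a * T2 z + b * T3 (y + z))"
      unfolding q_def using gaussian_form_le[OF \<alpha>, of "T1 y" "T3 (y + z)" "T2 z"] by (simp add: a_def b_def)
    also have "weighted \<alpha> (D1 y) (D2 z) (D3 (y + z))
       \<le> 1 / \<kappa> * (a\<^sup>2 * (D1 y * D2 z) + a * b * (D3 (y + z) * (D1 y + D2 z)))"
      using jacobian_lower_bound[OF \<alpha> D(1) D(2) D(3), of y z "y + z"] \<kappa>
      unfolding a2 ab' \<kappa>_def[symmetric] by (simp add: field_simps)
    finally show ?thesis by (simp add: Jac_def mult_ac mult_left_mono mult_right_mono q0)
  qed
  have "trilinear lborel (+) \<alpha> F G H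
     \<le> (\<integral>\<^sup>+y. \<integral>\<^sup>+z. ennreal (1 / \<kappa> * Jac y z) \<partial>lborel \<partial>lborel)"
    by (intro nn_integral_mono ennreal_leI pw)
  also have "\<dots> = ennreal (1 / \<kappa>) * (\<integral>\<^sup>+y. \<integral>\<^sup>+z. ennreal (Jac y z) \<partial>lborel \<partial>lborel)"
  proof -
    have J0: "0 \<le> Jac y z" for y z
      unfolding Jac_def using ab less_imp_le[OF D(1)] less_imp_le[OF D(2)] less_imp_le[OF D(3)] q0 by simp
    have Jm[measurable]: "(\<lambda>(y, z). Jac y z) \<in> borel_measurable (borel \<Otimes>\<^sub>M borel)"
      unfolding Jac_def q_def by measurable
    show ?thesis
      using \<kappa> J0 by (simp only: ennreal_mult[of "1 / \<kappa>"] less_imp_le zero_le_divide_1_iff) (simp add: nn_integral_cmult)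
  qed
  also have "(\<integral>\<^sup>+y. \<integral>\<^sup>+z. ennreal (Jac y z) \<partial>lborel \<partial>lborel) \<le> ennreal (pi * sqrt (2 * \<alpha> - 1))"
    unfolding Jac_def Iq[symmetric]
    by (rule nn_integral_transport_le) (use D ab q0 T1 T2 T3 Iq in \<open>auto simp: D1_def D2_def D3_def\<close>)
  also have "ennreal (1 / \<kappa>) * ennreal (pi * sqrt (2 * \<alpha> - 1)) = ennreal (young_const \<alpha> * pi)"
    using \<kappa> \<alpha> unfolding young_const_alt[OF \<alpha>, symmetric] \<kappa>_def[symmetric]
    by (subst ennreal_mult[symmetric]) (auto simp: mult_ac)
  finally show ?thesis by (simp add: mult_left_mono)
qed

lemma young_real_continuous:
  fixes F G H :: "real \<Rightarrow> real"
  assumes F: "continuous_on UNIV F" "\<And>x. 0 < F x" "integrable lborel F"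
    and G: "continuous_on UNIV G" "\<And>x. 0 < G x" "integrable lborel G"
    and H: "continuous_on UNIV H" "\<And>x. 0 < H x" "integrable lborel H"
    and \<alpha>: "1 / 2 < \<alpha>" "\<alpha> < 1"
  shows "trilinear lborel (+) \<alpha> F G H
    \<le> ennreal (young_const \<alpha> * (weighted \<alpha> (integral\<^sup>L lborel F) (integral\<^sup>L lborel G) (integral\<^sup>L lborel H)))"
proof -
  have pos: "0 < integral\<^sup>L lborel f" if "continuous_on UNIV f" "\<And>x. 0 < f x" "integrable lborel f" for f :: "real \<Rightarrow> real"
    using cumul_bounds[OF that, of 0] by linarith
  define A where "A = integral\<^sup>L lborel F / sqrt pi"
  define B where "B = integral\<^sup>L lborel G / sqrt pi"
  define C where "C = integral\<^sup>L lborel H / sqrt pi"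
  have ABC: "0 < A" "0 < B" "0 < C" using pos[OF F] pos[OF G] pos[OF H] by (auto simp: A_def B_def C_def)
  define M where "M = weighted \<alpha> A B C"
  have M: "0 < M" using ABC by (simp add: M_def)
  note [measurable] = F(1)[THEN borel_measurable_continuous_onI]
    G(1)[THEN borel_measurable_continuous_onI] H(1)[THEN borel_measurable_continuous_onI]
  have n: "(\<integral>\<^sup>+y. \<integral>\<^sup>+z. ennreal (weighted \<alpha> (F y / A) (G z / B) (H (y + z) / C)) \<partial>lborel \<partial>lborel)
    \<le> ennreal (young_const \<alpha> * pi)"
    using F G H ABC pos[OF F] pos[OF G] pos[OF H]
    by (intro young_real_normalized \<alpha>) (auto intro!: continuous_intros simp: A_def B_def C_def)
  have "trilinear lborel (+) \<alpha> F G H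
    = (\<integral>\<^sup>+y. \<integral>\<^sup>+z. ennreal M * ennreal (weighted \<alpha> (F y / A) (G z / B) (H (y + z) / C)) \<partial>lborel \<partial>lborel)"
    using ABC less_imp_le[OF F(2)] less_imp_le[OF G(2)] less_imp_le[OF H(2)]
    by (intro nn_integral_cong, subst ennreal_mult[symmetric]) (auto simp: M_def powr_divide)
  also have "\<dots> = ennreal M * (\<integral>\<^sup>+y. \<integral>\<^sup>+z. ennreal (weighted \<alpha> (F y / A) (G z / B) (H (y + z) / C)) \<partial>lborel \<partial>lborel)"
    by (simp add: nn_integral_cmult)
  also have "\<dots> \<le> ennreal M * ennreal (young_const \<alpha> * pi)"
    using n by (rule mult_left_mono) simp
  also have "\<dots> = ennreal (M * (young_const \<alpha> * pi))"
    using M by (simp add: ennreal_mult young_const_nonneg)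
  also have "M * (young_const \<alpha> * pi) = young_const \<alpha> * (weighted \<alpha> (integral\<^sup>L lborel F) (integral\<^sup>L lborel G) (integral\<^sup>L lborel H))"
  proof -
    \<comment> \<open>Because the exponents sum to 2, the factor \<open>pi\<close> absorbs the
      normalisation of all three masses at once.\<close>
    have "pi = sqrt pi powr 2" by simp
    also have "\<dots> = sqrt pi powr (\<alpha> + \<alpha> + (2 - 2 * \<alpha>))" by simp
    also have "\<dots> = weighted \<alpha> (sqrt pi) (sqrt pi) (sqrt pi)" by (simp only: powr_add)
    finally have p: "pi = weighted \<alpha> (sqrt pi) (sqrt pi) (sqrt pi)" .
    show ?thesis unfolding M_def
      by (subst p) (use pos[OF F] pos[OF G] pos[OF H] in \<open>simp add: A_def B_def C_def powr_divide\<close>)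
  qed
  finally show ?thesis .
qed

text \<open>The masses are passed as nonnegative reals, so that \<open>powr\<close> applies to them
  and finiteness of the three integrals is part of the hypothesis.\<close>

definition young_holds :: "'a measure \<Rightarrow> ('a \<Rightarrow> 'a \<Rightarrow> 'a) \<Rightarrow> real \<Rightarrow> real \<Rightarrow> bool" where
  "young_holds M p \<alpha> K \<longleftrightarrow> (\<forall>F G H A B C.
     F \<in> borel_measurable M \<longrightarrow> G \<in> borel_measurable M \<longrightarrow> H \<in> borel_measurable M \<longrightarrow>
     (\<forall>x. 0 \<le> F x) \<longrightarrow> (\<forall>x. 0 \<le> G x) \<longrightarrow> (\<forall>x. 0 \<le> H x) \<longrightarrow>
     0 \<le> A \<longrightarrow> 0 \<le> B \<longrightarrow> 0 \<le> C \<longrightarrow>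
     (\<integral>\<^sup>+x. ennreal (F x) \<partial>M) = ennreal A \<longrightarrow> (\<integral>\<^sup>+x. ennreal (G x) \<partial>M) = ennreal B \<longrightarrow>
     (\<integral>\<^sup>+x. ennreal (H x) \<partial>M) = ennreal C \<longrightarrow>
     trilinear M p \<alpha> F G H
       \<le> ennreal (K * weighted \<alpha> A B C))"

lemma young_holdsI:
  assumes "\<And>F G H A B C. F \<in> borel_measurable M \<Longrightarrow> G \<in> borel_measurable M \<Longrightarrow> H \<in> borel_measurable M \<Longrightarrow>
     (\<And>x. 0 \<le> F x) \<Longrightarrow> (\<And>x. 0 \<le> G x) \<Longrightarrow> (\<And>x. 0 \<le> H x) \<Longrightarrow>
     0 \<le> A \<Longrightarrow> 0 \<le> B \<Longrightarrow> 0 \<le> C \<Longrightarrow>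
     (\<integral>\<^sup>+x. ennreal (F x) \<partial>M) = ennreal A \<Longrightarrow> (\<integral>\<^sup>+x. ennreal (G x) \<partial>M) = ennreal B \<Longrightarrow>
     (\<integral>\<^sup>+x. ennreal (H x) \<partial>M) = ennreal C \<Longrightarrow>
     trilinear M p \<alpha> F G H
       \<le> ennreal (K * weighted \<alpha> A B C)"
  shows "young_holds M p \<alpha> K"
  unfolding young_holds_def by (intro allI impI assms) auto

lemma young_holdsD:
  assumes "young_holds M p \<alpha> K" "F \<in> borel_measurable M" "G \<in> borel_measurable M" "H \<in> borel_measurable M"
     "\<And>x. 0 \<le> F x" "\<And>x. 0 \<le> G x" "\<And>x. 0 \<le> H x" "0 \<le> A" "0 \<le> B" "0 \<le> C"
     "(\<integral>\<^sup>+x. ennreal (F x) \<partial>M) = ennreal A" "(\<integral>\<^sup>+x. ennreal (G x) \<partial>M) = ennreal B"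
     "(\<integral>\<^sup>+x. ennreal (H x) \<partial>M) = ennreal C"
  shows "trilinear M p \<alpha> F G H
       \<le> ennreal (K * weighted \<alpha> A B C)"
  using assms(1)[unfolded young_holds_def, rule_format, OF assms(2-13)] .

section \<open>Young's inequality for measurable functions and in higher dimension\<close>

lemma AE_lborel_translate:
  fixes c :: "'a::euclidean_space"
  assumes "AE x in lborel. P x"
  shows "AE x in lborel. P (c + x)"
proof (rule AE_distrD[where M' = borel and f = "\<lambda>x. c + x" and M = lborel])
  show "AE x in distr lborel borel ((+) c). P x" unfolding lborel_distr_plus by (rule assms)
qed simp

lemma positive_continuous_approx:
  fixes F :: "real \<Rightarrow> real"
  assumes F: "integrable lborel F" "\<And>x. 0 \<le> F x"
  obtains f :: "nat \<Rightarrow> real \<Rightarrow> real" where "\<And>n. continuous_on UNIV (f n)" "\<And>n x. 0 < f n x"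
    "\<And>n. integrable lborel (f n)" "(\<lambda>n. integral\<^sup>L lborel (f n)) \<longlonglongrightarrow> integral\<^sup>L lborel F"
    "AE x in lborel. (\<lambda>n. f n x) \<longlonglongrightarrow> F x"
proof -
  have "\<exists>g. continuous_on UNIV g \<and> integrable lborel g \<and> (LBINT x. norm (F x - g x)) < 1 / real (Suc n)" for n
    using integrable_approx_continuous[OF F(1), of "1 / real (Suc n)"] by (metis of_nat_0_less_iff zero_less_Suc zero_less_divide_1_iff)
  then obtain g where g: "\<And>n. continuous_on UNIV (g n)" "\<And>n. integrable lborel (g n)"
    "\<And>n. (LBINT x. norm (F x - g n x)) < 1 / real (Suc n)" by metis
  \<comment> \<open>The Gaussian term makes the approximation strictly positive, as transport
    requires, while its mass tends to 0.\<close>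
  define f where "f n x = max 0 (g n x) + exp (- x\<^sup>2) / real (Suc n)" for n x
  have f: "continuous_on UNIV (f n)" "0 < f n x" "integrable lborel (f n)" for n x
  proof -
    show "continuous_on UNIV (f n)" unfolding f_def by (intro continuous_intros g) simp
    show "0 < f n x" unfolding f_def by (intro add_nonneg_pos) auto
    show "integrable lborel (f n)" unfolding f_def
      by (intro Bochner_Integration.integrable_add integrable_max integrable_divide integrable_gauss g) simp
  qed
  have L1: "(\<lambda>n. \<integral>x. norm (f n x - F x) \<partial>lborel) \<longlonglongrightarrow> 0"
  proof (rule tendsto_sandwich[where f = "\<lambda>_. 0"])
    show "\<forall>\<^sub>F n in sequentially. (LBINT x. norm (f n x - F x)) \<le> (1 + sqrt pi) * (1 / real (Suc n))"
    proof (intro always_eventually allI)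
      fix n
      have "(LBINT x. norm (f n x - F x)) \<le> (LBINT x. norm (F x - g n x) + exp (- x\<^sup>2) / real (Suc n))"
      proof (rule integral_mono)
        fix x
        have "0 \<le> exp (- x\<^sup>2) / real (Suc n)" by simp
        then show "norm (f n x - F x) \<le> norm (F x - g n x) + exp (- x\<^sup>2) / real (Suc n)"
          unfolding f_def real_norm_def using F(2)[of x] by linarith
      qed (use f g F in \<open>auto intro!: integrable_gauss\<close>)
      also have "\<dots> = (LBINT x. norm (F x - g n x)) + sqrt pi / real (Suc n)"
        using g F integrable_gauss integral_gauss by (subst Bochner_Integration.integral_add) (auto simp del: of_nat_Suc)
      also have "\<dots> \<le> 1 / real (Suc n) + sqrt pi / real (Suc n)" using g(3)[of n] by linarith
      also have "\<dots> = (1 + sqrt pi) * (1 / real (Suc n))" by (simp add: field_simps)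
      finally show "(LBINT x. norm (f n x - F x)) \<le> (1 + sqrt pi) * (1 / real (Suc n))" .
    qed
    show "(\<lambda>n. (1 + sqrt pi) * (1 / real (Suc n))) \<longlonglongrightarrow> 0"
      using tendsto_mult_right_zero[OF LIMSEQ_Suc[OF lim_1_over_n[where 'a = real]], of "1 + sqrt pi"] by simp
  qed (auto intro!: always_eventually)
  have intL: "(\<lambda>n. integral\<^sup>L lborel (f n)) \<longlonglongrightarrow> integral\<^sup>L lborel F"
  proof (rule LIM_zero_cancel, rule Lim_null_comparison[OF _ L1])
    show "\<forall>\<^sub>F n in sequentially. norm (integral\<^sup>L lborel (f n) - integral\<^sup>L lborel F) \<le> (LBINT x. norm (f n x - F x))"
    proof (intro always_eventually allI)
      fix n
      have "integral\<^sup>L lborel (f n) - integral\<^sup>L lborel F = (LBINT x. f n x - F x)"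
        using f F by simp
      then show "norm (integral\<^sup>L lborel (f n) - integral\<^sup>L lborel F) \<le> (LBINT x. norm (f n x - F x))"
        using integral_norm_bound[of lborel "\<lambda>x. f n x - F x"] by simp
    qed
  qed
  have "\<exists>r::nat\<Rightarrow>nat. strict_mono r \<and> (AE x in lborel. (\<lambda>n. f (r n) x - F x) \<longlonglongrightarrow> 0)"
    using f F L1 by (intro tendsto_L1_AE_subseq[of lborel "\<lambda>n x. f n x - F x"]) auto
  then obtain r :: "nat \<Rightarrow> nat" where r: "strict_mono r" "AE x in lborel. (\<lambda>n. f (r n) x - F x) \<longlonglongrightarrow> 0" by blast
  show thesis
  proof (rule that[of "\<lambda>n. f (r n)"])
    show "(\<lambda>n. integral\<^sup>L lborel (f (r n))) \<longlonglongrightarrow> integral\<^sup>L lborel F"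
      using LIMSEQ_subseq_LIMSEQ[OF intL r(1)] by (simp add: o_def)
    show "AE x in lborel. (\<lambda>n. f (r n) x) \<longlonglongrightarrow> F x"
      using r(2) by eventually_elim (rule LIM_zero_cancel)
  qed (use f in auto)
qed

text \<open>Only an upper bound has to survive the limit, so Fatou's lemma in each of the two
  variables is enough. Along the approximating sequences the masses converge, and with them the
  right-hand sides.\<close>

lemma young_real:
  assumes \<alpha>: "1 / 2 < \<alpha>" "\<alpha> < 1"
  shows "young_holds (lborel :: real measure) (+) \<alpha> (young_const \<alpha>)"
proof (rule young_holdsI)
  fix F G H :: "real \<Rightarrow> real" and A B C :: real
  assume [measurable]: "F \<in> borel_measurable lborel" "G \<in> borel_measurable lborel" "H \<in> borel_measurable lborel"
    and nn: "\<And>x. 0 \<le> F x" "\<And>x. 0 \<le> G x" "\<And>x. 0 \<le> H x" "0 \<le> A" "0 \<le> B" "0 \<le> C"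
    and int: "(\<integral>\<^sup>+x. ennreal (F x) \<partial>lborel) = ennreal A" "(\<integral>\<^sup>+x. ennreal (G x) \<partial>lborel) = ennreal B"
     "(\<integral>\<^sup>+x. ennreal (H x) \<partial>lborel) = ennreal C"
  have bi: "integrable lborel f" "integral\<^sup>L lborel f = D"
    if "f \<in> borel_measurable lborel" "\<And>x. 0 \<le> f x" "0 \<le> D" "(\<integral>\<^sup>+x. ennreal (f x) \<partial>lborel) = ennreal D"
    for f :: "real \<Rightarrow> real" and D
  proof -
    have "has_bochner_integral lborel f D" using that by (intro has_bochner_integral_nn_integral) auto
    then show "integrable lborel f" "integral\<^sup>L lborel f = D" by (auto simp: has_bochner_integral_iff)
  qed
  have iF: "integrable lborel F" and eF: "integral\<^sup>L lborel F = A" using bi[of F A] nn int by auto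
  have iG: "integrable lborel G" and eG: "integral\<^sup>L lborel G = B" using bi[of G B] nn int by auto
  have iH: "integrable lborel H" and eH: "integral\<^sup>L lborel H = C" using bi[of H C] nn int by auto
  obtain f where f: "\<And>n. continuous_on UNIV (f n)" "\<And>n x. 0 < f n x"
    "\<And>n. integrable lborel (f n)" "(\<lambda>n. integral\<^sup>L lborel (f n)) \<longlonglongrightarrow> integral\<^sup>L lborel F"
    "AE x in lborel. (\<lambda>n. f n x) \<longlonglongrightarrow> F x"
    using positive_continuous_approx[OF iF nn(1)] by blast
  obtain g where g: "\<And>n. continuous_on UNIV (g n)" "\<And>n x. 0 < g n x"
    "\<And>n. integrable lborel (g n)" "(\<lambda>n. integral\<^sup>L lborel (g n)) \<longlonglongrightarrow> integral\<^sup>L lborel G"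
    "AE x in lborel. (\<lambda>n. g n x) \<longlonglongrightarrow> G x"
    using positive_continuous_approx[OF iG nn(2)] by blast
  obtain h where h: "\<And>n. continuous_on UNIV (h n)" "\<And>n x. 0 < h n x"
    "\<And>n. integrable lborel (h n)" "(\<lambda>n. integral\<^sup>L lborel (h n)) \<longlonglongrightarrow> integral\<^sup>L lborel H"
    "AE x in lborel. (\<lambda>n. h n x) \<longlonglongrightarrow> H x"
    using positive_continuous_approx[OF iH nn(3)] by blast
  note [measurable] = f(1)[THEN borel_measurable_continuous_onI] g(1)[THEN borel_measurable_continuous_onI] h(1)[THEN borel_measurable_continuous_onI]
  define u where "u n y z = ennreal (weighted \<alpha> (f n y) (g n z) (h n (y + z)))" for n y z
  have [measurable]: "(\<lambda>(y, z). u n y z) \<in> borel_measurable (borel \<Otimes>\<^sub>M borel)" for n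
    unfolding u_def by measurable
  have tp: "(\<lambda>n. a n powr \<beta>) \<longlonglongrightarrow> c powr \<beta>" if "a \<longlonglongrightarrow> c" "\<And>n. 0 \<le> a n" "0 < \<beta>" for a :: "nat \<Rightarrow> real" and c \<beta> :: real
    using that by (intro tendsto_powr') auto
  have lim: "AE y in lborel. AE z in lborel. ennreal (weighted \<alpha> (F y) (G z) (H (y + z))) = liminf (\<lambda>n. u n y z)"
    using f(5)
  proof eventually_elim
    case (elim y)
    show ?case using g(5) AE_lborel_translate[OF h(5), of y]
    proof eventually_elim
      case (elim z)
      have "(\<lambda>n. u n y z) \<longlonglongrightarrow> ennreal (weighted \<alpha> (F y) (G z) (H (y + z)))"
        unfolding u_def using elim \<open>(\<lambda>n. f n y) \<longlonglongrightarrow> F y\<close> f(2) g(2) h(2) \<alpha>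
        by (intro tendsto_ennrealI tendsto_mult tp) (auto intro: less_imp_le)
      from lim_imp_Liminf[OF _ this] show ?case by simp
    qed
  qed
  have "trilinear lborel (+) \<alpha> F G H
    = (\<integral>\<^sup>+y. \<integral>\<^sup>+z. liminf (\<lambda>n. u n y z) \<partial>lborel \<partial>lborel)"
    by (rule nn_integral_cong_AE, rule AE_mp[OF lim], rule AE_I2, rule impI, rule nn_integral_cong_AE)
  also have "\<dots> \<le> (\<integral>\<^sup>+y. liminf (\<lambda>n. \<integral>\<^sup>+z. u n y z \<partial>lborel) \<partial>lborel)"
    by (intro nn_integral_mono nn_integral_liminf) measurable
  also have "\<dots> \<le> liminf (\<lambda>n. \<integral>\<^sup>+y. \<integral>\<^sup>+z. u n y z \<partial>lborel \<partial>lborel)"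
    by (intro nn_integral_liminf) measurable
  also have "\<dots> \<le> liminf (\<lambda>n. ennreal (young_const \<alpha> * (weighted \<alpha> (integral\<^sup>L lborel (f n)) (integral\<^sup>L lborel (g n)) (integral\<^sup>L lborel (h n)))))"
    unfolding u_def using f(1-3) g(1-3) h(1-3) \<alpha> by (intro Liminf_mono always_eventually allI young_real_continuous) auto
  also have "\<dots> = ennreal (young_const \<alpha> * weighted \<alpha> A B C)"
  proof (rule lim_imp_Liminf)
    have pos: "0 \<le> integral\<^sup>L lborel (f n)" "0 \<le> integral\<^sup>L lborel (g n)" "0 \<le> integral\<^sup>L lborel (h n)" for n
      using f(2) g(2) h(2) by (auto intro!: Bochner_Integration.integral_nonneg intro: less_imp_le)
    show "(\<lambda>n. ennreal (young_const \<alpha> * (weighted \<alpha> (integral\<^sup>L lborel (f n)) (integral\<^sup>L lborel (g n)) (integral\<^sup>L lborel (h n)))))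
       \<longlonglongrightarrow> ennreal (young_const \<alpha> * weighted \<alpha> A B C)"
      using f(4) g(4) h(4) pos \<alpha> unfolding eF eG eH
      by (intro tendsto_ennrealI tendsto_mult tp tendsto_const) auto
  qed simp
  finally show "trilinear lborel (+) \<alpha> F G H
       \<le> ennreal (young_const \<alpha> * weighted \<alpha> A B C)" .
qed

text \<open>Used for two identifications: adding a coordinate to a function on a finite index set,
  and assembling a vector from its coordinates in \<open>Basis\<close>.\<close>

lemma young_holds_transfer:
  assumes Y: "young_holds M p \<alpha> K"
    and T[measurable]: "T \<in> measurable M N"
    and int: "\<And>f :: _ \<Rightarrow> ennreal. f \<in> borel_measurable N \<Longrightarrow> (\<integral>\<^sup>+x. f x \<partial>N) = (\<integral>\<^sup>+x. f (T x) \<partial>M)"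
    and q[measurable]: "case_prod q \<in> measurable (N \<Otimes>\<^sub>M N) N"
    and hom: "\<And>x y. x \<in> space M \<Longrightarrow> y \<in> space M \<Longrightarrow> q (T x) (T y) = T (p x y)"
    and N: "sigma_finite_measure N"
  shows "young_holds N q \<alpha> K"
proof (rule young_holdsI)
  fix F G H :: "'b \<Rightarrow> real" and A B C :: real
  assume [measurable]: "F \<in> borel_measurable N" "G \<in> borel_measurable N" "H \<in> borel_measurable N"
    and nn: "\<And>x. 0 \<le> F x" "\<And>x. 0 \<le> G x" "\<And>x. 0 \<le> H x" "0 \<le> A" "0 \<le> B" "0 \<le> C"
    and i: "(\<integral>\<^sup>+x. ennreal (F x) \<partial>N) = ennreal A" "(\<integral>\<^sup>+x. ennreal (G x) \<partial>N) = ennreal B"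
     "(\<integral>\<^sup>+x. ennreal (H x) \<partial>N) = ennreal C"
  interpret N: sigma_finite_measure N by (rule N)
  have [measurable]: "(\<lambda>(y, z). H (q y z)) \<in> borel_measurable (N \<Otimes>\<^sub>M N)"
    using measurable_compose[OF q, of H borel] by (simp add: case_prod_beta')
  have [measurable]: "(\<lambda>z. H (q y z)) \<in> borel_measurable N" if "y \<in> space N" for y
    using measurable_Pair2[OF \<open>(\<lambda>(y, z). H (q y z)) \<in> borel_measurable (N \<Otimes>\<^sub>M N)\<close> that] by simp
  have mu: "(\<lambda>(y, z). ennreal (weighted \<alpha> (F y) (G z) (H (q y z)))) \<in> borel_measurable (N \<Otimes>\<^sub>M N)"
    by measurable
  have "trilinear N q \<alpha> F G H
    = (\<integral>\<^sup>+y. \<integral>\<^sup>+z. ennreal (weighted \<alpha> (F (T y)) (G z) (H (q (T y) z))) \<partial>N \<partial>M)"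
    by (rule int) (use N.borel_measurable_nn_integral[OF mu] in simp)
  also have "\<dots> = (\<integral>\<^sup>+y. \<integral>\<^sup>+z. ennreal (weighted \<alpha> (F (T y)) (G (T z)) (H (T (p y z)))) \<partial>M \<partial>M)"
  proof (rule nn_integral_cong)
    fix y assume y: "y \<in> space M"
    then have Ty: "T y \<in> space N" using T by (rule measurable_space[rotated])
    have "(\<integral>\<^sup>+z. ennreal (weighted \<alpha> (F (T y)) (G z) (H (q (T y) z))) \<partial>N)
      = (\<integral>\<^sup>+z. ennreal (weighted \<alpha> (F (T y)) (G (T z)) (H (q (T y) (T z)))) \<partial>M)"
      by (rule int) (use Ty in measurable)
    also have "\<dots> = (\<integral>\<^sup>+z. ennreal (weighted \<alpha> (F (T y)) (G (T z)) (H (T (p y z)))) \<partial>M)"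
      by (rule nn_integral_cong) (simp add: hom y)
    finally show "(\<integral>\<^sup>+z. ennreal (weighted \<alpha> (F (T y)) (G z) (H (q (T y) z))) \<partial>N)
      = (\<integral>\<^sup>+z. ennreal (weighted \<alpha> (F (T y)) (G (T z)) (H (T (p y z)))) \<partial>M)" .
  qed
  also have "\<dots> \<le> ennreal (K * weighted \<alpha> A B C)"
  proof (rule young_holdsD[OF Y])
    show "(\<integral>\<^sup>+x. ennreal (F (T x)) \<partial>M) = ennreal A" "(\<integral>\<^sup>+x. ennreal (G (T x)) \<partial>M) = ennreal B"
      "(\<integral>\<^sup>+x. ennreal (H (T x)) \<partial>M) = ennreal C"
      unfolding i[symmetric] by (rule int[symmetric], measurable)+
  qed (use nn in \<open>auto intro: measurable_compose[OF T]\<close>)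
  finally show "trilinear N q \<alpha> F G H
    \<le> ennreal (K * weighted \<alpha> A B C)" .
qed

text \<open>Marginals as real functions. \<open>enn2real\<close> maps a slice of infinite mass to 0,
  but such slices form a null set, so the total mass is preserved.\<close>

lemma nn_integral_slices_finite:
  assumes M: "sigma_finite_measure M"
    and F[measurable]: "F \<in> borel_measurable (lborel \<Otimes>\<^sub>M M)" and A: "0 \<le> A"
    and int: "(\<integral>\<^sup>+x. ennreal (F x) \<partial>(lborel \<Otimes>\<^sub>M M)) = ennreal A"
  defines "\<phi> \<equiv> \<lambda>y. enn2real (\<integral>\<^sup>+x. ennreal (F (y, x)) \<partial>M)"
  shows "AE y in lborel. (\<integral>\<^sup>+x. ennreal (F (y, x)) \<partial>M) = ennreal (\<phi> y)"
    and "\<phi> \<in> borel_measurable lborel"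
    and "(\<integral>\<^sup>+y. ennreal (\<phi> y) \<partial>lborel) = ennreal A"
proof -
  interpret M: sigma_finite_measure M by (rule M)
  have [measurable]: "(\<lambda>y. \<integral>\<^sup>+x. ennreal (F (y, x)) \<partial>M) \<in> borel_measurable lborel"
    by (rule M.borel_measurable_nn_integral) (simp add: case_prod_beta')
  have i: "(\<integral>\<^sup>+y. \<integral>\<^sup>+x. ennreal (F (y, x)) \<partial>M \<partial>lborel) = ennreal A"
    unfolding int[symmetric] by (rule M.nn_integral_fst) measurable
  have "AE y in lborel. (\<integral>\<^sup>+x. ennreal (F (y, x)) \<partial>M) \<noteq> \<infinity>"
    by (rule nn_integral_PInf_AE) (auto simp: i)
  then show ae: "AE y in lborel. (\<integral>\<^sup>+x. ennreal (F (y, x)) \<partial>M) = ennreal (\<phi> y)"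
    by eventually_elim (simp add: \<phi>_def less_top)
  show "\<phi> \<in> borel_measurable lborel" unfolding \<phi>_def by measurable
  show "(\<integral>\<^sup>+y. ennreal (\<phi> y) \<partial>lborel) = ennreal A"
    unfolding i[symmetric] using ae by (intro nn_integral_cong_AE) (auto elim: eventually_mono)
qed

text \<open>With the real coordinates fixed, the inequality on \<open>M\<close> bounds the inner
  form by \<open>K\<close> times the weighted product of the marginals at \<open>y\<close>,
  \<open>z\<close> and \<open>y + z\<close>. The one-dimensional inequality for the marginals
  finishes, so the constants multiply.\<close>

lemma young_holds_pair:
  assumes Y: "young_holds M p \<alpha> K" and K: "0 \<le> K" and \<alpha>: "1 / 2 < \<alpha>" "\<alpha> < 1"
    and M: "sigma_finite_measure M"
    and p[measurable]: "case_prod p \<in> measurable (M \<Otimes>\<^sub>M M) M"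
  shows "young_holds (lborel \<Otimes>\<^sub>M M) (\<lambda>Y Z. (fst Y + fst Z :: real, p (snd Y) (snd Z))) \<alpha> (young_const \<alpha> * K)"
proof (rule young_holdsI)
  fix F G H :: "real \<times> 'a \<Rightarrow> real" and A B C :: real
  assume F[measurable]: "F \<in> borel_measurable (lborel \<Otimes>\<^sub>M M)" and G[measurable]: "G \<in> borel_measurable (lborel \<Otimes>\<^sub>M M)"
    and H[measurable]: "H \<in> borel_measurable (lborel \<Otimes>\<^sub>M M)"
    and nn: "\<And>x. 0 \<le> F x" "\<And>x. 0 \<le> G x" "\<And>x. 0 \<le> H x" and ABC: "0 \<le> A" "0 \<le> B" "0 \<le> C"
    and int: "(\<integral>\<^sup>+x. ennreal (F x) \<partial>(lborel \<Otimes>\<^sub>M M)) = ennreal A" "(\<integral>\<^sup>+x. ennreal (G x) \<partial>(lborel \<Otimes>\<^sub>M M)) = ennreal B"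
     "(\<integral>\<^sup>+x. ennreal (H x) \<partial>(lborel \<Otimes>\<^sub>M M)) = ennreal C"
  interpret M: sigma_finite_measure M by (rule M)
  let ?LM = "(lborel :: real measure) \<Otimes>\<^sub>M M"
  interpret LM: pair_sigma_finite lborel M ..
  define \<phi> where "\<phi> y = enn2real (\<integral>\<^sup>+x. ennreal (F (y, x)) \<partial>M)" for y
  define \<gamma> where "\<gamma> y = enn2real (\<integral>\<^sup>+x. ennreal (G (y, x)) \<partial>M)" for y
  define \<eta> where "\<eta> y = enn2real (\<integral>\<^sup>+x. ennreal (H (y, x)) \<partial>M)" for y
  note \<phi> = nn_integral_slices_finite[OF M F ABC(1) int(1), folded \<phi>_def]
  note \<gamma> = nn_integral_slices_finite[OF M G ABC(2) int(2), folded \<gamma>_def]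
  note \<eta> = nn_integral_slices_finite[OF M H ABC(3) int(3), folded \<eta>_def]
  note [measurable] = \<phi>(2) \<gamma>(2) \<eta>(2)
  define \<Phi> where "\<Phi> y x z w = ennreal (weighted \<alpha> (F (y, x)) (G (z, w)) (H (y + z, p x w)))" for y x z w
  have pm[measurable (raw)]: "(\<lambda>a. p (u a) (v a)) \<in> measurable N M" if "u \<in> measurable N M" "v \<in> measurable N M" for u v and N :: "'z measure"
  proof -
    have "(\<lambda>a. case_prod p (u a, v a)) \<in> measurable N M"
      by (rule measurable_compose[OF _ p]) (use that in measurable)
    then show ?thesis by simp
  qed
  have \<Phi>m: "(\<lambda>a. \<Phi> (f a) (g a) (h a) (k a)) \<in> borel_measurable N"
    if [measurable]: "f \<in> borel_measurable N" "g \<in> measurable N M" "h \<in> borel_measurable N" "k \<in> measurable N M" for f g h k and N :: "'z measure"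
    unfolding \<Phi>_def by measurable
  have "(\<integral>\<^sup>+Y. \<integral>\<^sup>+Z. ennreal (weighted \<alpha> (F Y) (G Z) (H (fst Y + fst Z, p (snd Y) (snd Z)))) \<partial>?LM \<partial>?LM)
    = (\<integral>\<^sup>+Y. \<integral>\<^sup>+Z. \<Phi> (fst Y) (snd Y) (fst Z) (snd Z) \<partial>?LM \<partial>?LM)"
    by (simp add: \<Phi>_def)
  also have "\<dots> = (\<integral>\<^sup>+Y. \<integral>\<^sup>+z. \<integral>\<^sup>+w. \<Phi> (fst Y) (snd Y) z w \<partial>M \<partial>lborel \<partial>?LM)"
  proof (rule nn_integral_cong)
    fix Y assume Y: "Y \<in> space ?LM"
    then have sY: "snd Y \<in> space M" by (auto simp: space_pair_measure)
    have "(\<lambda>Z. \<Phi> (fst Y) (snd Y) (fst Z) (snd Z)) \<in> borel_measurable ?LM"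
      by (rule \<Phi>m) (use sY in measurable)
    from M.nn_integral_fst[OF this]
    show "(\<integral>\<^sup>+Z. \<Phi> (fst Y) (snd Y) (fst Z) (snd Z) \<partial>?LM) = (\<integral>\<^sup>+z. \<integral>\<^sup>+w. \<Phi> (fst Y) (snd Y) z w \<partial>M \<partial>lborel)"
      by simp
  qed
  also have "\<dots> = (\<integral>\<^sup>+y. \<integral>\<^sup>+x. \<integral>\<^sup>+z. \<integral>\<^sup>+w. \<Phi> y x z w \<partial>M \<partial>lborel \<partial>M \<partial>lborel)"
  proof -
    have "(\<lambda>(P, w). \<Phi> (fst (fst P)) (snd (fst P)) (snd P) w) \<in> borel_measurable ((?LM \<Otimes>\<^sub>M lborel) \<Otimes>\<^sub>M M)"
      unfolding case_prod_beta' by (rule \<Phi>m) measurable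
    from M.borel_measurable_nn_integral[OF this]
    have "(\<lambda>(Y, z). \<integral>\<^sup>+w. \<Phi> (fst Y) (snd Y) z w \<partial>M) \<in> borel_measurable (?LM \<Otimes>\<^sub>M lborel)"
      by (simp add: case_prod_beta')
    from lborel.borel_measurable_nn_integral[OF this]
    have "(\<lambda>Y. \<integral>\<^sup>+z. \<integral>\<^sup>+w. \<Phi> (fst Y) (snd Y) z w \<partial>M \<partial>lborel) \<in> borel_measurable ?LM" .
    from M.nn_integral_fst[OF this] show ?thesis by simp
  qed
  \<comment> \<open>Both \<open>M\<close>-variables are moved inside both real variables, so that
    the inequality on \<open>M\<close> applies slicewise, for almost all \<open>y\<close> and then
    almost all \<open>z\<close>.\<close>
  also have "\<dots> = (\<integral>\<^sup>+y. \<integral>\<^sup>+z. \<integral>\<^sup>+x. \<integral>\<^sup>+w. \<Phi> y x z w \<partial>M \<partial>M \<partial>lborel \<partial>lborel)"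
  proof (rule nn_integral_cong)
    fix y :: real
    have "(\<lambda>(P, w). \<Phi> y (snd P) (fst P) w) \<in> borel_measurable (?LM \<Otimes>\<^sub>M M)"
      unfolding case_prod_beta' by (rule \<Phi>m) measurable
    from M.borel_measurable_nn_integral[OF this]
    have "(\<lambda>(z, x). \<integral>\<^sup>+w. \<Phi> y x z w \<partial>M) \<in> borel_measurable ?LM"
      by (simp add: case_prod_beta')
    from LM.Fubini'[OF this]
    show "(\<integral>\<^sup>+x. \<integral>\<^sup>+z. \<integral>\<^sup>+w. \<Phi> y x z w \<partial>M \<partial>lborel \<partial>M) = (\<integral>\<^sup>+z. \<integral>\<^sup>+x. \<integral>\<^sup>+w. \<Phi> y x z w \<partial>M \<partial>M \<partial>lborel)" .
  qed
  also have "\<dots> \<le> (\<integral>\<^sup>+y. \<integral>\<^sup>+z. ennreal (K * (weighted \<alpha> (\<phi> y) (\<gamma> z) (\<eta> (y + z)))) \<partial>lborel \<partial>lborel)"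
  proof (rule nn_integral_mono_AE)
    show "AE y in lborel. (\<integral>\<^sup>+z. \<integral>\<^sup>+x. \<integral>\<^sup>+w. \<Phi> y x z w \<partial>M \<partial>M \<partial>lborel) \<le>
      (\<integral>\<^sup>+z. ennreal (K * (weighted \<alpha> (\<phi> y) (\<gamma> z) (\<eta> (y + z)))) \<partial>lborel)"
      using \<phi>(1)
    proof eventually_elim
      case (elim y)
      note y = elim
      show ?case
      proof (rule nn_integral_mono_AE)
        show "AE z in lborel. (\<integral>\<^sup>+x. \<integral>\<^sup>+w. \<Phi> y x z w \<partial>M \<partial>M) \<le> ennreal (K * (weighted \<alpha> (\<phi> y) (\<gamma> z) (\<eta> (y + z))))"
          using \<gamma>(1) AE_lborel_translate[OF \<eta>(1), of y]
        proof eventually_elim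
          case (elim z)
          show ?case unfolding \<Phi>_def
            by (rule young_holdsD[OF Y _ _ _ nn(1) nn(2) nn(3) _ _ _ y elim]) (auto simp: \<phi>_def \<gamma>_def \<eta>_def)
        qed
      qed
    qed
  qed
  also have "\<dots> = ennreal K * (\<integral>\<^sup>+y. \<integral>\<^sup>+z. ennreal (weighted \<alpha> (\<phi> y) (\<gamma> z) (\<eta> (y + z))) \<partial>lborel \<partial>lborel)"
    using K by (simp add: ennreal_mult nn_integral_cmult)
  also have "\<dots> \<le> ennreal K * ennreal (young_const \<alpha> * weighted \<alpha> A B C)"
  proof (rule mult_left_mono[OF young_holdsD[OF young_real[OF \<alpha>] \<phi>(2) \<gamma>(2) \<eta>(2) _ _ _ ABC \<phi>(3) \<gamma>(3) \<eta>(3)]])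
  qed (auto simp: \<phi>_def \<gamma>_def \<eta>_def)
  also have "\<dots> = ennreal (young_const \<alpha> * K * weighted \<alpha> A B C)"
    using K by (simp add: ennreal_mult[symmetric] young_const_nonneg mult_ac)
  finally show "(\<integral>\<^sup>+Y. \<integral>\<^sup>+Z. ennreal (weighted \<alpha> (F Y) (G Z) (H (fst Y + fst Z, p (snd Y) (snd Z)))) \<partial>?LM \<partial>?LM)
    \<le> ennreal (young_const \<alpha> * K * weighted \<alpha> A B C)" .
qed

abbreviation lborel_PiM :: "'i set \<Rightarrow> ('i \<Rightarrow> real) measure" where
  "lborel_PiM I \<equiv> (\<Pi>\<^sub>M i\<in>I. lborel)"

lemma young_holds_PiM:
  fixes I :: "'i set"
  assumes \<alpha>: "1 / 2 < \<alpha>" "\<alpha> < 1" and I: "finite I"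
  shows "young_holds (lborel_PiM I) (\<lambda>x y. \<lambda>i\<in>I. x i + y i) \<alpha> (young_const \<alpha> ^ card I)"
  using I
proof (induction I rule: finite_induct)
  \<comment> \<open>The product over no indices is a one-point space of mass 1, on which both sides
    coincide.\<close>
  case empty
  interpret product_sigma_finite "\<lambda>_::'i. lborel :: real measure" ..
  show ?case
  proof (rule young_holdsI)
    fix F G H :: "('i \<Rightarrow> real) \<Rightarrow> real" and A B C
    assume "\<And>x. 0 \<le> F x" "\<And>x. 0 \<le> G x" "\<And>x. 0 \<le> H x" "0 \<le> A" "0 \<le> B" "0 \<le> C"
      "(\<integral>\<^sup>+x. ennreal (F x) \<partial>(lborel_PiM {})) = ennreal A" "(\<integral>\<^sup>+x. ennreal (G x) \<partial>(lborel_PiM {})) = ennreal B"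
      "(\<integral>\<^sup>+x. ennreal (H x) \<partial>(lborel_PiM {})) = ennreal C"
    then show "(\<integral>\<^sup>+y. \<integral>\<^sup>+z. ennreal (weighted \<alpha> (F y) (G z) (H (\<lambda>i\<in>{}. y i + z i))) \<partial>(lborel_PiM {}) \<partial>(lborel_PiM {}))
       \<le> ennreal (young_const \<alpha> ^ card ({}::'i set) * weighted \<alpha> A B C)"
      by (simp add: nn_integral_empty restrict_def)
  qed
next
  case (insert i I)
  interpret product_sigma_finite "\<lambda>_::'i. lborel :: real measure" ..
  have sf: "sigma_finite_measure (lborel_PiM J)" if "finite J" for J :: "'i set"
    using that by (rule sigma_finite)
  interpret PI: sigma_finite_measure "\<Pi>\<^sub>M i\<in>I. (lborel :: real measure)" using insert(1) by (rule sf)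
  have add_meas: "(\<lambda>(x, y). \<lambda>i\<in>J. x i + y i) \<in> measurable ((lborel_PiM J) \<Otimes>\<^sub>M (lborel_PiM J)) (lborel_PiM J)" for J :: "'i set"
  proof -
    have "(\<lambda>P. \<lambda>i\<in>J. fst P i + snd P i) \<in> measurable ((lborel_PiM J) \<Otimes>\<^sub>M (lborel_PiM J)) (lborel_PiM J)"
      by (rule measurable_restrict) measurable
    then show ?thesis by (simp add: case_prod_beta')
  qed
  have T[measurable]: "(\<lambda>P. (snd P)(i := fst P)) \<in> measurable (lborel \<Otimes>\<^sub>M (lborel_PiM I)) (lborel_PiM (insert i I))"
    by measurable
  have "young_holds (lborel \<Otimes>\<^sub>M (lborel_PiM I))
    (\<lambda>Y Z. (fst Y + fst Z :: real, \<lambda>i\<in>I. snd Y i + snd Z i)) \<alpha> (young_const \<alpha> * young_const \<alpha> ^ card I)"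
    by (rule young_holds_pair[OF insert.IH _ \<alpha> sf[OF insert(1)] add_meas]) (simp add: young_const_nonneg)
  then have "young_holds (lborel_PiM (insert i I)) (\<lambda>x y. \<lambda>j\<in>insert i I. x j + y j) \<alpha> (young_const \<alpha> * young_const \<alpha> ^ card I)"
  proof (rule young_holds_transfer[OF _ T])
    fix f :: "('i \<Rightarrow> real) \<Rightarrow> ennreal" assume f[measurable]: "f \<in> borel_measurable (lborel_PiM (insert i I))"
    have "(\<integral>\<^sup>+x. f x \<partial>(lborel_PiM (insert i I))) = (\<integral>\<^sup>+y. \<integral>\<^sup>+x. f (x(i := y)) \<partial>(lborel_PiM I) \<partial>lborel)"
      using insert(1,2) by (rule product_nn_integral_insert_rev) measurable
    also have "\<dots> = (\<integral>\<^sup>+P. f ((snd P)(i := fst P)) \<partial>(lborel \<Otimes>\<^sub>M (lborel_PiM I)))"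
    proof -
      have "(\<lambda>P. f ((snd P)(i := fst P))) \<in> borel_measurable (lborel \<Otimes>\<^sub>M (lborel_PiM I))" by measurable
      from PI.nn_integral_fst[OF this] show ?thesis by simp
    qed
    finally show "(\<integral>\<^sup>+x. f x \<partial>(lborel_PiM (insert i I))) = (\<integral>\<^sup>+P. f ((snd P)(i := fst P)) \<partial>(lborel \<Otimes>\<^sub>M (lborel_PiM I)))" .
  next
    show "(\<lambda>(x, y). \<lambda>j\<in>insert i I. x j + y j) \<in> measurable ((lborel_PiM (insert i I)) \<Otimes>\<^sub>M (lborel_PiM (insert i I))) (lborel_PiM (insert i I))"
      by (rule add_meas)
    show "sigma_finite_measure (lborel_PiM (insert i I))" using insert(1) by (intro sf) simp
  qed (use insert(2) in \<open>auto simp: fun_eq_iff restrict_def\<close>)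
  then show ?case unfolding card_insert_disjoint[OF insert(1,2)] power_Suc .
qed

theorem young_holds_lborel:
  assumes \<alpha>: "1 / 2 < \<alpha>" "\<alpha> < 1"
  shows "young_holds (lborel :: 'a::euclidean_space measure) (+) \<alpha> (young_const \<alpha> ^ DIM('a))"
proof (rule young_holds_transfer[OF young_holds_PiM[OF \<alpha> finite_Basis]])
  show T[measurable]: "(\<lambda>f. \<Sum>b\<in>Basis. f b *\<^sub>R b) \<in> measurable (\<Pi>\<^sub>M b\<in>(Basis :: 'a set). lborel) lborel"
    by measurable
  fix f :: "'a \<Rightarrow> ennreal" assume [measurable]: "f \<in> borel_measurable lborel"
  show "(\<integral>\<^sup>+x. f x \<partial>lborel) = (\<integral>\<^sup>+x. f (\<Sum>b\<in>Basis. x b *\<^sub>R b) \<partial>(\<Pi>\<^sub>M b\<in>(Basis :: 'a set). lborel))"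
    by (subst lborel_eq, rule nn_integral_distr) measurable
next
  show "sigma_finite_measure (lborel :: 'a measure)" by (rule sigma_finite_lborel)
qed (auto simp: scaleR_add_left sum.distrib intro!: borel_measurable_add)

section \<open>The two-sided quaternion Fourier transform\<close>

text \<open>The kernel is an operator on the quaternion between the two phases, not a scalar factor.
  It is real-linear and orthogonal, and this is the form in which it enters every later
  argument.\<close>

definition qker :: "'a::euclidean_space \<times> 'b::euclidean_space \<Rightarrow> 'a \<times> 'b \<Rightarrow> quat \<Rightarrow> quat" where
  "qker y w h = exp (- (fst y \<bullet> fst w) *\<^sub>R quat_i) * h * exp (- (snd y \<bullet> snd w) *\<^sub>R quat_j)"

lemma exp_quat_i: "exp (t *\<^sub>R quat_i) = Quat (cos t) (sin t) 0 0"
  and exp_quat_j: "exp (t *\<^sub>R quat_j) = Quat (cos t) 0 (sin t) 0"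
  by (subst quat_exp_unit, simp, simp add: quat_eq_iff)+

lemma norm_qker [simp]: "norm (qker y w h) = norm h"
  unfolding qker_def norm_mult exp_quat_i exp_quat_j by (simp add: norm_quat_eq)

lemma qker_diff: "qker y w (a - b) = qker y w a - qker y w b"
  by (simp add: qker_def algebra_simps)

lemma qker_commute: "qker y w h = qker w y h"
  by (simp add: qker_def inner_commute)

lemma qker_scale: "qker y (c *\<^sub>R w) h = qker (c *\<^sub>R y) w h"
  by (simp add: qker_def)

text \<open>For the real inner product, left or right multiplication by a quaternion has
  multiplication by the conjugate as its adjoint. Moving the phases across therefore joins i-phases
  only to i-phases and j-phases only to j-phases, which commute. This replaces the character
  identity of the commutative theory.\<close>

lemma inner_qker: "qker y w a \<bullet> qker y' w b = a \<bullet> qker (y' - y) w b"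
proof -
  have ip: "(p * a) \<bullet> b = a \<bullet> (qcnj p * b)" "(a * p) \<bullet> b = a \<bullet> (b * qcnj p)" for p a b :: quat
    by (simp_all add: inner_quat_def algebra_simps)
  have cj: "qcnj (exp (t *\<^sub>R quat_i)) = exp ((- t) *\<^sub>R quat_i)" "qcnj (exp (t *\<^sub>R quat_j)) = exp ((- t) *\<^sub>R quat_j)" for t
    unfolding exp_quat_i exp_quat_j by (simp_all add: quat_eq_iff)
  have add: "exp (s *\<^sub>R quat_i) * exp (t *\<^sub>R quat_i) = exp ((s + t) *\<^sub>R quat_i)"
    "exp (s *\<^sub>R quat_j) * exp (t *\<^sub>R quat_j) = exp ((s + t) *\<^sub>R quat_j)" for s t
    unfolding exp_quat_i exp_quat_j by (simp_all add: quat_eq_iff cos_add sin_add)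
  have "qker y w a \<bullet> qker y' w b = a \<bullet> ((exp ((fst y \<bullet> fst w) *\<^sub>R quat_i) * exp (- (fst y' \<bullet> fst w) *\<^sub>R quat_i)) * b
     * (exp (- (snd y' \<bullet> snd w) *\<^sub>R quat_j) * exp ((snd y \<bullet> snd w) *\<^sub>R quat_j)))"
    unfolding qker_def by (subst ip(2), subst mult.assoc, subst ip(1), simp only: cj minus_minus mult.assoc)
  also have "\<dots> = a \<bullet> qker (y' - y) w b"
    unfolding add qker_def by (simp add: inner_diff_left)
  finally show ?thesis .
qed

lemma exp_quat_units:
  "exp (t *\<^sub>R quat_i) = cos t *\<^sub>R 1 + sin t *\<^sub>R quat_i"
  "exp (t *\<^sub>R quat_j) = cos t *\<^sub>R 1 + sin t *\<^sub>R quat_j"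
  by (rule quat_exp_unit; simp)+

lemma continuous_on_qker [continuous_intros]:
  fixes y w :: "'c::t2_space \<Rightarrow> 'a::euclidean_space \<times> 'b::euclidean_space"
  assumes "continuous_on S y" "continuous_on S w" "continuous_on S h"
  shows "continuous_on S (\<lambda>x. qker (y x) (w x) (h x))"
  unfolding qker_def exp_quat_units
  by (intro continuous_intros assms)

lemma measurable_qker:
  assumes [measurable]: "y \<in> borel_measurable M" "w \<in> borel_measurable M" "h \<in> borel_measurable M"
  shows "(\<lambda>x. qker (y x) (w x) (h x)) \<in> borel_measurable M"
proof -
  have c: "continuous_on UNIV (\<lambda>p :: ('b \<times> 'c) \<times> ('b \<times> 'c) \<times> quat. qker (fst p) (fst (snd p)) (snd (snd p)))"
    by (intro continuous_intros)
  have "(\<lambda>x. (y x, w x, h x)) \<in> borel_measurable M" by measurable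
  from measurable_compose[OF this borel_measurable_continuous_onI[OF c]] show ?thesis by simp
qed

lemma measurable_qker_right [measurable]: "(\<lambda>w. qker z w b) \<in> borel_measurable borel"
  by (intro borel_measurable_continuous_onI continuous_intros)

lemma integral_lborel_affine:
  fixes f :: "'a::euclidean_space \<Rightarrow> 'b::{banach, second_countable_topology}"
  assumes [measurable]: "f \<in> borel_measurable borel" and c: "c \<noteq> 0"
  shows "(LBINT x. f x) = \<bar>c\<bar> ^ DIM('a) *\<^sub>R (LBINT x. f (t + c *\<^sub>R x))"
  by (subst lborel_affine[OF c, of t]) (simp add: integral_density integral_distr)

lemma nn_integral_lborel_affine:
  fixes f :: "'a::euclidean_space \<Rightarrow> ennreal"
  assumes [measurable]: "f \<in> borel_measurable borel" and c: "c \<noteq> 0"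
  shows "(\<integral>\<^sup>+x. f x \<partial>lborel) = ennreal (\<bar>c\<bar> ^ DIM('a)) * (\<integral>\<^sup>+x. f (t + c *\<^sub>R x) \<partial>lborel)"
  by (subst lborel_affine[OF c, of t]) (simp add: nn_integral_density nn_integral_distr nn_integral_cmult)

section \<open>Fourier transforms of Gaussians\<close>

lemma gauss_fourier_real:
  "integrable lborel (\<lambda>x. of_real (exp (- x\<^sup>2 / 2)) * cis (t * x))"
  "(LBINT x. of_real (exp (- x\<^sup>2 / 2)) * cis (t * x)) = of_real (sqrt (2 * pi) * exp (- t\<^sup>2 / 2))"
proof -
  have i: "integrable lborel (\<lambda>x::real. exp (- x\<^sup>2 / 2))"
    using integrable_mult_right[OF integrable_normal_density[of 1 0], of "sqrt (2 * pi)"]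
    by (simp add: normal_density_def)
  then show "integrable lborel (\<lambda>x. of_real (exp (- x\<^sup>2 / 2)) * cis (t * x))"
  proof (rule Bochner_Integration.integrable_bound)
    show "(\<lambda>x. of_real (exp (- x\<^sup>2 / 2)) * cis (t * x)) \<in> borel_measurable lborel"
      by (subst measurable_lborel2, intro borel_measurable_continuous_onI continuous_intros) simp
  qed (auto simp: norm_mult)
  have "of_real (exp (- t\<^sup>2 / 2)) = (\<integral>x. iexp (t * x) \<partial>std_normal_distribution)"
    using char_std_normal_distribution by (simp add: char_def fun_eq_iff)
  also have "\<dots> = (LBINT x. std_normal_density x *\<^sub>R iexp (t * x))"
    by (rule integral_density) auto
  also have "\<dots> = (LBINT x. (1 / sqrt (2 * pi)) *\<^sub>R (of_real (exp (- x\<^sup>2 / 2)) * cis (t * x)))"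
    by (intro Bochner_Integration.integral_cong refl) (simp add: normal_density_def cis_conv_exp scaleR_conv_of_real)
  also have "\<dots> = (1 / sqrt (2 * pi)) *\<^sub>R (LBINT x. of_real (exp (- x\<^sup>2 / 2)) * cis (t * x))"
    by (rule integral_scaleR_right)
  finally have *: "of_real (exp (- t\<^sup>2 / 2)) = (1 / sqrt (2 * pi)) *\<^sub>R (LBINT x. of_real (exp (- x\<^sup>2 / 2)) * cis (t * x))" .
  have "of_real (sqrt (2 * pi) * exp (- t\<^sup>2 / 2)) = sqrt (2 * pi) *\<^sub>R (of_real (exp (- t\<^sup>2 / 2)) :: complex)"
    by (simp add: scaleR_conv_of_real)
  then show "(LBINT x. of_real (exp (- x\<^sup>2 / 2)) * cis (t * x)) = of_real (sqrt (2 * pi) * exp (- t\<^sup>2 / 2))"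
    unfolding * by simp
qed

lemma cis_sum: "finite A \<Longrightarrow> cis (sum f A) = (\<Prod>i\<in>A. cis (f i))"
  by (induction A rule: finite_induct) (auto simp: cis_mult[symmetric])

lemma norm_square_Basis: "(norm u)\<^sup>2 = (\<Sum>b\<in>Basis. (u \<bullet> b)\<^sup>2)"
  by (subst euclidean_inner[of u u, folded power2_norm_eq_inner]) (simp add: power2_eq_square)

abbreviation gauss :: "'a::real_normed_vector \<Rightarrow> real" where
  "gauss u \<equiv> exp (- (norm u)\<^sup>2 / 2)"

abbreviation gauss_hat :: "'a::euclidean_space \<Rightarrow> real" where
  "gauss_hat s \<equiv> sqrt (2 * pi) ^ DIM('a) * gauss s"

lemma gauss_fourier:
  fixes s :: "'a::euclidean_space"
  shows "integrable lborel (\<lambda>u::'a. of_real (gauss u) * cis (s \<bullet> u))"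
  "(LBINT u. of_real (gauss u) * cis (s \<bullet> u)) = of_real (gauss_hat s)"
proof -
  interpret product_sigma_finite "\<lambda>_::'a. lborel :: real measure" ..
  let ?f = "\<lambda>u::'a. complex_of_real (gauss u) * cis (s \<bullet> u)"
  let ?T = "\<lambda>x. \<Sum>b\<in>(Basis::'a set). x b *\<^sub>R b"
  have f: "?f (?T x) = (\<Prod>b\<in>Basis. of_real (exp (- (x b)\<^sup>2 / 2)) * cis ((s \<bullet> b) * x b))" for x
  proof -
    have "gauss (?T x) = (\<Prod>b\<in>(Basis::'a set). exp (- (x b)\<^sup>2 / 2))"
      by (simp add: norm_square_Basis exp_sum[symmetric] sum_negf[symmetric] sum_divide_distrib)
    moreover have "cis (s \<bullet> ?T x) = (\<Prod>b\<in>(Basis::'a set). cis ((s \<bullet> b) * x b))"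
      by (simp add: inner_sum_right mult.commute cis_sum[symmetric])
    ultimately show ?thesis by (simp only: of_real_prod prod.distrib)
  qed
  have Tm[measurable]: "?T \<in> measurable (\<Pi>\<^sub>M b\<in>(Basis :: 'a set). lborel) borel" by measurable
  have fm[measurable]: "?f \<in> borel_measurable borel"
    by (intro borel_measurable_continuous_onI continuous_intros) simp
  have iP: "integrable (\<Pi>\<^sub>M b\<in>(Basis :: 'a set). lborel) (\<lambda>x. ?f (?T x))"
    unfolding f by (intro product_integrable_prod gauss_fourier_real) simp
  show "integrable lborel ?f"
    using iffD2[OF integrable_distr_eq[OF Tm fm] iP] unfolding lborel_eq[symmetric] .
  have "(LBINT u. ?f u) = (\<integral>x. ?f (?T x) \<partial>(\<Pi>\<^sub>M b\<in>(Basis :: 'a set). lborel))"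
    using integral_distr[OF Tm fm] unfolding lborel_eq[symmetric] .
  also have "\<dots> = (\<Prod>b\<in>(Basis::'a set). of_real (sqrt (2 * pi) * exp (- (s \<bullet> b)\<^sup>2 / 2)))"
    unfolding f by (subst product_integral_prod[OF finite_Basis gauss_fourier_real(1)]) (simp only: gauss_fourier_real(2))
  also have "\<dots> = of_real (\<Prod>b\<in>(Basis::'a set). sqrt (2 * pi) * exp (- (s \<bullet> b)\<^sup>2 / 2))" by (simp only: of_real_prod)
  also have "(\<Prod>b\<in>(Basis::'a set). sqrt (2 * pi) * exp (- (s \<bullet> b)\<^sup>2 / 2)) = gauss_hat s"
    by (simp add: prod.distrib norm_square_Basis exp_sum[symmetric] sum_negf[symmetric] sum_divide_distrib)
  finally show "(LBINT u. ?f u) = of_real (gauss_hat s)" .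
qed

lemma gauss_integral:
  shows "integrable lborel (\<lambda>u::'a::euclidean_space. gauss u)"
  and "(LBINT u. gauss (u::'a)) = sqrt (2 * pi) ^ DIM('a)"
proof -
  note g = gauss_fourier[of "0 :: 'a", unfolded inner_zero_left cis_zero mult_1_right integral_complex_of_real of_real_eq_iff]
  show "integrable lborel (\<lambda>u::'a. gauss u)"
    using integrable_Re[OF g(1)] by (simp only: complex.sel Re_complex_of_real)
  show "(LBINT u. gauss (u::'a)) = sqrt (2 * pi) ^ DIM('a)"
    using g(2) by simp
qed

text \<open>The real-linear map \<open>L\<close> sends the imaginary unit to \<open>e\<close>, and
  the complex result is carried over through it.\<close>

lemma gauss_fourier_quat:
  fixes s :: "'a::euclidean_space"
  assumes e: "\<And>t. exp (t *\<^sub>R e) = cos t *\<^sub>R 1 + sin t *\<^sub>R (e :: quat)"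
  shows "integrable lborel (\<lambda>u::'a. gauss u *\<^sub>R exp ((s \<bullet> u) *\<^sub>R e))"
  "(LBINT u. gauss u *\<^sub>R exp ((s \<bullet> u) *\<^sub>R e)) = gauss_hat s *\<^sub>R 1"
proof -
  define L where "L z = Re z *\<^sub>R (1 :: quat) + Im z *\<^sub>R e" for z
  have L: "bounded_linear L" unfolding L_def
    by (intro bounded_linear_add bounded_linear_scaleR_const bounded_linear_Re bounded_linear_Im)
  have eq: "gauss u *\<^sub>R exp ((s \<bullet> u) *\<^sub>R e) = L (of_real (gauss u) * cis (s \<bullet> u))" for u
    by (simp add: L_def e scaleR_add_right)
  show "integrable lborel (\<lambda>u::'a. gauss u *\<^sub>R exp ((s \<bullet> u) *\<^sub>R e))"
    unfolding eq by (rule integrable_bounded_linear[OF L gauss_fourier(1)])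
  show "(LBINT u. gauss u *\<^sub>R exp ((s \<bullet> u) *\<^sub>R e)) = gauss_hat s *\<^sub>R 1"
    unfolding eq integral_bounded_linear[OF L gauss_fourier(1)] gauss_fourier(2) by (simp add: L_def)
qed

text \<open>The Gaussian factors over the two halves of \<open>w\<close>, which leaves
  \<open>b\<close> between two one-sided transforms. Each of these is a real multiple of 1, so the
  order of the factors no longer matters.\<close>

lemma gauss_qker:
  fixes z :: "'a::euclidean_space \<times> 'b::euclidean_space"
  shows "integrable lborel (\<lambda>w::'a \<times> 'b. gauss w *\<^sub>R qker z w b)"
    and "(LBINT w. gauss w *\<^sub>R qker z w b) = gauss_hat z *\<^sub>R b"
proof -
  show i: "integrable lborel (\<lambda>w::'a \<times> 'b. gauss w *\<^sub>R qker z w b)"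
  proof (rule Bochner_Integration.integrable_bound[of _ "\<lambda>w. norm b * gauss w"])
    show "integrable lborel (\<lambda>w::'a\<times>'b. norm b * gauss w)"
      by (intro integrable_mult_right gauss_integral)
    show "(\<lambda>w::'a\<times>'b. gauss w *\<^sub>R qker z w b) \<in> borel_measurable lborel"
      by (subst measurable_lborel2, intro borel_measurable_continuous_onI continuous_intros) simp
  qed auto
  define E1 where "E1 u = gauss u *\<^sub>R exp (((- fst z) \<bullet> u) *\<^sub>R quat_i)" for u :: 'a
  define E2 where "E2 v = gauss v *\<^sub>R exp (((- snd z) \<bullet> v) *\<^sub>R quat_j)" for v :: 'b
  note g1 = gauss_fourier_quat[OF exp_quat_units(1), of "- fst z", folded E1_def] and g2 = gauss_fourier_quat[OF exp_quat_units(2), of "- snd z", folded E2_def]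
  have eq: "gauss w *\<^sub>R qker z w b = E1 (fst w) * b * E2 (snd w)" for w
  proof -
    have "gauss w = gauss (fst w) * gauss (snd w)"
      by (simp add: norm_prod_def mult_exp_exp add_divide_distrib)
    then show ?thesis by (simp add: E1_def E2_def qker_def)
  qed
  have "(LBINT w. gauss w *\<^sub>R qker z w b) = (\<integral>w. E1 (fst w) * b * E2 (snd w) \<partial>(lborel \<Otimes>\<^sub>M lborel))"
    unfolding eq lborel_prod ..
  also have "\<dots> = (\<integral>u. \<integral>v. E1 u * b * E2 v \<partial>lborel \<partial>lborel)"
    using i unfolding eq lborel_prod[symmetric] by (subst lborel_pair.integral_fst'[symmetric]) auto
  also have "\<dots> = (LBINT u. (E1 u * b) * integral\<^sup>L lborel E2)"
    using g2(1) by (intro Bochner_Integration.integral_cong refl integral_mult_right) auto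
  also have "\<dots> = integral\<^sup>L lborel E1 * (b * integral\<^sup>L lborel E2)"
    unfolding mult.assoc using g1(1) by (intro Bochner_Integration.integral_mult_left) auto
  also have "\<dots> = gauss_hat z *\<^sub>R b"
    unfolding g1(2) g2(2) by (simp add: norm_prod_def power_add mult_exp_exp add_divide_distrib mult_ac)
  finally show "(LBINT w. gauss w *\<^sub>R qker z w b) = gauss_hat z *\<^sub>R b" .
qed

lemma gauss_qker_scaled:
  fixes z :: "'a::euclidean_space \<times> 'b::euclidean_space"
  assumes c: "0 < c"
  shows "integrable lborel (\<lambda>w::'a \<times> 'b. gauss (c *\<^sub>R w) *\<^sub>R qker z w b)"
    and "(LBINT w. gauss (c *\<^sub>R w) *\<^sub>R qker z w b)
      = ((1 / c) ^ DIM('a \<times> 'b) * (gauss_hat (z /\<^sub>R c))) *\<^sub>R b"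
proof -
  have sc: "exp (- (norm (c *\<^sub>R (0 + (1 / c) *\<^sub>R w)))\<^sup>2 / 2) *\<^sub>R qker z (0 + (1 / c) *\<^sub>R w) b = gauss w *\<^sub>R qker (z /\<^sub>R c) w b" for w
  proof -
    have "c *\<^sub>R (0 + (1 / c) *\<^sub>R w) = w" using c by simp
    moreover have "qker z (0 + (1 / c) *\<^sub>R w) b = qker (z /\<^sub>R c) w b"
      unfolding add_0_left qker_scale by (simp only: inverse_eq_divide)
    ultimately show ?thesis by (simp only:)
  qed
  have "(LBINT w. gauss (c *\<^sub>R w) *\<^sub>R qker z w b)
     = \<bar>1 / c\<bar> ^ DIM('a \<times> 'b) *\<^sub>R (LBINT w. exp (- (norm (c *\<^sub>R (0 + (1 / c) *\<^sub>R w)))\<^sup>2 / 2) *\<^sub>R qker z (0 + (1 / c) *\<^sub>R w) b)"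
  proof (rule integral_lborel_affine)
    show "(\<lambda>w::'a\<times>'b. gauss (c *\<^sub>R w) *\<^sub>R qker z w b) \<in> borel_measurable borel"
      by (intro borel_measurable_continuous_onI continuous_intros) simp
  qed (use c in simp)
  also have "\<dots> = ((1 / c) ^ DIM('a \<times> 'b) * (gauss_hat (z /\<^sub>R c))) *\<^sub>R b"
    unfolding sc gauss_qker(2) using c by simp
  finally show "(LBINT w. gauss (c *\<^sub>R w) *\<^sub>R qker z w b)
      = ((1 / c) ^ DIM('a \<times> 'b) * (gauss_hat (z /\<^sub>R c))) *\<^sub>R b" .
  have ig: "integrable lborel (\<lambda>w::'a \<times> 'b. gauss (c *\<^sub>R w))"
  proof (rule integrableI_nonneg)
    have "(\<integral>\<^sup>+w. ennreal (gauss (c *\<^sub>R (w::'a\<times>'b))) \<partial>lborel) =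
       ennreal (\<bar>1 / c\<bar> ^ DIM('a \<times> 'b)) * (\<integral>\<^sup>+w. ennreal (exp (- (norm (c *\<^sub>R (0 + (1 / c) *\<^sub>R w :: 'a\<times>'b)))\<^sup>2 / 2)) \<partial>lborel)"
      by (rule nn_integral_lborel_affine) (use c in simp_all)
    also have "\<dots> = ennreal (\<bar>1 / c\<bar> ^ DIM('a \<times> 'b)) * (\<integral>\<^sup>+w. ennreal (gauss (w :: 'a\<times>'b)) \<partial>lborel)"
      using c by simp
    also have "\<dots> < \<infinity>"
      using gauss_integral(1)[where 'a = "'a \<times> 'b"] by (simp add: nn_integral_eq_integral ennreal_mult_less_top)
    finally show "(\<integral>\<^sup>+w. ennreal (gauss (c *\<^sub>R (w::'a\<times>'b))) \<partial>lborel) < \<infinity>" .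
  qed auto
  show "integrable lborel (\<lambda>w::'a \<times> 'b. gauss (c *\<^sub>R w) *\<^sub>R qker z w b)"
  proof (rule Bochner_Integration.integrable_bound[of _ "\<lambda>w. norm b * gauss (c *\<^sub>R w)"])
    show "integrable lborel (\<lambda>w::'a\<times>'b. norm b * gauss (c *\<^sub>R w))"
      by (intro integrable_mult_right ig)
    show "(\<lambda>w::'a\<times>'b. gauss (c *\<^sub>R w) *\<^sub>R qker z w b) \<in> borel_measurable lborel"
      by (subst measurable_lborel2, intro borel_measurable_continuous_onI continuous_intros) simp
  qed auto
qed

section \<open>Plancherel's theorem for the two-sided transform\<close>

definition qft :: "('a::euclidean_space \<times> 'b::euclidean_space \<Rightarrow> quat) \<Rightarrow> 'a \<times> 'b \<Rightarrow> quat" where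
  "qft h w = (LBINT y. qker y w (h y))"

abbreviation energy :: "('a::euclidean_space \<Rightarrow> quat) \<Rightarrow> ennreal" where
  "energy h \<equiv> (\<integral>\<^sup>+x. ennreal ((norm (h x))\<^sup>2) \<partial>lborel)"

lemma integrable_qker:
  assumes h: "integrable lborel h"
  shows "integrable lborel (\<lambda>y. qker y w (h y))"
proof -
  have [measurable]: "h \<in> borel_measurable borel" using h by auto
  show ?thesis
    by (rule Bochner_Integration.integrable_bound[OF h]) (auto intro: measurable_qker)
qed

lemma norm_qft_le: "norm (qft h w) \<le> (LBINT y. norm (h y))"
  unfolding qft_def by (rule order_trans[OF integral_norm_bound]) simp

lemma measurable_qft [measurable]:
  assumes [measurable]: "h \<in> borel_measurable borel"
  shows "qft h \<in> borel_measurable borel"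
proof -
  have "(\<lambda>(w, y). qker y w (h y)) \<in> borel_measurable (borel \<Otimes>\<^sub>M lborel)"
    unfolding case_prod_beta' by (rule measurable_qker) measurable
  from lborel.borel_measurable_lebesgue_integral[OF this] show ?thesis
    unfolding qft_def[abs_def] .
qed

lemma qft_diff:
  assumes "integrable lborel h" "integrable lborel g"
  shows "qft (\<lambda>y. h y - g y) w = qft h w - qft g w"
  unfolding qft_def qker_diff
  by (rule Bochner_Integration.integral_diff) (intro integrable_qker assms)+

lemma integrable_prod_mult:
  fixes f :: "'a \<Rightarrow> real" and g :: "'b \<Rightarrow> real"
  assumes M: "sigma_finite_measure M1" "sigma_finite_measure M2"
    and f: "integrable M1 f" and g: "integrable M2 g"
  shows "integrable (M1 \<Otimes>\<^sub>M M2) (\<lambda>p. f (fst p) * g (snd p))"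
proof -
  interpret pair_sigma_finite M1 M2 using M by (rule pair_sigma_finite.intro)
  have [measurable]: "f \<in> borel_measurable M1" "g \<in> borel_measurable M2" using f g by auto
  show ?thesis
  proof (rule Fubini_integrable)
    have "(\<lambda>x. \<integral>y. norm (f (fst (x, y)) * g (snd (x, y))) \<partial>M2) = (\<lambda>x. norm (f x) * (\<integral>y. norm (g y) \<partial>M2))"
      using g by (simp add: abs_mult)
    then show "integrable M1 (\<lambda>x. \<integral>y. norm (f (fst (x, y)) * g (snd (x, y))) \<partial>M2)"
      using f by simp
  qed (use g in auto)
qed

text \<open>The Gaussian damping makes the integral over the frequency and both copies of the space
  variable absolutely convergent. Fubini and \<open>inner_qker\<close> turn the frequency integral
  into a Gaussian in the difference of the space variables, and rescaling that difference leaves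
  \<open>c\<close> only in the argument of \<open>h\<close>.\<close>

lemma qft_gauss_square:
  fixes h :: "'a::euclidean_space \<times> 'b::euclidean_space \<Rightarrow> quat"
  assumes h: "integrable lborel h" and c: "0 < c"
  shows "integrable lborel (\<lambda>w. gauss (c *\<^sub>R w) * (norm (qft h w))\<^sup>2)"
   and "(LBINT w. gauss (c *\<^sub>R w) * (norm (qft h w))\<^sup>2)
     = (\<integral>y. \<integral>\<zeta>. gauss_hat \<zeta> * (h y \<bullet> h (y + c *\<^sub>R \<zeta>)) \<partial>lborel \<partial>lborel)"
proof -
  let ?P = "(lborel :: ('a \<times> 'b) measure) \<Otimes>\<^sub>M (lborel :: ('a \<times> 'b) measure)"
  have hm[measurable]: "h \<in> borel_measurable borel" using h by auto
  define \<rho> where "\<rho> w = gauss (c *\<^sub>R w)" for w :: "'a \<times> 'b"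
  have \<rho>: "integrable lborel \<rho>"
  proof -
    \<comment> \<open>Since the kernel preserves norms, applying it to 1 and taking norms recovers
      the weight itself.\<close>
    have "integrable lborel (\<lambda>w::'a\<times>'b. norm (\<rho> w *\<^sub>R qker 0 w 1))"
      unfolding \<rho>_def by (intro integrable_norm gauss_qker_scaled c)
    moreover have "(\<lambda>w::'a\<times>'b. norm (\<rho> w *\<^sub>R qker 0 w 1)) = \<rho>"
      by (rule ext) (simp only: norm_scaleR norm_qker norm_one mult_1_right \<rho>_def abs_exp_cancel)
    ultimately show ?thesis by simp
  qed
  have [measurable]: "\<rho> \<in> borel_measurable borel" using \<rho> by auto
  have \<rho>0: "0 \<le> \<rho> w" for w by (simp add: \<rho>_def)
  show "integrable lborel (\<lambda>w. gauss (c *\<^sub>R w) * (norm (qft h w))\<^sup>2)"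
  proof (rule Bochner_Integration.integrable_bound[OF integrable_mult_left[OF \<rho>, of "(LBINT y. norm (h y))\<^sup>2"]])
    show "(\<lambda>w. gauss (c *\<^sub>R w) * (norm (qft h w))\<^sup>2) \<in> borel_measurable lborel"
      unfolding \<rho>_def[symmetric] by measurable
    show "AE w in lborel. norm (gauss (c *\<^sub>R w) * (norm (qft h w))\<^sup>2) \<le> norm (\<rho> w * (LBINT y. norm (h y))\<^sup>2)"
      unfolding \<rho>_def[symmetric] using \<rho>0 by (intro AE_I2) (auto simp: abs_mult intro!: mult_left_mono power_mono norm_qft_le)
  qed
  define \<Psi> where "\<Psi> w p = \<rho> w * (h (fst p) \<bullet> qker (snd p - fst p) w (h (snd p)))" for w p
  have PP: "sigma_finite_measure ?P" unfolding lborel_prod by (rule sigma_finite_lborel)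
  interpret LP: pair_sigma_finite "lborel :: ('a \<times> 'b) measure" ?P
    by (rule pair_sigma_finite.intro[OF sigma_finite_lborel PP])
  have int_hh: "integrable ?P (\<lambda>p. norm (h (fst p)) * norm (h (snd p)))"
    using h by (intro integrable_prod_mult sigma_finite_lborel) auto
  have int_P: "integrable ?P (\<lambda>p. h (fst p) \<bullet> qker (snd p - fst p) w (h (snd p)))" for w
  proof (rule Bochner_Integration.integrable_bound[OF int_hh])
    have "(\<lambda>p. qker (snd p - fst p) w (h (snd p))) \<in> borel_measurable ?P"
      by (rule measurable_qker) measurable
    then show "(\<lambda>p. h (fst p) \<bullet> qker (snd p - fst p) w (h (snd p))) \<in> borel_measurable ?P" by measurable
    show "AE p in ?P. norm (h (fst p) \<bullet> qker (snd p - fst p) w (h (snd p))) \<le> norm (norm (h (fst p)) * norm (h (snd p)))"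
      using Cauchy_Schwarz_ineq2 by (intro AE_I2) (auto intro: order_trans[OF Cauchy_Schwarz_ineq2])
  qed
  have sq: "(norm (qft h w))\<^sup>2 = (\<integral>p. h (fst p) \<bullet> qker (snd p - fst p) w (h (snd p)) \<partial>?P)" for w
  proof -
    have "(\<integral>p. h (fst p) \<bullet> qker (snd p - fst p) w (h (snd p)) \<partial>?P)
       = (\<integral>y. \<integral>y'. h y \<bullet> qker (y' - y) w (h y') \<partial>lborel \<partial>lborel)"
      using lborel_pair.integral_fst'[OF int_P[of w]] by simp
    also have "\<dots> = (\<integral>y. \<integral>y'. qker y w (h y) \<bullet> qker y' w (h y') \<partial>lborel \<partial>lborel)"
      unfolding inner_qker ..
    also have "\<dots> = (LBINT y. qker y w (h y) \<bullet> qft h w)"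
      unfolding qft_def using integrable_qker[OF h] by (intro Bochner_Integration.integral_cong refl integral_inner_right) 
    also have "\<dots> = qft h w \<bullet> qft h w"
      unfolding qft_def using integrable_qker[OF h] by (intro integral_inner_left)
    finally show ?thesis by (simp add: power2_norm_eq_inner)
  qed
  have int_\<Psi>: "integrable (lborel \<Otimes>\<^sub>M ?P) (\<lambda>(w, p). \<Psi> w p)"
  proof (rule Bochner_Integration.integrable_bound[OF integrable_prod_mult[OF sigma_finite_lborel PP \<rho> int_hh]])
    have "(\<lambda>q. qker (snd (snd q) - fst (snd q)) (fst q) (h (snd (snd q)))) \<in> borel_measurable (lborel \<Otimes>\<^sub>M ?P)"
      by (rule measurable_qker) measurable
    then show "(\<lambda>(w, p). \<Psi> w p) \<in> borel_measurable (lborel \<Otimes>\<^sub>M ?P)"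
      unfolding \<Psi>_def case_prod_beta' by measurable
    show "AE q in lborel \<Otimes>\<^sub>M ?P. norm (case q of (w, p) \<Rightarrow> \<Psi> w p)
        \<le> norm (\<rho> (fst q) * (norm (h (fst (snd q))) * norm (h (snd (snd q)))))"
      unfolding \<Psi>_def case_prod_beta' norm_mult
      by (intro AE_I2 mult_left_mono) (auto simp: abs_mult intro: order_trans[OF Cauchy_Schwarz_ineq2])
  qed
  have "(LBINT w. \<rho> w * (norm (qft h w))\<^sup>2) = (\<integral>w. \<integral>p. \<Psi> w p \<partial>?P \<partial>lborel)"
    unfolding \<Psi>_def sq by simp
  also have "\<dots> = (\<integral>p. \<integral>w. \<Psi> w p \<partial>lborel \<partial>?P)"
    using LP.Fubini_integral[OF int_\<Psi>] by simp
  also have "\<dots> = (\<integral>p. (1 / c) ^ DIM('a \<times> 'b) * (gauss_hat ((snd p - fst p) /\<^sub>R c)) * (h (fst p) \<bullet> h (snd p)) \<partial>?P)"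
  proof (rule Bochner_Integration.integral_cong[OF refl])
    fix p :: "('a \<times> 'b) \<times> ('a \<times> 'b)"
    have "(LBINT w. \<Psi> w p) = (LBINT w. h (fst p) \<bullet> (\<rho> w *\<^sub>R qker (snd p - fst p) w (h (snd p))))"
      by (simp add: \<Psi>_def)
    also have "\<dots> = h (fst p) \<bullet> (LBINT w. \<rho> w *\<^sub>R qker (snd p - fst p) w (h (snd p)))"
      unfolding \<rho>_def by (intro integral_inner_right gauss_qker_scaled c)
    also have "\<dots> = (1 / c) ^ DIM('a \<times> 'b) * (gauss_hat ((snd p - fst p) /\<^sub>R c)) * (h (fst p) \<bullet> h (snd p))"
      unfolding \<rho>_def gauss_qker_scaled(2)[OF c] by simp
    finally show "(LBINT w. \<Psi> w p) = (1 / c) ^ DIM('a \<times> 'b) * (gauss_hat ((snd p - fst p) /\<^sub>R c)) * (h (fst p) \<bullet> h (snd p))" .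
  qed
  also have "\<dots> = (\<integral>y. \<integral>y'. (1 / c) ^ DIM('a \<times> 'b) * (gauss_hat ((y' - y) /\<^sub>R c)) * (h y \<bullet> h y') \<partial>lborel \<partial>lborel)"
  proof -
    have "integrable ?P (\<lambda>p. (1 / c) ^ DIM('a \<times> 'b) * (gauss_hat ((snd p - fst p) /\<^sub>R c)) * (h (fst p) \<bullet> h (snd p)))"
    proof (rule Bochner_Integration.integrable_bound[OF integrable_mult_right[OF int_hh, of "(1 / c) ^ DIM('a \<times> 'b) * sqrt (2 * pi) ^ DIM('a \<times> 'b)"]])
      show "AE p in ?P. norm ((1 / c) ^ DIM('a \<times> 'b) * (gauss_hat ((snd p - fst p) /\<^sub>R c)) * (h (fst p) \<bullet> h (snd p)))
        \<le> norm ((1 / c) ^ DIM('a \<times> 'b) * sqrt (2 * pi) ^ DIM('a \<times> 'b) * (norm (h (fst p)) * norm (h (snd p))))"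
      proof (rule AE_I2)
        fix p :: "('a \<times> 'b) \<times> ('a \<times> 'b)"
        define K where "K = (1 / c) ^ DIM('a \<times> 'b) * sqrt (2 * pi) ^ DIM('a \<times> 'b)"
        have K: "0 \<le> K" using c by (simp add: K_def)
        define e where "e = gauss ((snd p - fst p) /\<^sub>R c)"
        have e: "0 \<le> e" "e \<le> 1" by (auto simp: e_def)
        have "norm (K * e * (h (fst p) \<bullet> h (snd p))) \<le> K * 1 * (norm (h (fst p)) * norm (h (snd p)))"
          unfolding norm_mult using K e by (intro mult_mono) (auto simp: Cauchy_Schwarz_ineq2)
        then show "norm ((1 / c) ^ DIM('a \<times> 'b) * (gauss_hat ((snd p - fst p) /\<^sub>R c)) * (h (fst p) \<bullet> h (snd p)))
          \<le> norm ((1 / c) ^ DIM('a \<times> 'b) * sqrt (2 * pi) ^ DIM('a \<times> 'b) * (norm (h (fst p)) * norm (h (snd p))))"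
          unfolding e_def[symmetric] mult.assoc[symmetric] K_def[symmetric] using K by (simp add: abs_mult mult_ac)
      qed
    qed measurable
    from lborel_pair.integral_fst'[OF this] show ?thesis by simp
  qed
  also have "\<dots> = (\<integral>y. \<integral>\<zeta>. gauss_hat \<zeta> * (h y \<bullet> h (y + c *\<^sub>R \<zeta>)) \<partial>lborel \<partial>lborel)"
  proof (rule Bochner_Integration.integral_cong[OF refl])
    fix y :: "'a \<times> 'b"
    let ?f = "\<lambda>y'. (1 / c) ^ DIM('a \<times> 'b) * (gauss_hat ((y' - y) /\<^sub>R c)) * (h y \<bullet> h y')"
    have "(\<integral>y'. ?f y' \<partial>lborel) = \<bar>c\<bar> ^ DIM('a \<times> 'b) *\<^sub>R (LBINT \<zeta>. ?f (y + c *\<^sub>R \<zeta>))"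
      by (rule integral_lborel_affine) (use c in simp_all)
    also have "\<dots> = (LBINT \<zeta>. c ^ DIM('a \<times> 'b) * ?f (y + c *\<^sub>R \<zeta>))"
      using c by (simp only: real_scaleR_def abs_of_pos Bochner_Integration.integral_mult_right_zero)
    also have "\<dots> = (LBINT \<zeta>. gauss_hat \<zeta> * (h y \<bullet> h (y + c *\<^sub>R \<zeta>)))"
    proof (rule Bochner_Integration.integral_cong[OF refl])
      fix \<zeta> :: "'a \<times> 'b"
      have 1: "(y + c *\<^sub>R \<zeta> - y) /\<^sub>R c = \<zeta>" using c by simp
      have 2: "c ^ DIM('a \<times> 'b) * (1 / c) ^ DIM('a \<times> 'b) = 1" using c by (simp add: power_mult_distrib[symmetric])
      have "c ^ DIM('a \<times> 'b) * ?f (y + c *\<^sub>R \<zeta>) = (c ^ DIM('a \<times> 'b) * (1 / c) ^ DIM('a \<times> 'b)) * (gauss_hat \<zeta> * (h y \<bullet> h (y + c *\<^sub>R \<zeta>)))"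
        unfolding 1 by (simp only: mult_ac)
      then show "c ^ DIM('a \<times> 'b) * ?f (y + c *\<^sub>R \<zeta>) = gauss_hat \<zeta> * (h y \<bullet> h (y + c *\<^sub>R \<zeta>))"
        unfolding 2 by simp
    qed
    finally show "(\<integral>y'. ?f y' \<partial>lborel) = (LBINT \<zeta>. gauss_hat \<zeta> * (h y \<bullet> h (y + c *\<^sub>R \<zeta>)))" .
  qed
  finally show "(LBINT w. gauss (c *\<^sub>R w) * (norm (qft h w))\<^sup>2)
     = (\<integral>y. \<integral>\<zeta>. gauss_hat \<zeta> * (h y \<bullet> h (y + c *\<^sub>R \<zeta>)) \<partial>lborel \<partial>lborel)"
    unfolding \<rho>_def .
qed

lemma integrable_lborel_translate:
  fixes f :: "'a::euclidean_space \<Rightarrow> 'b::{banach, second_countable_topology}"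
  assumes "integrable lborel f"
  shows "integrable lborel (\<lambda>y. f (y + z))"
proof -
  have "integrable (distr lborel borel ((+) z)) f" unfolding lborel_distr_plus by (rule assms)
  then have "integrable lborel (\<lambda>y. f (z + y))" by (rule integrable_distr[rotated]) simp
  then show ?thesis by (simp add: add.commute)
qed

lemma integral_lborel_translate:
  fixes f :: "'a::euclidean_space \<Rightarrow> 'b::{banach, second_countable_topology}"
  assumes [measurable]: "f \<in> borel_measurable borel"
  shows "(LBINT y. f (y + z)) = (LBINT y. f y)"
  using integral_lborel_affine[of f 1 z] by (simp add: add.commute)

definition correlation :: "('a::euclidean_space \<Rightarrow> 'b::euclidean_space) \<Rightarrow> ('a \<Rightarrow> 'b) \<Rightarrow> 'a \<Rightarrow> real" where
  "correlation h g z = (LBINT y. h y \<bullet> g (y + z))"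

context
  fixes h :: "'a::euclidean_space \<Rightarrow> 'b::euclidean_space" and M :: real
  assumes h: "integrable lborel h" and M: "\<And>y. norm (h y) \<le> M"
begin

lemma M_nonneg: "0 \<le> M"
  using M[of 0] norm_ge_zero order_trans by blast

lemma integrable_correlation:
  assumes g: "integrable lborel g"
  shows "integrable lborel (\<lambda>y. h y \<bullet> g (y + z))"
proof -
  have [measurable]: "g \<in> borel_measurable borel" "h \<in> borel_measurable borel" using g h by auto
  show ?thesis
  proof (rule Bochner_Integration.integrable_bound[OF integrable_mult_right[OF integrable_norm[OF integrable_lborel_translate[OF g, of z]], of M]])
    show "AE y in lborel. norm (h y \<bullet> g (y + z)) \<le> norm (M * norm (g (y + z)))"
    proof (rule AE_I2)
      fix y
      have "norm (h y \<bullet> g (y + z)) \<le> norm (h y) * norm (g (y + z))" using Cauchy_Schwarz_ineq2 by simp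
      also have "\<dots> \<le> M * norm (g (y + z))" by (rule mult_right_mono[OF M]) simp
      finally show "norm (h y \<bullet> g (y + z)) \<le> norm (M * norm (g (y + z)))" by simp
    qed
  qed measurable
qed

lemma correlation_bound:
  assumes g: "integrable lborel g"
  shows "\<bar>correlation h g z\<bar> \<le> M * (LBINT y. norm (g y))"
proof -
  have [measurable]: "g \<in> borel_measurable borel" "h \<in> borel_measurable borel" using g h by auto
  have "\<bar>correlation h g z\<bar> \<le> (LBINT y. norm (h y \<bullet> g (y + z)))"
    unfolding correlation_def using integral_norm_bound[of lborel "\<lambda>y. h y \<bullet> g (y + z)"] by simp
  also have "\<dots> \<le> (LBINT y. M * norm (g (y + z)))"
  proof (rule integral_mono)
    fix y
    have "norm (h y \<bullet> g (y + z)) \<le> norm (h y) * norm (g (y + z))" using Cauchy_Schwarz_ineq2 by simp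
    also have "\<dots> \<le> M * norm (g (y + z))" by (rule mult_right_mono[OF M]) simp
    finally show "norm (h y \<bullet> g (y + z)) \<le> M * norm (g (y + z))" .
  qed (intro integrable_norm integrable_correlation g integrable_mult_right integrable_lborel_translate)+
  also have "\<dots> = M * (LBINT y. norm (g y))"
    using integral_lborel_translate[of "\<lambda>y. norm (g y)" z] by simp
  finally show ?thesis .
qed

text \<open>Only the shifted factor is replaced by a bounded continuous \<open>g\<close>. By
  \<open>correlation_bound\<close> the resulting error is small uniformly in the shift, and for
  \<open>g\<close> itself dominated convergence applies.\<close>

lemma correlation_tendsto:
  assumes z: "z \<longlonglongrightarrow> 0"
  shows "(\<lambda>n. correlation h h (z n)) \<longlonglongrightarrow> correlation h h 0"
proof (rule LIMSEQ_I)
  fix r :: real assume r: "0 < r"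
  \<comment> \<open>Three errors of size \<open>r / 3\<close> are added below; the summand 1 covers
    the case \<open>M = 0\<close>.\<close>
  define e where "e = r / (3 * (M + 1))"
  have e: "0 < e" using r M_nonneg by (simp add: e_def)
  have eM: "M * e < r / 3"
    using r M_nonneg by (simp add: e_def field_simps)
  obtain g where g: "continuous_on UNIV g" "bounded (range g)" "integrable lborel g"
    "(LBINT x. norm (h x - g x)) < e"
    using integrable_approx_continuous[OF h e] by blast
  obtain B where B: "\<And>x. norm (g x) \<le> B" using g(2) by (auto simp: bounded_iff)
  have [measurable]: "g \<in> borel_measurable borel" "h \<in> borel_measurable borel" using g h by auto
  have "(\<lambda>n. \<integral>y. h y \<bullet> g (y + z n) \<partial>lborel) \<longlonglongrightarrow> (LBINT y. h y \<bullet> g (y + 0))"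
  proof (rule integral_dominated_convergence[where w = "\<lambda>y. B * norm (h y)"])
    show "integrable lborel (\<lambda>y. B * norm (h y))" using h by simp
    show "AE y in lborel. (\<lambda>n. h y \<bullet> g (y + z n)) \<longlonglongrightarrow> h y \<bullet> g (y + 0)"
    proof (rule AE_I2)
      fix y
      have "isCont g (y + 0)" using g(1) by (simp add: continuous_on_eq_continuous_at)
      then show "(\<lambda>n. h y \<bullet> g (y + z n)) \<longlonglongrightarrow> h y \<bullet> g (y + 0)"
        by (intro tendsto_inner tendsto_const isCont_tendsto_compose[of _ g] tendsto_add z)
    qed
    show "AE y in lborel. norm (h y \<bullet> g (y + z n)) \<le> B * norm (h y)" for n
    proof (rule AE_I2)
      fix y
      have "norm (h y \<bullet> g (y + z n)) \<le> norm (h y) * norm (g (y + z n))" using Cauchy_Schwarz_ineq2 by simp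
      also have "\<dots> \<le> norm (h y) * B" by (rule mult_left_mono[OF B]) simp
      finally show "norm (h y \<bullet> g (y + z n)) \<le> B * norm (h y)" by (simp add: mult.commute)
    qed
  qed measurable
  then have "(\<lambda>n. correlation h g (z n)) \<longlonglongrightarrow> correlation h g 0" unfolding correlation_def .
  then obtain N where N: "\<And>n. n \<ge> N \<Longrightarrow> norm (correlation h g (z n) - correlation h g 0) < r / 3"
    using LIMSEQ_D[of _ _ "r / 3"] r by (metis zero_less_divide_iff zero_less_numeral)
  have hg: "integrable lborel (\<lambda>y. h y - g y)" using h g by simp
  have d: "\<bar>correlation h h x - correlation h g x\<bar> < r / 3" for x
  proof -
    have "correlation h h x - correlation h g x = correlation h (\<lambda>y. h y - g y) x"
      unfolding correlation_def inner_diff_right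
      by (rule Bochner_Integration.integral_diff[symmetric]) (intro integrable_correlation h g)+
    then have "\<bar>correlation h h x - correlation h g x\<bar> \<le> M * (LBINT x. norm (h x - g x))"
      using correlation_bound[OF hg, of x] by simp
    also have "\<dots> \<le> M * e" using g(4) M_nonneg by (intro mult_left_mono) auto
    finally show ?thesis using eM by simp
  qed
  have "norm (correlation h h (z n) - correlation h h 0) < r" if "n \<ge> N" for n
    using N[OF that] d[of "z n"] d[of 0] unfolding real_norm_def by linarith
  then show "\<exists>N. \<forall>n\<ge>N. norm (correlation h h (z n) - correlation h h 0) < r" by blast
qed

end

text \<open>The bound \<open>M\<close> makes the product integrable in both variables jointly, so
  the space integral can be taken first and becomes the autocorrelation.\<close>

lemma qft_gauss_square_correlation:
  fixes h :: "'a::euclidean_space \<times> 'b::euclidean_space \<Rightarrow> quat"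
  assumes h: "integrable lborel h" and M: "\<And>y. norm (h y) \<le> M" and c: "0 < c"
  shows "(LBINT w. gauss (c *\<^sub>R w) * (norm (qft h w))\<^sup>2)
     = (LBINT \<zeta>. gauss_hat \<zeta> * correlation h h (c *\<^sub>R \<zeta>))"
proof -
  let ?P = "(lborel :: ('a \<times> 'b) measure) \<Otimes>\<^sub>M (lborel :: ('a \<times> 'b) measure)"
  have hm[measurable]: "h \<in> borel_measurable borel" using h by auto
  define k where "k \<zeta> = gauss_hat \<zeta>" for \<zeta> :: "'a \<times> 'b"
  have k: "integrable lborel k" unfolding k_def by (intro integrable_mult_right gauss_integral)
  have k0: "0 \<le> k \<zeta>" for \<zeta> by (simp add: k_def)
  have [measurable]: "k \<in> borel_measurable borel" using k by auto
  have int: "integrable ?P (\<lambda>(\<zeta>, y). k \<zeta> * (h y \<bullet> h (y + c *\<^sub>R \<zeta>)))"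
  proof (rule lborel_pair.Fubini_integrable)
    show "(\<lambda>(\<zeta>, y). k \<zeta> * (h y \<bullet> h (y + c *\<^sub>R \<zeta>))) \<in> borel_measurable ?P" by measurable
    have "integrable lborel (\<lambda>\<zeta>. \<integral>y. norm (k \<zeta> * (h y \<bullet> h (y + c *\<^sub>R \<zeta>))) \<partial>lborel)"
    proof (rule Bochner_Integration.integrable_bound[OF integrable_mult_left[OF k, of "M * (LBINT y. norm (h y))"]])
      show "AE \<zeta> in lborel. norm (LBINT y. norm (k \<zeta> * (h y \<bullet> h (y + c *\<^sub>R \<zeta>)))) \<le> norm (k \<zeta> * (M * (LBINT y. norm (h y))))"
      proof (rule AE_I2)
        fix \<zeta> :: "'a \<times> 'b"
        have "(LBINT y. norm (h y \<bullet> h (y + c *\<^sub>R \<zeta>))) \<le> (LBINT y. M * norm (h (y + c *\<^sub>R \<zeta>)))"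
        proof (rule integral_mono)
          fix y
          have "norm (h y \<bullet> h (y + c *\<^sub>R \<zeta>)) \<le> norm (h y) * norm (h (y + c *\<^sub>R \<zeta>))" using Cauchy_Schwarz_ineq2 by simp
          also have "\<dots> \<le> M * norm (h (y + c *\<^sub>R \<zeta>))" by (rule mult_right_mono[OF M]) simp
          finally show "norm (h y \<bullet> h (y + c *\<^sub>R \<zeta>)) \<le> M * norm (h (y + c *\<^sub>R \<zeta>))" .
        qed (intro integrable_norm integrable_correlation[OF h M] h integrable_mult_right integrable_lborel_translate)+
        also have "\<dots> = M * (LBINT y. norm (h y))"
          using integral_lborel_translate[of "\<lambda>y. norm (h y)" "c *\<^sub>R \<zeta>"] by simp
        finally have "(LBINT y. norm (h y \<bullet> h (y + c *\<^sub>R \<zeta>))) \<le> M * (LBINT y. norm (h y))" .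
        then have "k \<zeta> * (LBINT y. norm (h y \<bullet> h (y + c *\<^sub>R \<zeta>))) \<le> k \<zeta> * (M * (LBINT y. norm (h y)))"
          using k0 by (rule mult_left_mono)
        moreover have "(LBINT y. norm (k \<zeta> * (h y \<bullet> h (y + c *\<^sub>R \<zeta>)))) = k \<zeta> * (LBINT y. norm (h y \<bullet> h (y + c *\<^sub>R \<zeta>)))"
          using k0 by (simp add: abs_mult)
        moreover have gen: "norm X \<le> norm Y" if "0 \<le> X" "X \<le> Y" for X Y :: real using that by simp
        moreover have "0 \<le> (LBINT y. norm (k \<zeta> * (h y \<bullet> h (y + c *\<^sub>R \<zeta>))))" by simp
        ultimately show "norm (LBINT y. norm (k \<zeta> * (h y \<bullet> h (y + c *\<^sub>R \<zeta>)))) \<le> norm (k \<zeta> * (M * (LBINT y. norm (h y))))"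
          by (intro gen) simp_all
      qed
    qed measurable
    then show "integrable lborel (\<lambda>x. \<integral>y. norm (case (x, y) of (\<zeta>, y) \<Rightarrow> k \<zeta> * (h y \<bullet> h (y + c *\<^sub>R \<zeta>))) \<partial>lborel)"
      by (simp only: prod.case)
    show "AE x in lborel. integrable lborel (\<lambda>y. case (x, y) of (\<zeta>, y) \<Rightarrow> k \<zeta> * (h y \<bullet> h (y + c *\<^sub>R \<zeta>)))"
      unfolding prod.case by (intro AE_I2 integrable_mult_right integrable_correlation[OF h M] h)
  qed
  have "(\<integral>y. \<integral>\<zeta>. k \<zeta> * (h y \<bullet> h (y + c *\<^sub>R \<zeta>)) \<partial>lborel \<partial>lborel) = (\<integral>\<zeta>. \<integral>y. k \<zeta> * (h y \<bullet> h (y + c *\<^sub>R \<zeta>)) \<partial>lborel \<partial>lborel)"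
    by (rule lborel_pair.Fubini_integral[OF int])
  also have "\<dots> = (LBINT \<zeta>. k \<zeta> * correlation h h (c *\<^sub>R \<zeta>))"
    unfolding correlation_def by simp
  finally show ?thesis unfolding qft_gauss_square(2)[OF h c] k_def .
qed

text \<open>As the damping is removed, the frequency side converges monotonically to the energy of
  the transform. On the space side the autocorrelation tends to its value at 0, the squared norm of
  \<open>h\<close>, under dominated convergence; the factor is the mass of
  \<open>gauss_hat\<close>.\<close>

lemma Plancherel_bounded:
  fixes h :: "'a::euclidean_space \<times> 'b::euclidean_space \<Rightarrow> quat"
  assumes h: "integrable lborel h" and M: "\<And>y. norm (h y) \<le> M"
  shows "energy (qft h) = ennreal ((2 * pi) ^ DIM('a \<times> 'b) * (LBINT y. (norm (h y))\<^sup>2))"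
proof -
  have hm[measurable]: "h \<in> borel_measurable borel" using h by auto
  define k where "k \<zeta> = gauss_hat \<zeta>" for \<zeta> :: "'a \<times> 'b"
  have k: "integrable lborel k" unfolding k_def by (intro integrable_mult_right gauss_integral)
  have k0: "0 \<le> k \<zeta>" for \<zeta> by (simp add: k_def)
  have [measurable]: "k \<in> borel_measurable borel" using k by auto
  have ik: "integral\<^sup>L lborel k = (2 * pi) ^ DIM('a \<times> 'b)"
  proof -
    have "sqrt (2 * pi) ^ DIM('a \<times> 'b) * sqrt (2 * pi) ^ DIM('a \<times> 'b) = (2 * pi) ^ DIM('a \<times> 'b)"
      unfolding power_mult_distrib[of "sqrt (2 * pi)" "sqrt (2 * pi)", symmetric] by (simp del: DIM_prod)
    then show ?thesis
      unfolding k_def Bochner_Integration.integral_mult_right_zero gauss_integral(2) .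
  qed
  define c where "c n = 1 / real (Suc n)" for n
  have c: "0 < c n" for n by (simp add: c_def)
  have c0: "c \<longlonglongrightarrow> 0" unfolding c_def using LIMSEQ_Suc[OF lim_1_over_n[where 'a = real]] .
  define J where "J n = (LBINT w. gauss (c n *\<^sub>R w) * (norm (qft h w))\<^sup>2)" for n
  have corr_m: "correlation h h \<in> borel_measurable borel"
  proof -
    have "(\<lambda>(z, y). h y \<bullet> h (y + z)) \<in> borel_measurable (borel \<Otimes>\<^sub>M lborel)" by measurable
    from lborel.borel_measurable_lebesgue_integral[OF this] show ?thesis unfolding correlation_def[abs_def] .
  qed
  have "J \<longlonglongrightarrow> (LBINT \<zeta>. k \<zeta> * correlation h h 0)"
    unfolding J_def qft_gauss_square_correlation[OF h M c] k_def[symmetric]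
  proof (rule integral_dominated_convergence[where w = "\<lambda>\<zeta>. k \<zeta> * (M * (LBINT y. norm (h y)))"])
    show "integrable lborel (\<lambda>\<zeta>. k \<zeta> * (M * (LBINT y. norm (h y))))" using k by simp
    show "(\<lambda>\<zeta>. k \<zeta> * correlation h h (c n *\<^sub>R \<zeta>)) \<in> borel_measurable lborel" for n
    proof -
      have [measurable]: "(\<lambda>\<zeta>. correlation h h (c n *\<^sub>R \<zeta>)) \<in> borel_measurable borel"
        by (rule measurable_compose[OF _ corr_m]) measurable
      show ?thesis by measurable
    qed
    show "AE \<zeta> in lborel. (\<lambda>n. k \<zeta> * correlation h h (c n *\<^sub>R \<zeta>)) \<longlonglongrightarrow> k \<zeta> * correlation h h 0"
    proof (intro AE_I2 tendsto_mult tendsto_const correlation_tendsto[OF h M])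
      fix \<zeta> :: "'a \<times> 'b"
      show "(\<lambda>n. c n *\<^sub>R \<zeta>) \<longlonglongrightarrow> 0" using tendsto_scaleR[OF c0 tendsto_const[of \<zeta>]] by simp
    qed
    show "AE \<zeta> in lborel. norm (k \<zeta> * correlation h h (c n *\<^sub>R \<zeta>)) \<le> k \<zeta> * (M * (LBINT y. norm (h y)))" for n
      unfolding norm_mult using k0 correlation_bound[OF h M h] by (intro AE_I2) (simp add: mult_left_mono)
  qed measurable
  also have "(LBINT \<zeta>. k \<zeta> * correlation h h 0) = (2 * pi) ^ DIM('a \<times> 'b) * (LBINT y. (norm (h y))\<^sup>2)"
    using ik by (simp add: correlation_def power2_norm_eq_inner del: DIM_prod)
  finally have J: "J \<longlonglongrightarrow> (2 * pi) ^ DIM('a \<times> 'b) * (LBINT y. (norm (h y))\<^sup>2)" .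
  have eJ: "(\<integral>\<^sup>+w. ennreal (gauss (c n *\<^sub>R w) * (norm (qft h w))\<^sup>2) \<partial>lborel) = ennreal (J n)" for n
    unfolding J_def by (rule nn_integral_eq_integral[OF qft_gauss_square(1)[OF h c]]) simp
  have "(\<lambda>n. \<integral>\<^sup>+w. ennreal (gauss (c n *\<^sub>R w) * (norm (qft h w))\<^sup>2) \<partial>lborel) \<longlonglongrightarrow> energy (qft h)"
  proof (rule nn_integral_LIMSEQ)
    show "incseq (\<lambda>n w. ennreal (gauss (c n *\<^sub>R w) * (norm (qft h w))\<^sup>2))"
    proof (rule incseq_SucI, rule le_funI, rule ennreal_leI, rule mult_right_mono)
      fix n w
      have "c (Suc n) \<le> c n" unfolding c_def by (simp add: field_simps)
      then have "norm (c (Suc n) *\<^sub>R w) \<le> norm (c n *\<^sub>R w)"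
        using c[of n] c[of "Suc n"] by (simp add: mult_right_mono)
      then show "gauss (c n *\<^sub>R w) \<le> gauss (c (Suc n) *\<^sub>R w)"
        by (simp add: power_mono del: norm_scaleR)
    qed simp
    show "(\<lambda>w. ennreal (gauss (c n *\<^sub>R w) * (norm (qft h w))\<^sup>2)) \<in> borel_measurable lborel" for n
      using borel_measurable_integrable[OF qft_gauss_square(1)[OF h c]] by measurable
    show "(\<lambda>n. ennreal (gauss (c n *\<^sub>R w) * (norm (qft h w))\<^sup>2)) \<longlonglongrightarrow> ennreal ((norm (qft h w))\<^sup>2)" for w
    proof -
      have "(\<lambda>n. gauss (c n *\<^sub>R w) * (norm (qft h w))\<^sup>2) \<longlonglongrightarrow> gauss (0 *\<^sub>R w) * (norm (qft h w))\<^sup>2"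
        by (intro tendsto_intros c0) simp
      then show ?thesis by (intro tendsto_ennrealI) simp
    qed
  qed
  moreover have "(\<lambda>n. \<integral>\<^sup>+w. ennreal (gauss (c n *\<^sub>R w) * (norm (qft h w))\<^sup>2) \<partial>lborel) \<longlonglongrightarrow> ennreal ((2 * pi) ^ DIM('a \<times> 'b) * (LBINT y. (norm (h y))\<^sup>2))"
    unfolding eJ by (intro tendsto_ennrealI J)
  ultimately show ?thesis by (rule LIMSEQ_unique)
qed

lemma bounded_truncations:
  fixes h :: "'a::euclidean_space \<Rightarrow> quat"
  assumes h: "integrable lborel h"
  shows "\<exists>hn. (\<forall>n. integrable lborel (hn n) \<and> (\<forall>y. norm (hn n y) \<le> real n \<and> norm (hn n y) \<le> norm (h y)))
    \<and> (\<forall>y. (\<lambda>n. hn n y) \<longlonglongrightarrow> h y)"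
proof -
  define hn where "hn n y = (if norm (h y) \<le> real n then h y else 0)" for n y
  have [measurable]: "h \<in> borel_measurable borel" using h by auto
  have le: "norm (hn n y) \<le> norm (h y)" "norm (hn n y) \<le> real n" for n y by (auto simp: hn_def)
  have [measurable]: "hn n \<in> borel_measurable borel" for n unfolding hn_def by measurable
  have int: "integrable lborel (hn n)" for n
    by (rule Bochner_Integration.integrable_bound[OF h]) (auto simp: le)
  have lim: "(\<lambda>n. hn n y) \<longlonglongrightarrow> h y" for y
  proof (rule tendsto_eventually)
    obtain N where "norm (h y) \<le> real N" using real_arch_simple by blast
    then show "\<forall>\<^sub>F n in sequentially. hn n y = h y"
      unfolding eventually_sequentially by (intro exI[of _ N]) (auto simp: hn_def)
  qed
  show ?thesis using int le lim by (intro exI[of _ hn]) blast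
qed

text \<open>Fatou along bounded truncations yields one direction. It is isolated because the other
  direction applies it to the remainders \<open>h - hn n\<close>, which need not be bounded.\<close>

lemma Plancherel_upper:
  fixes h :: "'a::euclidean_space \<times> 'b::euclidean_space \<Rightarrow> quat"
  assumes h: "integrable lborel h" and h2: "integrable lborel (\<lambda>y. (norm (h y))\<^sup>2)"
  shows "energy (qft h) \<le> ennreal ((2 * pi) ^ DIM('a \<times> 'b) * (LBINT y. (norm (h y))\<^sup>2))"
proof -
  have hm[measurable]: "h \<in> borel_measurable borel" using h by auto
  obtain hn where int: "\<And>n. integrable lborel (hn n)" and leM: "\<And>n y. norm (hn n y) \<le> real n"
    and leh: "\<And>n y. norm (hn n y) \<le> norm (h y)" and lim: "\<And>y. (\<lambda>n. hn n y) \<longlonglongrightarrow> h y"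
    using bounded_truncations[OF h] by blast
  note le = leh leM
  have hnm[measurable]: "hn n \<in> borel_measurable borel" for n using int[of n] by auto
  have int2: "integrable lborel (\<lambda>y. (norm (hn n y))\<^sup>2)" for n
    by (rule Bochner_Integration.integrable_bound[OF h2]) (auto intro!: power_mono le)
  have limq: "(\<lambda>n. qft (hn n) w) \<longlonglongrightarrow> qft h w" for w
    unfolding qft_def
  proof (rule integral_dominated_convergence[where w = "\<lambda>y. norm (h y)"])
    show "(\<lambda>y. qker y w (h y)) \<in> borel_measurable lborel" "(\<lambda>y. qker y w (hn n y)) \<in> borel_measurable lborel" for n
      by (rule borel_measurable_integrable[OF integrable_qker], rule h int)+
    show "AE y in lborel. (\<lambda>n. qker y w (hn n y)) \<longlonglongrightarrow> qker y w (h y)"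
      unfolding qker_def by (intro AE_I2 tendsto_intros lim)
  qed (use h le in auto)
  have "energy (qft h) = (\<integral>\<^sup>+w. liminf (\<lambda>n. ennreal ((norm (qft (hn n) w))\<^sup>2)) \<partial>lborel)"
    by (intro nn_integral_cong lim_imp_Liminf[symmetric] tendsto_ennrealI tendsto_intros limq) simp
  also have "\<dots> \<le> liminf (\<lambda>n. \<integral>\<^sup>+w. ennreal ((norm (qft (hn n) w))\<^sup>2) \<partial>lborel)"
    by (rule nn_integral_liminf) simp
  also have "\<dots> \<le> liminf (\<lambda>n::nat. ennreal ((2 * pi) ^ DIM('a \<times> 'b) * (LBINT y. (norm (h y))\<^sup>2)))"
  proof (intro Liminf_mono always_eventually allI)
    fix n
    show "energy (qft (hn n)) \<le> ennreal ((2 * pi) ^ DIM('a \<times> 'b) * (LBINT y. (norm (h y))\<^sup>2))"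
      unfolding Plancherel_bounded[OF int le(2)]
      by (intro ennreal_leI mult_left_mono integral_mono int2 h2 power_mono le) auto
  qed
  also have "\<dots> = ennreal ((2 * pi) ^ DIM('a \<times> 'b) * (LBINT y. (norm (h y))\<^sup>2))"
    by (rule Liminf_const) simp
  finally show "energy (qft h) \<le> ennreal ((2 * pi) ^ DIM('a \<times> 'b) * (LBINT y. (norm (h y))\<^sup>2))" .
qed

theorem Plancherel:
  fixes h :: "'a::euclidean_space \<times> 'b::euclidean_space \<Rightarrow> quat"
  assumes h: "integrable lborel h" and h2: "integrable lborel (\<lambda>y. (norm (h y))\<^sup>2)"
  shows "energy (qft h) = ennreal ((2 * pi) ^ DIM('a \<times> 'b) * (LBINT y. (norm (h y))\<^sup>2))"
proof (rule antisym)
  have hm[measurable]: "h \<in> borel_measurable borel" using h by auto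
  define K where "K = (2 * pi) ^ DIM('a \<times> 'b)"
  have K: "0 < K" unfolding K_def by (rule zero_less_power) simp
  note up = Plancherel_upper[OF h h2, folded K_def]
  show "energy (qft h) \<le> ennreal ((2 * pi) ^ DIM('a \<times> 'b) * (LBINT y. (norm (h y))\<^sup>2))"
    by (rule Plancherel_upper[OF h h2])
  obtain hn where hn: "\<And>n. integrable lborel (hn n)" "\<And>n y. norm (hn n y) \<le> real n" "\<And>n y. norm (hn n y) \<le> norm (h y)"
    "\<And>y. (\<lambda>n. hn n y) \<longlonglongrightarrow> h y"
    using bounded_truncations[OF h] by blast
  have [measurable]: "hn n \<in> borel_measurable borel" for n using hn(1)[of n] by auto
  have d2: "(norm (h y - hn n y))\<^sup>2 \<le> 4 * (norm (h y))\<^sup>2" for n y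
  proof -
    have "norm (h y - hn n y) \<le> 2 * norm (h y)" using norm_triangle_ineq4[of "h y" "hn n y"] hn(3)[of n y] by linarith
    then have "(norm (h y - hn n y))\<^sup>2 \<le> (2 * norm (h y))\<^sup>2" by (intro power_mono) auto
    then show ?thesis by (simp add: power_mult_distrib)
  qed
  have i2: "integrable lborel (\<lambda>y. (norm (h y - hn n y))\<^sup>2)" for n
    by (rule Bochner_Integration.integrable_bound[OF integrable_mult_right[OF h2, of 4]]) (auto simp: d2)
  define I where "I = enn2real (energy (qft h))"
  have I: "energy (qft h) = ennreal I"
    using up unfolding I_def by (metis ennreal_enn2real ennreal_less_top less_top order_le_less_trans)
  have I0: "0 \<le> I" by (simp add: I_def)
  define E where "E n = (LBINT y. (norm (h y - hn n y))\<^sup>2)" for n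
  define S where "S n = (LBINT y. (norm (hn n y))\<^sup>2)" for n
  have E: "E \<longlonglongrightarrow> 0"
  proof -
    have "E \<longlonglongrightarrow> (\<integral>y. 0 \<partial>(lborel :: ('a \<times> 'b) measure))" unfolding E_def
    proof (rule integral_dominated_convergence[where w = "\<lambda>y. 4 * (norm (h y))\<^sup>2"])
      show "AE y in lborel. (\<lambda>n. (norm (h y - hn n y))\<^sup>2) \<longlonglongrightarrow> 0"
      proof (rule AE_I2)
        fix y
        have "(\<lambda>n. (norm (h y - hn n y))\<^sup>2) \<longlonglongrightarrow> (norm (h y - h y))\<^sup>2" by (intro tendsto_intros hn(4))
        then show "(\<lambda>n. (norm (h y - hn n y))\<^sup>2) \<longlonglongrightarrow> 0" by simp
      qed
    qed (use h2 d2 in auto)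
    then show ?thesis by simp
  qed
  have S: "S \<longlonglongrightarrow> (LBINT y. (norm (h y))\<^sup>2)" unfolding S_def
  proof (rule integral_dominated_convergence[where w = "\<lambda>y. (norm (h y))\<^sup>2"])
    show "AE y in lborel. (\<lambda>n. (norm (hn n y))\<^sup>2) \<longlonglongrightarrow> (norm (h y))\<^sup>2"
      by (intro AE_I2 tendsto_intros hn(4))
  qed (use h2 hn(3) in \<open>auto intro!: power_mono\<close>)
  \<comment> \<open>The transform of the truncation is compared with that of \<open>h\<close> by
    \<open>(a + b)\<^sup>2 \<le> (1 + e) * a\<^sup>2 + (1 + 1 / e) * b\<^sup>2\<close>, which plays
    the part of Minkowski's inequality. For fixed \<open>e\<close> the remainder term tends to 0;
    afterwards \<open>e\<close> tends to 0.\<close>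
  have key: "K * (LBINT y. (norm (h y))\<^sup>2) \<le> (1 + e) * I" if e: "0 < e" for e
  proof (rule LIMSEQ_le[where X = "\<lambda>n. K * S n" and Y = "\<lambda>n. (1 + e) * I + (1 + 1 / e) * (K * E n)"])
    show "(\<lambda>n. K * S n) \<longlonglongrightarrow> K * (LBINT y. (norm (h y))\<^sup>2)" by (intro tendsto_intros S)
    have "(\<lambda>n. (1 + e) * I + (1 + 1 / e) * (K * E n)) \<longlonglongrightarrow> (1 + e) * I + (1 + 1 / e) * (K * 0)" by (intro tendsto_intros E)
    then show "(\<lambda>n. (1 + e) * I + (1 + 1 / e) * (K * E n)) \<longlonglongrightarrow> (1 + e) * I" by simp
    have "K * S n \<le> (1 + e) * I + (1 + 1 / e) * (K * E n)" for n
    proof -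
      have pw: "(norm (qft (hn n) w))\<^sup>2 \<le> (1 + e) * (norm (qft h w))\<^sup>2 + (1 + 1 / e) * (norm (qft (\<lambda>y. h y - hn n y) w))\<^sup>2" for w
      proof -
        define a where "a = norm (qft h w)"
        define b where "b = norm (qft h w - qft (hn n) w)"
        have "norm (qft (hn n) w) \<le> a + b" unfolding a_def b_def
          by (metis norm_minus_commute norm_triangle_sub)
        then have "(norm (qft (hn n) w))\<^sup>2 \<le> (a + b)\<^sup>2" by (intro power_mono) auto
        also have "\<dots> \<le> (1 + e) * a\<^sup>2 + (1 + 1 / e) * b\<^sup>2"
        proof -
          have "0 \<le> (sqrt e * a - b / sqrt e)\<^sup>2" by simp
          also have "(sqrt e * a - b / sqrt e)\<^sup>2 = e * a\<^sup>2 + b\<^sup>2 / e - 2 * (a * b)"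
            using e by (simp add: power2_diff power_mult_distrib power_divide)
          finally show ?thesis by (simp add: power2_sum algebra_simps)
        qed
        finally show ?thesis unfolding a_def b_def qft_diff[OF h hn(1)] .
      qed
      have "ennreal (K * S n) = energy (qft (hn n))"
        unfolding K_def S_def by (rule Plancherel_bounded[OF hn(1,2), symmetric])
      also have "\<dots> \<le> (\<integral>\<^sup>+w. ennreal (1 + e) * ennreal ((norm (qft h w))\<^sup>2) + ennreal (1 + 1 / e) * ennreal ((norm (qft (\<lambda>y. h y - hn n y) w))\<^sup>2) \<partial>lborel)"
        using pw e by (intro nn_integral_mono) (simp add: ennreal_mult[symmetric] ennreal_plus[symmetric] del: ennreal_plus)
      also have "\<dots> = ennreal (1 + e) * ennreal I + ennreal (1 + 1 / e) * (\<integral>\<^sup>+w. ennreal ((norm (qft (\<lambda>y. h y - hn n y) w))\<^sup>2) \<partial>lborel)"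
        unfolding I[symmetric] by (subst nn_integral_add) (auto simp: nn_integral_cmult)
      also have "\<dots> \<le> ennreal (1 + e) * ennreal I + ennreal (1 + 1 / e) * ennreal (K * E n)"
        unfolding K_def E_def by (intro add_left_mono mult_left_mono Plancherel_upper i2 Bochner_Integration.integrable_diff h hn(1)) simp
      also have "\<dots> = ennreal ((1 + e) * I + (1 + 1 / e) * (K * E n))"
        using e I0 K by (simp add: ennreal_mult[symmetric] ennreal_plus[symmetric] E_def del: ennreal_plus)
      finally have "ennreal (K * S n) \<le> ennreal ((1 + e) * I + (1 + 1 / e) * (K * E n))" .
      moreover have "0 \<le> (1 + e) * I + (1 + 1 / e) * (K * E n)" using e I0 K by (simp add: E_def)
      ultimately show ?thesis by (simp add: ennreal_le_iff)
    qed
    then show "\<exists>N. \<forall>n\<ge>N. K * S n \<le> (1 + e) * I + (1 + 1 / e) * (K * E n)" by blast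
  qed
  have "K * (LBINT y. (norm (h y))\<^sup>2) \<le> I"
  proof (rule LIMSEQ_le_const[where X = "\<lambda>n. (1 + 1 / real (Suc n)) * I"])
    have "(\<lambda>n. (1 + 1 / real (Suc n)) * I) \<longlonglongrightarrow> (1 + 0) * I"
      by (intro tendsto_intros LIMSEQ_Suc[OF lim_1_over_n])
    then show "(\<lambda>n. (1 + 1 / real (Suc n)) * I) \<longlonglongrightarrow> I" by simp
    show "\<exists>N. \<forall>n\<ge>N. K * (LBINT y. (norm (h y))\<^sup>2) \<le> (1 + 1 / real (Suc n)) * I"
      using key[of "1 / real (Suc _)"] by auto
  qed
  then show "ennreal ((2 * pi) ^ DIM('a \<times> 'b) * (LBINT y. (norm (h y))\<^sup>2)) \<le> energy (qft h)"
    unfolding I K_def[symmetric] by (rule ennreal_leI)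
qed

section \<open>Energy of the transform on a set of finite measure\<close>

lemma integral_abs_sqrt_le:
  fixes f :: "'a \<Rightarrow> real"
  assumes f[measurable]: "integrable M (\<lambda>x. (f x)\<^sup>2)" "f \<in> borel_measurable M" "\<And>x. 0 \<le> f x"
    and E[measurable]: "E \<in> sets M" and fin: "emeasure M E < \<infinity>" and supp: "\<And>x. x \<notin> E \<Longrightarrow> f x = 0"
  shows "integrable M f" "integral\<^sup>L M f \<le> sqrt (measure M E * (\<integral>x. (f x)\<^sup>2 \<partial>M))"
proof -
  have iE: "integrable M (indicator E :: 'a \<Rightarrow> real)" using E fin by (simp add: integrable_indicator_iff)
  show i: "integrable M f"
  proof (rule Bochner_Integration.integrable_bound[OF Bochner_Integration.integrable_add[OF iE f(1)]])
    \<comment> \<open>Integrability comes first from this elementary bound, because the Bochner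
      integral in the Cauchy-Schwarz estimate is meaningful only for integrable
      \<open>f\<close>.\<close>
    have "f x \<le> indicator E x + (f x)\<^sup>2" for x
    proof (cases "x \<in> E")
      case True
      have "0 \<le> (f x - 1)\<^sup>2 + f x" using f(3)[of x] by simp
      then show ?thesis using True by (simp add: power2_eq_square algebra_simps)
    qed (simp add: supp)
    then show "AE x in M. norm (f x) \<le> norm (indicator E x + (f x)\<^sup>2)" using f(3) by (intro AE_I2) simp
  qed fact
  have "(\<integral>\<^sup>+x. ennreal (f x) * indicator E x \<partial>M)\<^sup>2 \<le> (\<integral>\<^sup>+x. (ennreal (f x))\<^sup>2 \<partial>M) * (\<integral>\<^sup>+x. (indicator E x)\<^sup>2 \<partial>M)"
    by (rule Cauchy_Schwarz_nn_integral) measurable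
  also have "(\<integral>\<^sup>+x. ennreal (f x) * indicator E x \<partial>M) = ennreal (integral\<^sup>L M f)"
  proof -
    have "(\<integral>\<^sup>+x. ennreal (f x) * indicator E x \<partial>M) = (\<integral>\<^sup>+x. ennreal (f x) \<partial>M)"
      by (intro nn_integral_cong) (auto simp: indicator_def supp)
    then show ?thesis using i f(3) by (simp add: nn_integral_eq_integral)
  qed
  also have "(\<integral>\<^sup>+x. (ennreal (f x))\<^sup>2 \<partial>M) = ennreal (\<integral>x. (f x)\<^sup>2 \<partial>M)"
    using f by (simp add: ennreal_power nn_integral_eq_integral)
  also have "(\<integral>\<^sup>+x. (indicator E x)\<^sup>2 \<partial>M) = (\<integral>\<^sup>+x. indicator E x \<partial>M)"
    by (intro nn_integral_cong) (simp add: indicator_def)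
  also have "\<dots> = ennreal (measure M E)"
    using fin by (simp add: emeasure_eq_ennreal_measure)
  finally have "(integral\<^sup>L M f)\<^sup>2 \<le> (\<integral>x. (f x)\<^sup>2 \<partial>M) * measure M E"
    using f(3) by (simp add: ennreal_power ennreal_mult[symmetric] ennreal_le_iff)
  then show "integral\<^sup>L M f \<le> sqrt (measure M E * (\<integral>x. (f x)\<^sup>2 \<partial>M))"
    by (intro real_le_rsqrt) (simp add: mult.commute)
qed

lemma nn_integral_lborel_uminus:
  fixes f :: "'a::euclidean_space \<Rightarrow> ennreal"
  assumes "f \<in> borel_measurable borel"
  shows "(\<integral>\<^sup>+y. f (- y) \<partial>lborel) = (\<integral>\<^sup>+y. f y \<partial>lborel)"
  using nn_integral_lborel_affine[OF assms, of "-1" 0] by simp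

text \<open>Hausdorff-Young restricted to a set of finite measure. By duality it suffices to estimate the
  transform of a function supported on that set, whose sup norm is controlled by Cauchy-Schwarz and
  whose \<open>L\<^sup>2\<close> norm is controlled by Plancherel, so that no complex interpolation is needed.\<close>

lemma qft_energy_le:
  fixes h :: "'a::euclidean_space \<times> 'b::euclidean_space \<Rightarrow> quat"
  assumes h: "integrable lborel h" and E[measurable]: "E \<in> sets borel" and fin: "emeasure lborel E < \<infinity>"
    and q: "1 < q" "q < 2"
  defines "\<nu> \<equiv> \<integral>w. indicator E w * (norm (qft h w))\<^sup>2 \<partial>lborel"
  shows "integrable lborel (\<lambda>w. indicator E w * (norm (qft h w))\<^sup>2)"
    and "ennreal \<nu> \<le> ennreal (sqrt (measure lborel E * \<nu>) powr (2 - q) * ((2 * pi) ^ DIM('a \<times> 'b)) powr (q - 1))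
       * (\<integral>\<^sup>+y. ennreal (norm (h y) powr q) \<partial>lborel)"
proof -
  have hm[measurable]: "h \<in> borel_measurable borel" using h by auto
  define B where "B = (LBINT y. norm (h y))"
  have B: "norm (qft h w) \<le> B" for w unfolding B_def by (rule norm_qft_le)
  have iE: "integrable lborel (indicator E :: 'a \<times> 'b \<Rightarrow> real)" using fin by (simp add: integrable_indicator_iff)
  define \<phi> where "\<phi> w = indicator E w *\<^sub>R qft h w" for w
  have [measurable]: "\<phi> \<in> borel_measurable borel" unfolding \<phi>_def by measurable
  have \<phi>: "integrable lborel \<phi>" 
    by (rule Bochner_Integration.integrable_bound[OF integrable_mult_left[OF iE, of B]])
       (auto simp: \<phi>_def indicator_def order_trans[OF B abs_ge_self])
  have \<phi>2e: "(norm (\<phi> w))\<^sup>2 = indicator E w * (norm (qft h w))\<^sup>2" for w by (simp add: \<phi>_def indicator_def)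
  have \<phi>2: "integrable lborel (\<lambda>w. (norm (\<phi> w))\<^sup>2)"
    by (rule Bochner_Integration.integrable_bound[OF integrable_mult_left[OF iE, of "B\<^sup>2"]])
       (auto simp: \<phi>2e indicator_def intro!: power_mono B)
  show "integrable lborel (\<lambda>w. indicator E w * (norm (qft h w))\<^sup>2)" using \<phi>2 unfolding \<phi>2e .
  have \<nu>: "(LBINT w. (norm (\<phi> w))\<^sup>2) = \<nu>" unfolding \<nu>_def \<phi>2e ..
  have \<nu>0: "0 \<le> \<nu>" unfolding \<nu>[symmetric] by simp
  define H where "H = sqrt (measure lborel E * \<nu>)"
  \<comment> \<open>This is the adjoint transform of \<open>\<phi>\<close>: the kernel is symmetric
    in its two arguments, and its adjoint reflects one of them. Pairing \<open>h\<close> with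
    \<open>\<psi>\<close> therefore returns the energy \<open>\<nu>\<close>.\<close>
  define \<psi> where "\<psi> y = qft \<phi> (- y)" for y
  have [measurable]: "\<psi> \<in> borel_measurable borel" unfolding \<psi>_def by measurable
  have \<psi>H: "norm (\<psi> y) \<le> H" for y
  proof -
    have "norm (\<psi> y) \<le> (LBINT w. norm (\<phi> w))" unfolding \<psi>_def by (rule norm_qft_le)
    also have "\<dots> \<le> sqrt (measure lborel E * (LBINT w. (norm (\<phi> w))\<^sup>2))"
      by (rule integral_abs_sqrt_le(2)) (use \<phi>2 fin in \<open>auto simp: \<phi>_def\<close>)
    finally show ?thesis unfolding \<nu> H_def .
  qed
  have H0: "0 \<le> H" using \<psi>H[of 0] norm_ge_zero order_trans by blast
  define \<kappa> where "\<kappa> = (2 * pi) ^ DIM('a \<times> 'b)"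
  have \<kappa>: "0 < \<kappa>" unfolding \<kappa>_def by (rule zero_less_power) simp
  have \<psi>2: "energy \<psi> = ennreal (\<kappa> * \<nu>)"
    unfolding \<psi>_def using nn_integral_lborel_uminus[of "\<lambda>y. ennreal ((norm (qft \<phi> y))\<^sup>2)"] Plancherel[OF \<phi> \<phi>2]
    by (simp add: \<nu> \<kappa>_def del: DIM_prod)
  have adj: "qker y w a \<bullet> b = a \<bullet> qker w (- y) b" for y w :: "'a \<times> 'b" and a b
  proof -
    have "qker y w a \<bullet> qker 0 w b = a \<bullet> qker (0 - y) w b" by (rule inner_qker)
    moreover have "qker 0 w b = b" by (simp add: qker_def)
    ultimately show ?thesis by (simp add: qker_commute[of w])
  qed
  have pair: "\<nu> = (LBINT y. h y \<bullet> \<psi> y)"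
  proof -
    let ?P = "(lborel :: ('a \<times> 'b) measure) \<Otimes>\<^sub>M (lborel :: ('a \<times> 'b) measure)"
    have int: "integrable ?P (\<lambda>(w, y). qker y w (h y) \<bullet> \<phi> w)"
    proof (rule Bochner_Integration.integrable_bound[OF integrable_prod_mult[OF sigma_finite_lborel sigma_finite_lborel integrable_norm[OF \<phi>] integrable_norm[OF h]]])
      have "(\<lambda>p. qker (snd p) (fst p) (h (snd p))) \<in> borel_measurable ?P" by (rule measurable_qker) measurable
      then show "(\<lambda>(w, y). qker y w (h y) \<bullet> \<phi> w) \<in> borel_measurable ?P" unfolding case_prod_beta' by measurable
      show "AE p in ?P. norm (case p of (w, y) \<Rightarrow> qker y w (h y) \<bullet> \<phi> w) \<le> norm (norm (\<phi> (fst p)) * norm (h (snd p)))"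
        unfolding case_prod_beta' by (intro AE_I2) (auto intro: order_trans[OF Cauchy_Schwarz_ineq2] simp: mult.commute)
    qed
    have "\<nu> = (LBINT w. qft h w \<bullet> \<phi> w)"
      unfolding \<nu>_def \<phi>_def by (simp add: power2_norm_eq_inner)
    also have "\<dots> = (\<integral>w. \<integral>y. qker y w (h y) \<bullet> \<phi> w \<partial>lborel \<partial>lborel)"
      unfolding qft_def by (intro Bochner_Integration.integral_cong refl integral_inner_left[symmetric] integrable_qker h)
    also have "\<dots> = (\<integral>y. \<integral>w. qker y w (h y) \<bullet> \<phi> w \<partial>lborel \<partial>lborel)"
      using lborel_pair.Fubini_integral[OF int] by simp
    also have "\<dots> = (LBINT y. h y \<bullet> \<psi> y)"
      unfolding adj \<psi>_def qft_def by (intro Bochner_Integration.integral_cong refl integral_inner_right integrable_qker \<phi>)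
    finally show ?thesis .
  qed
  have \<nu>le: "ennreal \<nu> \<le> (\<integral>\<^sup>+y. ennreal (norm (h y) * norm (\<psi> y)) \<partial>lborel)"
  proof -
    have "\<nu> \<le> norm (LBINT y. h y \<bullet> \<psi> y)" unfolding pair by simp
    then have "ennreal \<nu> \<le> ennreal (norm (LBINT y. h y \<bullet> \<psi> y))" by (rule ennreal_leI)
    also have "\<dots> \<le> (\<integral>\<^sup>+y. norm (h y \<bullet> \<psi> y) \<partial>lborel)" 
    proof (rule integral_norm_bound_ennreal)
      show "integrable lborel (\<lambda>y. h y \<bullet> \<psi> y)"
      proof (rule Bochner_Integration.integrable_bound[OF integrable_mult_right[OF integrable_norm[OF h], of H]])
        show "AE y in lborel. norm (h y \<bullet> \<psi> y) \<le> norm (H * norm (h y))"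
        proof (rule AE_I2)
          fix y
          have "norm (h y \<bullet> \<psi> y) \<le> norm (h y) * norm (\<psi> y)" using Cauchy_Schwarz_ineq2 by simp
          also have "\<dots> \<le> norm (h y) * H" by (rule mult_left_mono[OF \<psi>H]) simp
          finally show "norm (h y \<bullet> \<psi> y) \<le> norm (H * norm (h y))" using H0 by (simp add: mult.commute)
        qed
      qed measurable
    qed
    also have "\<dots> \<le> (\<integral>\<^sup>+y. ennreal (norm (h y) * norm (\<psi> y)) \<partial>lborel)"
      by (intro nn_integral_mono ennreal_leI) (simp add: Cauchy_Schwarz_ineq2)
    finally show ?thesis .
  qed
  show "ennreal \<nu> \<le> ennreal (sqrt (measure lborel E * \<nu>) powr (2 - q) * ((2 * pi) ^ DIM('a \<times> 'b)) powr (q - 1))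
       * (\<integral>\<^sup>+y. ennreal (norm (h y) powr q) \<partial>lborel)"
  \<comment> \<open>The scaling factor below divides by a power of \<open>H\<close>. If
    \<open>H = 0\<close>, then \<open>\<psi>\<close> vanishes and so does
    \<open>\<nu>\<close>.\<close>
  proof (cases "H = 0")
    case True
    then have "\<psi> y = 0" for y using \<psi>H[of y] by simp
    then have "\<nu> = 0" unfolding pair by simp
    then show ?thesis by simp
  next
    case False
    then have H: "0 < H" using H0 by simp
    define L where "L = H powr (2 - q) * \<kappa> powr (q - 1)"
    have L: "0 < L" using H \<kappa> by (simp add: L_def)
    define X where "X = (\<integral>\<^sup>+y. ennreal (norm (h y) powr q) \<partial>lborel)"
    have "ennreal \<nu> \<le> ennreal L * X"
    proof (cases "X = \<infinity>")
      case True
      then show ?thesis using L by (simp add: ennreal_mult_top)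
    next
      case Xfin: False
      define p where "p = q / (q - 1)"
      have p: "1 < p" "1 / q + 1 / p = 1" "2 < p" using q by (auto simp: p_def field_simps)
      have pq: "(p - 2) * (q - 1) = 2 - q" "p * (q - 1) = q" "q / p = q - 1" using q by (auto simp: p_def field_simps)
      \<comment> \<open>The factor \<open>l\<close> balances Young's inequality for products so that
        the \<open>\<psi>\<close> term integrates to exactly \<open>\<nu> / p\<close>. This is
        absorbed on the left, where \<open>\<nu> / q\<close> remains.\<close>
      define l where "l = L powr (1 / q)"
      have l: "0 < l" "l powr q = L" using L q by (auto simp: l_def powr_powr)
      have lp: "l powr p = H powr (p - 2) * \<kappa>"
      proof -
        have "(H powr (p - 2) * \<kappa>) powr (q - 1) = L"
          using H \<kappa> by (simp add: powr_mult powr_powr pq L_def)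
        then have "l powr p = ((H powr (p - 2) * \<kappa>) powr (q - 1)) powr (p / q)"
          by (simp add: l_def powr_powr)
        also have "\<dots> = (H powr (p - 2) * \<kappa>) powr ((q - 1) * (p / q))" by (simp add: powr_powr)
        also have "(q - 1) * (p / q) = 1" using q by (simp add: p_def)
        finally show ?thesis using H \<kappa> by simp
      qed
      have pw: "norm (h y) * norm (\<psi> y) \<le> L / q * norm (h y) powr q + 1 / (p * \<kappa>) * (norm (\<psi> y))\<^sup>2" for y
      proof -
        have "norm (h y) * norm (\<psi> y) = (l * norm (h y)) * (norm (\<psi> y) / l)" using l by simp
        also have "\<dots> \<le> (l * norm (h y)) powr q / q + (norm (\<psi> y) / l) powr p / p"
          by (rule Youngs_inequality) (use q p l in auto)
        also have "(l * norm (h y)) powr q = L * norm (h y) powr q" using l by (simp add: powr_mult)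
        also have "(norm (\<psi> y) / l) powr p \<le> (norm (\<psi> y))\<^sup>2 / \<kappa>"
        proof (cases "\<psi> y = 0")
          case False
          \<comment> \<open>The exponent is split into \<open>p - 2\<close>, handled by the sup
            bound \<open>H\<close>, and 2, handled by Plancherel. This elementary inclusion takes
            the place of interpolation and needs \<open>2 < p\<close>.\<close>
          have "norm (\<psi> y) powr p = norm (\<psi> y) powr (p - 2) * norm (\<psi> y) powr 2" by (simp add: powr_add[symmetric] del: powr_numeral)
          also have "\<dots> \<le> H powr (p - 2) * (norm (\<psi> y))\<^sup>2"
            using p \<psi>H[of y] False by (intro mult_mono powr_mono2) auto
          finally have "norm (\<psi> y) powr p / (H powr (p - 2) * \<kappa>) \<le> H powr (p - 2) * (norm (\<psi> y))\<^sup>2 / (H powr (p - 2) * \<kappa>)"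
            using \<kappa> by (intro divide_right_mono) auto
          then show ?thesis using H l by (simp add: powr_divide lp)
        qed simp
        finally show ?thesis using p by (simp add: divide_right_mono mult.commute[of p])
      qed
      have "ennreal \<nu> \<le> (\<integral>\<^sup>+y. ennreal (L / q) * ennreal (norm (h y) powr q) + ennreal (1 / (p * \<kappa>)) * ennreal ((norm (\<psi> y))\<^sup>2) \<partial>lborel)"
        by (rule order_trans[OF \<nu>le], rule nn_integral_mono)
           (use pw L q p \<kappa> in \<open>simp add: ennreal_mult[symmetric] ennreal_plus[symmetric] del: ennreal_plus\<close>)
      also have "\<dots> = ennreal (L / q) * X + ennreal (1 / (p * \<kappa>)) * ennreal (\<kappa> * \<nu>)"
        unfolding X_def \<psi>2[symmetric] by (subst nn_integral_add) (auto simp: nn_integral_cmult)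
      also have "\<dots> = ennreal (L / q * enn2real X + \<nu> / p)"
      proof -
        have "X = ennreal (enn2real X)" using Xfin by (simp add: less_top)
        then have "ennreal (L / q) * X = ennreal (L / q * enn2real X)"
          using L q by (metis ennreal_mult'' enn2real_nonneg)
        moreover have "ennreal (1 / (p * \<kappa>)) * ennreal (\<kappa> * \<nu>) = ennreal (\<nu> / p)"
          using p \<kappa> \<nu>0 by (simp add: ennreal_mult[symmetric])
        ultimately show ?thesis
          using L q p \<nu>0 by (simp add: ennreal_plus)
      qed
      finally have "\<nu> \<le> L / q * enn2real X + \<nu> / p"
        using L q p \<nu>0 by (subst (asm) ennreal_le_iff) simp_all
      moreover have "\<nu> = \<nu> / q + \<nu> / p" using p(2) by (metis add_divide_distrib distrib_left mult.right_neutral times_divide_eq_right)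
      ultimately have "\<nu> / q \<le> L * enn2real X / q" by simp
      then have "\<nu> \<le> L * enn2real X" using q by (simp add: divide_le_cancel)
      then have "ennreal \<nu> \<le> ennreal (L * enn2real X)" by (rule ennreal_leI)
      also have "\<dots> = ennreal L * X"
        using L Xfin by (simp add: ennreal_mult less_top)
      finally show ?thesis .
    qed
    then show ?thesis unfolding L_def X_def H_def \<kappa>_def .
  qed
qed

section \<open>Energy of the windowed transform on a set\<close>

lemma norm_qcnj [simp]: "norm (qcnj x) = norm x"
  by (simp add: norm_quat_eq)

lemma measurable_qcnj [measurable]: "qcnj \<in> borel_measurable borel"
proof -
  have "bounded_linear qcnj"
    by (rule bounded_linear_intro[where K = 1]) (simp_all add: quat_eq_iff)
  then show ?thesis by (intro borel_measurable_continuous_onI linear_continuous_on)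
qed

definition windowed :: "('a::euclidean_space \<Rightarrow> quat) \<Rightarrow> ('a \<Rightarrow> quat) \<Rightarrow> 'a \<Rightarrow> 'a \<Rightarrow> quat" where
  "windowed g f x y = f y * qcnj (g (y - x))"

lemma norm_windowed: "norm (windowed g f x y) = norm (f y) * norm (g (y - x))"
  by (simp add: windowed_def norm_mult)

text \<open>Borel versions of the signal and the window, with their squared norms against Lebesgue
  measure recorded as the reals \<open>A\<close> and \<open>B\<close>.\<close>

locale L2_pair =
  fixes f g :: "'a::euclidean_space \<times> 'b::euclidean_space \<Rightarrow> quat" and A B :: real
  assumes f [measurable]: "f \<in> borel_measurable borel" and g [measurable]: "g \<in> borel_measurable borel"
    and f2: "energy f = ennreal A"
    and g2: "energy g = ennreal B"
    and A0: "0 \<le> A" and B0: "0 \<le> B"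
begin

text \<open>Plancherel's factor for the transform against \<open>lborel\<close>. Its reciprocal is
  also the density of \<open>mu\<close> on phase space, whose dimension is twice that of
  \<open>'a \<times> 'b\<close>, so that all powers of 2 pi disappear at the end.\<close>

definition \<kappa> :: real where "\<kappa> = (2 * pi) ^ DIM('a \<times> 'b)"

lemma \<kappa>_pos: "0 < \<kappa>"
  unfolding \<kappa>_def by (rule zero_less_power) simp

lemma windowed_measurable [measurable]: "windowed g f x \<in> borel_measurable borel"
  unfolding windowed_def[abs_def] by measurable

lemma integrable_squares:
  "integrable lborel (\<lambda>y. (norm (f y))\<^sup>2)" "integrable lborel (\<lambda>y. (norm (g y))\<^sup>2)"
  using f2 g2 by (auto intro!: integrableI_nonneg)

text \<open>The bound \<open>a * b \<le> a\<^sup>2 + b\<^sup>2\<close> works for every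
  \<open>x\<close>, whereas square integrability of the product is available only for almost every
  \<open>x\<close>.\<close>

lemma integrable_windowed: "integrable lborel (windowed g f x)"
proof -
  have "integrable lborel (\<lambda>y. (norm (f y))\<^sup>2 + (norm (g (y + (- x))))\<^sup>2)"
    by (intro Bochner_Integration.integrable_add integrable_squares integrable_lborel_translate[where f = "\<lambda>y. (norm (g y))\<^sup>2"])
  then show ?thesis
  proof (rule Bochner_Integration.integrable_bound)
    show "AE y in lborel. norm (windowed g f x y) \<le> norm ((norm (f y))\<^sup>2 + (norm (g (y + (- x))))\<^sup>2)"
    proof (rule AE_I2)
      fix y
      define a b where "a = norm (f y)" and "b = norm (g (y - x))"
      have "0 \<le> a" "0 \<le> b" by (simp_all add: a_def b_def)
      then have "0 \<le> (a - b)\<^sup>2 + a * b" by simp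
      then have "a * b \<le> a\<^sup>2 + b\<^sup>2" by (simp add: power2_diff)
      then show "norm (windowed g f x y) \<le> norm ((norm (f y))\<^sup>2 + (norm (g (y + (- x))))\<^sup>2)"
        by (simp add: norm_windowed a_def b_def)
    qed
  qed measurable
qed

definition \<G> :: "('a \<times> 'b) \<times> ('a \<times> 'b) \<Rightarrow> quat" where
  "\<G> = (\<lambda>(x, w). qft (windowed g f x) w)"

lemma \<G>_measurable [measurable]: "\<G> \<in> borel_measurable borel"
proof -
  have "(\<lambda>(p, y). qker y (snd p) (windowed g f (fst p) y)) \<in> borel_measurable ((borel \<Otimes>\<^sub>M borel) \<Otimes>\<^sub>M lborel)"
    unfolding case_prod_beta' windowed_def by (rule measurable_qker) measurable
  from lborel.borel_measurable_lebesgue_integral[OF this] show ?thesis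
    unfolding \<G>_def qft_def case_prod_beta' borel_prod .
qed

lemma nn_integral_windowed_square: "(\<integral>\<^sup>+x. \<integral>\<^sup>+y. ennreal ((norm (windowed g f x y))\<^sup>2) \<partial>lborel \<partial>lborel) = ennreal (A * B)"
proof -
  have "(\<integral>\<^sup>+x. \<integral>\<^sup>+y. ennreal ((norm (windowed g f x y))\<^sup>2) \<partial>lborel \<partial>lborel)
     = (\<integral>\<^sup>+y. \<integral>\<^sup>+x. ennreal ((norm (f y))\<^sup>2) * ennreal ((norm (g (y - x)))\<^sup>2) \<partial>lborel \<partial>lborel)"
    unfolding norm_windowed power_mult_distrib by (subst lborel_pair.Fubini') (auto simp: ennreal_mult)
  also have "\<dots> = (\<integral>\<^sup>+y. ennreal ((norm (f y))\<^sup>2) * (\<integral>\<^sup>+x. ennreal ((norm (g (y - x)))\<^sup>2) \<partial>lborel) \<partial>lborel)"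
    by (intro nn_integral_cong nn_integral_cmult) measurable
  also have "(\<lambda>y. \<integral>\<^sup>+x. ennreal ((norm (g (y - x)))\<^sup>2) \<partial>lborel) = (\<lambda>y. ennreal B)"
  proof
    fix y
    show "(\<integral>\<^sup>+x. ennreal ((norm (g (y - x)))\<^sup>2) \<partial>lborel) = ennreal B"
      unfolding g2[symmetric] using nn_integral_lborel_affine[of "\<lambda>y. ennreal ((norm (g y))\<^sup>2)" "-1" y] by simp
  qed
  also have "(\<integral>\<^sup>+y. ennreal ((norm (f y))\<^sup>2) * ennreal B \<partial>lborel) = ennreal (A * B)"
    using A0 B0 by (simp add: nn_integral_multc f2 ennreal_mult)
  finally show ?thesis .
qed

text \<open>Plancherel is applied on each slice where the windowed signal is square integrable.
  These are almost all slices, because the total in \<open>nn_integral_windowed_square\<close> is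
  finite.\<close>

lemma nn_integral_\<G>_square: "energy \<G> = ennreal (\<kappa> * (A * B))"
proof -
  have m: "(\<lambda>x. \<integral>\<^sup>+y. ennreal ((norm (windowed g f x y))\<^sup>2) \<partial>lborel) \<in> borel_measurable lborel"
  proof -
    have "(\<lambda>(x, y). ennreal ((norm (windowed g f x y))\<^sup>2)) \<in> borel_measurable (lborel \<Otimes>\<^sub>M lborel)"
      unfolding windowed_def by measurable
    from lborel.borel_measurable_nn_integral[OF this] show ?thesis .
  qed
  have "energy \<G> = (\<integral>\<^sup>+x. \<integral>\<^sup>+w. ennreal ((norm (qft (windowed g f x) w))\<^sup>2) \<partial>lborel \<partial>lborel)"
  proof -
    have "(\<lambda>p. ennreal ((norm (\<G> p))\<^sup>2)) \<in> borel_measurable lborel" by measurable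
    then have "(\<lambda>p. ennreal ((norm (\<G> p))\<^sup>2)) \<in> borel_measurable ((lborel :: ('a \<times> 'b) measure) \<Otimes>\<^sub>M (lborel :: ('a \<times> 'b) measure))"
      unfolding lborel_prod .
    from lborel.nn_integral_fst[OF this] show ?thesis unfolding lborel_prod by (simp add: \<G>_def)
  qed
  also have "\<dots> = (\<integral>\<^sup>+x. ennreal \<kappa> * (\<integral>\<^sup>+y. ennreal ((norm (windowed g f x y))\<^sup>2) \<partial>lborel) \<partial>lborel)"
  proof (rule nn_integral_cong_AE)
    have "AE x in lborel. (\<integral>\<^sup>+y. ennreal ((norm (windowed g f x y))\<^sup>2) \<partial>lborel) \<noteq> \<infinity>"
      by (rule nn_integral_PInf_AE[OF m]) (simp add: nn_integral_windowed_square)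
    then show "AE x in lborel. (\<integral>\<^sup>+w. ennreal ((norm (qft (windowed g f x) w))\<^sup>2) \<partial>lborel) = ennreal \<kappa> * (\<integral>\<^sup>+y. ennreal ((norm (windowed g f x y))\<^sup>2) \<partial>lborel)"
    proof eventually_elim
      case (elim x)
      have i: "integrable lborel (\<lambda>y. (norm (windowed g f x y))\<^sup>2)"
        by (rule integrableI_nonneg) (use elim in \<open>auto simp: less_top\<close>)
      show ?case
        unfolding Plancherel[OF integrable_windowed i] \<kappa>_def[symmetric] using \<kappa>_pos i
        by (simp add: ennreal_mult nn_integral_eq_integral)
    qed
  qed
  also have "\<dots> = ennreal (\<kappa> * (A * B))"
    using \<kappa>_pos A0 B0 m by (simp add: nn_integral_cmult nn_integral_windowed_square ennreal_mult)
  finally show ?thesis .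
qed

text \<open>The quantity \<open>I\<close> is left on both sides: its exponent
  \<open>1 - q / 2\<close> on the right is below 1, and \<open>powr_bound_from_energy\<close> solves
  for the measure of \<open>U\<close>.\<close>

theorem energy_concentration:
  assumes U [measurable]: "U \<in> sets borel" and fin: "emeasure lborel U < \<infinity>"
    and q: "1 < q" "q < 2"
  defines "I \<equiv> \<integral>p. indicator U p * (norm (\<G> p))\<^sup>2 \<partial>lborel"
  shows "I \<le> \<kappa> powr (q - 1) * young_const (q / 2) ^ DIM('a \<times> 'b) * (A * B) powr (q / 2)
        * (measure lborel U * I) powr (1 - q / 2)"
proof -
  let ?V = "lborel :: ('a \<times> 'b) measure"
  define S where "S x = Pair x -` U" for x
  have UP: "U \<in> sets (?V \<Otimes>\<^sub>M ?V)" unfolding lborel_prod using U by simp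
  have S[measurable]: "S x \<in> sets borel" for x
    unfolding S_def using sets_Pair1[OF UP, of x] by simp
  define m where "m x = emeasure lborel (S x)" for x
  have mm[measurable]: "m \<in> borel_measurable borel"
    unfolding m_def[abs_def] S_def using lborel.measurable_emeasure_Pair[OF UP] by simp
  have mI: "(\<integral>\<^sup>+x. m x \<partial>lborel) = emeasure lborel U"
    unfolding m_def S_def using lborel.emeasure_pair_measure_alt[OF UP] unfolding lborel_prod by simp
  have mfin: "AE x in lborel. m x \<noteq> \<infinity>"
    using fin mI by (intro nn_integral_PInf_AE) auto
  define \<nu> where "\<nu> x = (LBINT w. indicator (S x) w * (norm (qft (windowed g f x) w))\<^sup>2)" for x
  have \<nu>0: "0 \<le> \<nu> x" for x unfolding \<nu>_def by simp
  have ind: "indicator U (x, w) = (indicator (S x) w :: real)" for x w by (simp add: S_def indicator_def)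
  have \<nu>e: "\<nu> x = (LBINT w. indicator U (x, w) * (norm (\<G> (x, w)))\<^sup>2)" for x
    by (simp add: \<nu>_def ind \<G>_def)
  have um: "(\<lambda>p. indicator U p * (norm (\<G> p))\<^sup>2) \<in> borel_measurable borel" by measurable
  have \<nu>m[measurable]: "\<nu> \<in> borel_measurable borel"
  proof -
    have "(\<lambda>p. indicator U p * (norm (\<G> p))\<^sup>2) \<in> borel_measurable (?V \<Otimes>\<^sub>M ?V)"
      unfolding lborel_prod using um by simp
    then have "(\<lambda>(x, w). indicator U (x, w) * (norm (\<G> (x, w)))\<^sup>2) \<in> borel_measurable (?V \<Otimes>\<^sub>M ?V)"
      by (simp only: case_prod_beta' prod.collapse)
    from lborel.borel_measurable_lebesgue_integral[OF this] show ?thesis unfolding \<nu>e[abs_def] by simp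
  qed
  have iU: "integrable lborel (\<lambda>p. (norm (\<G> p))\<^sup>2)"
    using nn_integral_\<G>_square by (intro integrableI_nonneg) auto
  have iI: "integrable lborel (\<lambda>p. indicator U p * (norm (\<G> p))\<^sup>2)"
    by (rule Bochner_Integration.integrable_bound[OF iU]) (auto simp: indicator_def)
  have I0: "0 \<le> I" unfolding I_def by simp
  have \<nu>I: "(\<integral>\<^sup>+x. ennreal (\<nu> x) \<partial>lborel) = ennreal I"
  proof -
    have iI': "integrable (?V \<Otimes>\<^sub>M ?V) (\<lambda>p. indicator U p * (norm (\<G> p))\<^sup>2)" unfolding lborel_prod by (rule iI)
    have "integrable lborel \<nu>" unfolding \<nu>e[abs_def] by (rule lborel_pair.integrable_fst'[OF iI'])
    moreover have "integral\<^sup>L lborel \<nu> = I"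
      unfolding \<nu>e[abs_def] I_def using lborel_pair.integral_fst'[OF iI'] unfolding lborel_prod .
    ultimately show ?thesis using \<nu>0 by (simp add: nn_integral_eq_integral)
  qed
  \<comment> \<open>The factor by which \<open>qft_energy_le\<close> lets the slice bound depend on
    \<open>x\<close>. Its integral is controlled by Cauchy-Schwarz, with total measure
    \<open>u\<close> and total energy \<open>I\<close>. Slices of infinite measure get 0 and form a
    null set.\<close>
  define H where "H x = sqrt (enn2real (m x) * \<nu> x)" for x
  have Hm[measurable]: "H \<in> borel_measurable borel" unfolding H_def by measurable
  have H0: "0 \<le> H x" for x unfolding H_def using \<nu>0 by simp
  define u where "u = measure lborel U"
  have u: "emeasure lborel U = ennreal u" "0 \<le> u" using fin by (simp_all add: u_def emeasure_eq_ennreal_measure)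
  have HC: "(\<integral>\<^sup>+x. ennreal (H x) \<partial>lborel)\<^sup>2 \<le> ennreal (u * I)"
  proof -
    have "(\<integral>\<^sup>+x. ennreal (H x) \<partial>lborel)\<^sup>2 = (\<integral>\<^sup>+x. ennreal (sqrt (enn2real (m x))) * ennreal (sqrt (\<nu> x)) \<partial>lborel)\<^sup>2"
      unfolding H_def real_sqrt_mult using \<nu>0 by (simp add: ennreal_mult)
    also have "\<dots> \<le> (\<integral>\<^sup>+x. (ennreal (sqrt (enn2real (m x))))\<^sup>2 \<partial>lborel) * (\<integral>\<^sup>+x. (ennreal (sqrt (\<nu> x)))\<^sup>2 \<partial>lborel)"
      by (rule Cauchy_Schwarz_nn_integral) measurable
    also have "(\<integral>\<^sup>+x. (ennreal (sqrt (enn2real (m x))))\<^sup>2 \<partial>lborel) = (\<integral>\<^sup>+x. m x \<partial>lborel)"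
      using mfin by (intro nn_integral_cong_AE) (auto elim!: eventually_mono simp: ennreal_power less_top)
    also have "(\<integral>\<^sup>+x. (ennreal (sqrt (\<nu> x)))\<^sup>2 \<partial>lborel) = (\<integral>\<^sup>+x. ennreal (\<nu> x) \<partial>lborel)"
      using \<nu>0 by (simp add: ennreal_power)
    finally show ?thesis unfolding mI \<nu>I u using u I0 by (simp add: ennreal_mult)
  qed
  have Hfin: "(\<integral>\<^sup>+x. ennreal (H x) \<partial>lborel) < \<infinity>"
  proof (rule ccontr)
    assume "\<not> ?thesis"
    then have "(\<integral>\<^sup>+x. ennreal (H x) \<partial>lborel) = \<infinity>" by (simp add: not_less top_unique)
    then show False using HC by (simp add: power2_eq_square ennreal_top_mult top_unique)
  qed
  define C where "C = enn2real (\<integral>\<^sup>+x. ennreal (H x) \<partial>lborel)"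
  have C: "(\<integral>\<^sup>+x. ennreal (H x) \<partial>lborel) = ennreal C" "0 \<le> C" using Hfin by (auto simp: C_def)
  have Cle: "C\<^sup>2 \<le> u * I"
    using HC u I0 C(2) unfolding C(1) by (simp add: ennreal_power ennreal_le_iff)
  define F where "F y = (norm (f y))\<^sup>2" for y
  \<comment> \<open>The reflection turns the window term at \<open>y - x\<close> into
    \<open>G (x - y)\<close>. With \<open>z = x - y\<close> the integrand then has arguments
    \<open>y\<close>, \<open>z\<close> and \<open>y + z\<close>, as in Young's form.\<close>
  define G where "G z = (norm (g (- z)))\<^sup>2" for z
  have [measurable]: "F \<in> borel_measurable borel" "G \<in> borel_measurable borel" unfolding F_def G_def by measurable
  define k where "k = \<kappa> powr (q - 1)"
  have k: "0 < k" using \<kappa>_pos by (simp add: k_def)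
  have slice: "AE x in lborel. ennreal (\<nu> x) \<le> ennreal k * (\<integral>\<^sup>+y. ennreal (F y powr (q/2) * G (x - y) powr (q/2) * H x powr (2 - 2 * (q/2))) \<partial>lborel)"
    using mfin
  proof eventually_elim
    case (elim x)
    have p2: "(a\<^sup>2) powr (q / 2) = a powr q" if "0 \<le> a" for a :: real
    proof (cases "a = 0")
      case False
      then have "a\<^sup>2 = a powr 2" using that by simp
      then show ?thesis by (simp add: powr_powr)
    qed simp
    have "ennreal (\<nu> x) \<le> ennreal (sqrt (measure lborel (S x) * \<nu> x) powr (2 - q) * \<kappa> powr (q - 1))
       * (\<integral>\<^sup>+y. ennreal (norm (windowed g f x y) powr q) \<partial>lborel)"
      unfolding \<nu>_def \<kappa>_def using elim by (intro qft_energy_le integrable_windowed S q) (simp add: m_def less_top)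
    also have "sqrt (measure lborel (S x) * \<nu> x) = H x" by (simp add: H_def m_def measure_def)
    also have "ennreal (H x powr (2 - q) * \<kappa> powr (q - 1)) = ennreal k * ennreal (H x powr (2 - q))"
      using k by (simp add: k_def ennreal_mult mult.commute)
    also have "ennreal k * ennreal (H x powr (2 - q)) * (\<integral>\<^sup>+y. ennreal (norm (windowed g f x y) powr q) \<partial>lborel)
      = ennreal k * (\<integral>\<^sup>+y. ennreal (H x powr (2 - q)) * ennreal (norm (windowed g f x y) powr q) \<partial>lborel)"
      unfolding mult.assoc by (subst nn_integral_cmult) auto
    also have "(\<integral>\<^sup>+y. ennreal (H x powr (2 - q)) * ennreal (norm (windowed g f x y) powr q) \<partial>lborel)
      = (\<integral>\<^sup>+y. ennreal (F y powr (q/2) * G (x - y) powr (q/2) * H x powr (2 - 2 * (q/2))) \<partial>lborel)"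
      by (intro nn_integral_cong) (simp add: ennreal_mult[symmetric] F_def G_def p2 norm_windowed powr_mult mult_ac)
    finally show ?case .
  qed
  have "ennreal I = (\<integral>\<^sup>+x. ennreal (\<nu> x) \<partial>lborel)" by (simp add: \<nu>I)
  also have "\<dots> \<le> (\<integral>\<^sup>+x. ennreal k * (\<integral>\<^sup>+y. ennreal (F y powr (q/2) * G (x - y) powr (q/2) * H x powr (2 - 2 * (q/2))) \<partial>lborel) \<partial>lborel)"
    by (rule nn_integral_mono_AE[OF slice])
  also have "\<dots> = ennreal k * (\<integral>\<^sup>+x. \<integral>\<^sup>+y. ennreal (F y powr (q/2) * G (x - y) powr (q/2) * H x powr (2 - 2 * (q/2))) \<partial>lborel \<partial>lborel)"
    by (rule nn_integral_cmult) measurable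
  also have "(\<integral>\<^sup>+x. \<integral>\<^sup>+y. ennreal (F y powr (q/2) * G (x - y) powr (q/2) * H x powr (2 - 2 * (q/2))) \<partial>lborel \<partial>lborel)
    = (\<integral>\<^sup>+y. \<integral>\<^sup>+x. ennreal (F y powr (q/2) * G (x - y) powr (q/2) * H x powr (2 - 2 * (q/2))) \<partial>lborel \<partial>lborel)"
    by (rule lborel_pair.Fubini') measurable
  also have "\<dots> = (\<integral>\<^sup>+y. \<integral>\<^sup>+z. ennreal (F y powr (q/2) * G z powr (q/2) * H (y + z) powr (2 - 2 * (q/2))) \<partial>lborel \<partial>lborel)"
  proof (rule nn_integral_cong)
    fix y :: "'a \<times> 'b"
    have "(\<lambda>x. ennreal (F y powr (q/2) * G (x - y) powr (q/2) * H x powr (2 - 2 * (q/2)))) \<in> borel_measurable borel" by measurable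
    from nn_integral_lborel_affine[OF this, of 1 y]
    show "(\<integral>\<^sup>+x. ennreal (F y powr (q/2) * G (x - y) powr (q/2) * H x powr (2 - 2 * (q/2))) \<partial>lborel)
      = (\<integral>\<^sup>+z. ennreal (F y powr (q/2) * G z powr (q/2) * H (y + z) powr (2 - 2 * (q/2))) \<partial>lborel)" by simp
  qed
  also have "\<dots> \<le> ennreal (young_const (q/2) ^ DIM('a \<times> 'b) * (A powr (q/2) * B powr (q/2) * C powr (2 - 2 * (q/2))))"
  proof (rule young_holdsD[OF young_holds_lborel])
    show "(\<integral>\<^sup>+x. ennreal (F x) \<partial>lborel) = ennreal A" unfolding F_def by (rule f2)
    show "(\<integral>\<^sup>+x. ennreal (G x) \<partial>lborel) = ennreal B"
      unfolding G_def g2[symmetric] by (rule nn_integral_lborel_uminus) measurable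
    show "(\<integral>\<^sup>+x. ennreal (H x) \<partial>lborel) = ennreal C" by (rule C)
  qed (use q A0 B0 C H0 in \<open>auto simp: F_def G_def\<close>)
  finally have "ennreal I \<le> ennreal k * ennreal (young_const (q/2) ^ DIM('a \<times> 'b) * (A powr (q/2) * B powr (q/2) * C powr (2 - 2 * (q/2))))"
    by (simp add: mult_left_mono)
  also have "\<dots> = ennreal (k * (young_const (q/2) ^ DIM('a \<times> 'b) * (A powr (q/2) * B powr (q/2) * C powr (2 - 2 * (q/2)))))"
    using k by (intro ennreal_mult[symmetric]) (auto intro!: mult_nonneg_nonneg zero_le_power young_const_nonneg)
  finally have le: "I \<le> k * (young_const (q/2) ^ DIM('a \<times> 'b) * (A powr (q/2) * B powr (q/2) * C powr (2 - 2 * (q/2))))"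
    using k by (subst (asm) ennreal_le_iff) (auto intro!: mult_nonneg_nonneg zero_le_power young_const_nonneg)
  \<comment> \<open>The exponent is rewritten in terms of the square of \<open>C\<close>, since
    \<open>Cle\<close> bounds that square by \<open>u * I\<close>.\<close>
  have "C powr (2 - 2 * (q/2)) = (C\<^sup>2) powr (1 - q / 2)"
  proof (cases "C = 0")
    case False
    then have "C\<^sup>2 = C powr 2" using C(2) by simp
    then show ?thesis by (simp add: powr_powr algebra_simps)
  qed simp
  also have "\<dots> \<le> (u * I) powr (1 - q / 2)" using q Cle by (intro powr_mono2) auto
  finally have Cp: "C powr (2 - 2 * (q/2)) \<le> (u * I) powr (1 - q / 2)" .
  have "I \<le> k * (young_const (q/2) ^ DIM('a \<times> 'b) * (A powr (q/2) * B powr (q/2) * (u * I) powr (1 - q / 2)))"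
    by (rule order_trans[OF le])
       (intro mult_left_mono Cp, use k in \<open>auto intro!: mult_nonneg_nonneg zero_le_power young_const_nonneg\<close>)
  then show ?thesis using A0 B0 by (simp add: k_def u_def powr_mult mult_ac del: DIM_prod)
qed

end

section \<open>The uncertainty inequality\<close>

text \<open>For \<open>\<alpha> = q / 2\<close> the base \<open>2 * \<alpha> - 1\<close> equals
  \<open>q / p\<close>. The logarithm is therefore a combination of \<open>ln 2\<close>,
  \<open>ln p\<close> and \<open>ln q\<close>, to be compared coefficient by coefficient with that
  of \<open>lieb_const\<close>.\<close>

lemma ln_young_const:
  assumes q: "1 < q" and p: "p = q / (q - 1)"
  shows "ln (young_const (q / 2)) = (q - 1) * ln 2 - (q - 1) / 2 * ln p - ln q / 2"
proof -
  have p0: "0 < p" using q p by simp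
  have qp: "2 * (q / 2) - 1 = q / p" "0 < q / p" using q by (auto simp: p field_simps)
  have "ln (young_const (q / 2)) = - (q / 2) * ln (q / 2) + (q / 2 - 1) * ln 2 + (q / 2 - 1 / 2) * ln (q / p)"
    unfolding young_const_def qp(1) using q qp(2) p0 by (simp add: ln_mult ln_powr)
  also have "\<dots> = - (q / 2) * (ln q - ln 2) + (q / 2 - 1) * ln 2 + (q / 2 - 1 / 2) * (ln q - ln p)"
    using q p0 by (simp add: ln_div)
  also have "\<dots> = (q - 1) * ln 2 - (q - 1) / 2 * ln p - ln q / 2" by (simp add: field_simps)
  finally show ?thesis .
qed

lemma young_const_pos:
  assumes "1 / 2 < \<alpha>"
  shows "0 < young_const \<alpha>"
  using assms by (simp add: young_const_def)

text \<open>The underlying identity is that \<open>lieb_const d p q\<close> is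
  \<open>young_const (q / 2)\<close> to the power \<open>2 * d / q\<close>, that is, the q-th root
  of Young's constant in dimension \<open>2 * d\<close>. Taking logarithms, \<open>c1\<close>,
  \<open>c2\<close> and \<open>c3\<close> match the coefficients of \<open>ln 2\<close>,
  \<open>ln p\<close> and \<open>ln q\<close>.\<close>

lemma lieb_const_young_const:
  assumes p: "2 < p" and pq: "1 / p + 1 / q = 1"
  shows "lieb_const d p q powr (2 * p / (2 - p)) = young_const (q / 2) powr (- (2 * real d) / (1 - q / 2))"
    and "p / (p - 2) = (q / 2) / (1 - q / 2)" "1 < q" "q < 2"
proof -
  have "1 / q = (p - 1) / p" using p pq by (simp add: field_simps)
  then have q: "q = p / (p - 1)" by (metis inverse_divide inverse_eq_divide inverse_inverse_eq)
  have q1: "1 < q" "q < 2" using p by (auto simp: q field_simps)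
  then show "1 < q" "q < 2" .
  have pq': "p = q / (q - 1)" using p by (simp add: q field_simps)
  have e: "1 - q / 2 = (p - 2) / (2 * (p - 1))" using p by (simp add: q field_simps)
  show "p / (p - 2) = (q / 2) / (1 - q / 2)" 
  proof -
    define r where "r = p - 1"
    have "0 < r" using p by (simp add: r_def)
    then show ?thesis unfolding e unfolding q r_def[symmetric] by simp
  qed
  have l: "0 < lieb_const d p q" using p q1 by (simp add: lieb_const_def)
  have Y: "0 < young_const (q / 2)" using q1 by (intro young_const_pos) simp
  have ln4: "ln (4 :: real) = 2 * ln 2" using ln_realpow[of 2 2] by simp
  have lnl: "ln (lieb_const d p q) = real d / p * (2 * ln 2 - ln p) - real d / q * ln q"
    unfolding lieb_const_def using p q1 by (simp add: ln_mult ln_powr ln_div ln4)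
  have dist: "k * (a * (2 * x - y) - b * z) = (k * (2 * a)) * x - (k * a) * y - (k * b) * z" for k a b x y z :: real
    by (simp add: algebra_simps)
  note L = dist[of "2 * p / (2 - p)" "real d / p" "ln 2" "ln p" "real d / q" "ln q", folded lnl]
  have R: "- (2 * real d) / (1 - q / 2) * ln (young_const (q / 2)) = (- (2 * real d) / (1 - q / 2) * (q - 1)) * ln 2 - (- (2 * real d) / (1 - q / 2) * ((q - 1) / 2)) * ln p - (- (2 * real d) / (1 - q / 2) / 2) * ln q"
  proof -
    have "k * (a * x - b * y - z / 2) = (k * a) * x - (k * b) * y - (k / 2) * z" for k a b x y z :: real
      by (simp add: algebra_simps)
    then show ?thesis unfolding ln_young_const[OF q1(1) pq'] .
  qed
  have qm: "q - 1 = 1 / (p - 1)" using p by (simp add: q field_simps)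
  have c1: "2 * p / (2 - p) * (2 * (real d / p)) = - (2 * real d) / (1 - q / 2) * (q - 1)"
    unfolding e qm using p by (simp add: divide_simps) (simp add: algebra_simps)
  have c2: "2 * p / (2 - p) * (real d / p) = - (2 * real d) / (1 - q / 2) * ((q - 1) / 2)"
  proof -
    have "k * a = l * (r / 2)" if "k * (2 * a) = l * r" for k a l r :: real
      using that by (simp add: field_simps)
    from this[OF c1] show ?thesis .
  qed
  have iq: "1 / q = (p - 1) / p" by fact
  have c3: "2 * p / (2 - p) * (real d / q) = - (2 * real d) / (1 - q / 2) / 2"
  proof -
    have "2 * p / (2 - p) * (real d / q) = 2 * p / (2 - p) * (real d * ((p - 1) / p))" using iq by (metis times_divide_eq_right mult.right_neutral)
    also have "\<dots> = - (2 * real d) / (1 - q / 2) / 2" unfolding e using p by (simp add: divide_simps) (simp add: algebra_simps)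
    finally show ?thesis .
  qed
  have "2 * p / (2 - p) * ln (lieb_const d p q) = - (2 * real d) / (1 - q / 2) * ln (young_const (q / 2))"
    unfolding L R c1 c2 c3 ..
  then show "lieb_const d p q powr (2 * p / (2 - p)) = young_const (q / 2) powr (- (2 * real d) / (1 - q / 2))"
    using l Y by (simp add: powr_def)
qed

text \<open>Dividing by \<open>I powr (1 - \<alpha>)\<close> leaves \<open>I powr \<alpha>\<close>,
  and the lower bound on \<open>I\<close> makes \<open>D\<close> cancel. The surplus power of
  \<open>\<kappa>\<close> is just what turns \<open>u\<close> into \<open>u / \<kappa>\<close>; a
  root of order \<open>1 - \<alpha>\<close> concludes.\<close>

lemma powr_bound_from_energy:
  fixes \<alpha> \<delta> \<kappa> D I u Y :: real
  assumes \<alpha>: "1 / 2 < \<alpha>" "\<alpha> < 1" and \<delta>: "0 < \<delta>" and \<kappa>: "0 < \<kappa>" and D: "0 < D" and u: "0 \<le> u" and Y: "0 < Y"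
    and I: "\<delta> * (\<kappa> * D) \<le> I"
    and le: "I \<le> \<kappa> powr (2 * \<alpha> - 1) * Y ^ n * D powr \<alpha> * (u * I) powr (1 - \<alpha>)"
  shows "Y powr (- real n / (1 - \<alpha>)) * \<delta> powr (\<alpha> / (1 - \<alpha>)) \<le> u / \<kappa>"
proof -
  have I0: "0 < I" using I \<delta> \<kappa> D by (smt (verit) mult_pos_pos)
  have "I powr \<alpha> * I powr (1 - \<alpha>) = I" using I0 by (simp add: powr_add[symmetric])
  also have "\<dots> \<le> (\<kappa> powr (2 * \<alpha> - 1) * Y ^ n * D powr \<alpha> * u powr (1 - \<alpha>)) * I powr (1 - \<alpha>)"
    using le u I0 by (simp add: powr_mult mult_ac)
  finally have "I powr \<alpha> \<le> \<kappa> powr (2 * \<alpha> - 1) * Y ^ n * D powr \<alpha> * u powr (1 - \<alpha>)"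
    by (rule mult_right_le_imp_le) (use I0 in simp)
  moreover have "(\<delta> * (\<kappa> * D)) powr \<alpha> \<le> I powr \<alpha>"
    using I \<delta> \<kappa> D \<alpha> by (intro powr_mono2) auto
  moreover have "(\<delta> * (\<kappa> * D)) powr \<alpha> = \<delta> powr \<alpha> * \<kappa> powr \<alpha> * D powr \<alpha>"
    using \<delta> \<kappa> D by (simp add: powr_mult mult.assoc)
  moreover have "\<kappa> powr (2 * \<alpha> - 1) * Y ^ n * D powr \<alpha> * u powr (1 - \<alpha>) = \<kappa> powr (2 * \<alpha> - 1) * Y ^ n * u powr (1 - \<alpha>) * D powr \<alpha>"
    by (simp only: mult_ac)
  ultimately have "\<delta> powr \<alpha> * \<kappa> powr \<alpha> * D powr \<alpha> \<le> \<kappa> powr (2 * \<alpha> - 1) * Y ^ n * u powr (1 - \<alpha>) * D powr \<alpha>"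
    by linarith
  then have "\<delta> powr \<alpha> * \<kappa> powr \<alpha> \<le> \<kappa> powr (2 * \<alpha> - 1) * Y ^ n * u powr (1 - \<alpha>)"
    by (rule mult_right_le_imp_le) (use D in simp)
  also have "\<dots> = Y ^ n * (u / \<kappa>) powr (1 - \<alpha>) * \<kappa> powr \<alpha>"
  proof -
    have "\<kappa> powr (2 * \<alpha> - 1) = \<kappa> powr (\<alpha> + - (1 - \<alpha>))" by simp
    also have "\<dots> = \<kappa> powr \<alpha> / \<kappa> powr (1 - \<alpha>)" unfolding powr_add powr_minus by (simp add: divide_inverse)
    finally show ?thesis using u \<kappa> by (simp add: powr_divide)
  qed
  finally have "\<delta> powr \<alpha> \<le> Y ^ n * (u / \<kappa>) powr (1 - \<alpha>)"
    by (rule mult_right_le_imp_le) (use \<kappa> in simp)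
  then have "Y powr (- real n) * \<delta> powr \<alpha> \<le> (u / \<kappa>) powr (1 - \<alpha>)"
    using Y by (simp add: powr_minus powr_realpow field_simps)
  then have "(Y powr (- real n) * \<delta> powr \<alpha>) powr (1 / (1 - \<alpha>)) \<le> ((u / \<kappa>) powr (1 - \<alpha>)) powr (1 / (1 - \<alpha>))"
    using \<alpha> Y \<delta> by (intro powr_mono2) auto
  also have "\<dots> = u / \<kappa>" using \<alpha> u \<kappa> by (simp add: powr_powr)
  also have "(Y powr (- real n) * \<delta> powr \<alpha>) powr (1 / (1 - \<alpha>)) = Y powr (- real n / (1 - \<alpha>)) * \<delta> powr (\<alpha> / (1 - \<alpha>))"
    using Y \<delta> by (simp add: powr_mult powr_powr)
  finally show ?thesis .
qed

section \<open>Passage from Lebesgue to Borel measurability and from \<open>mu\<close> to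
  \<open>lborel\<close>\<close>

lemma measurable_mu [simp]: "borel_measurable mu = borel_measurable lebesgue"
  unfolding mu_def by (rule measurable_cong_sets) simp_all

lemma AE_mu_iff: "(AE x in mu. P x) \<longleftrightarrow> (AE x in lborel. P x)"
  unfolding mu_def by (subst AE_density) (simp_all add: AE_completion_iff)

lemma emeasure_mu: "U \<in> sets lebesgue \<Longrightarrow>
   emeasure mu (U :: 'a::euclidean_space set) = ennreal (1 / (2 * pi) powr (real DIM('a) / 2)) * emeasure lebesgue U"
  unfolding mu_def by (rule emeasure_density_const)

lemma integral_mu:
  fixes F :: "'a::euclidean_space \<Rightarrow> 'b::euclidean_space"
  assumes F: "F \<in> borel_measurable borel"
  shows "integral\<^sup>L mu F = (1 / (2 * pi) powr (real DIM('a) / 2)) *\<^sub>R integral\<^sup>L lborel F"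
proof -
  have m: "F \<in> borel_measurable lborel" "F \<in> borel_measurable lebesgue"
    using F by (auto intro: measurable_completion)
  show ?thesis unfolding mu_def
    by (subst integral_density) (use m in \<open>simp_all add: integral_completion\<close>)
qed

lemma nn_integral_mu:
  fixes F :: "'a::euclidean_space \<Rightarrow> ennreal"
  assumes F: "F \<in> borel_measurable borel"
  shows "integral\<^sup>N mu F = ennreal (1 / (2 * pi) powr (real DIM('a) / 2)) * integral\<^sup>N lborel F"
proof -
  have m: "F \<in> borel_measurable lborel" "F \<in> borel_measurable lebesgue"
    using F by (auto intro: measurable_completion)
  show ?thesis unfolding mu_def
    by (subst nn_integral_density) (use m in \<open>simp_all add: nn_integral_cmult nn_integral_completion\<close>)
qed

text \<open>Fubini and joint measurability on products are used for Borel functions only, so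
  \<open>f\<close> and \<open>g\<close> are replaced by Borel versions.\<close>

lemma lebesgue_measurable_borel_version:
  fixes F :: "'a::euclidean_space \<Rightarrow> 'b::euclidean_space"
  assumes F: "F \<in> borel_measurable lebesgue"
  obtains G where "G \<in> borel_measurable borel" "AE x in lborel. F x = G x"
proof -
  have "\<exists>g\<in>borel_measurable lborel. AE x in lborel. F x \<bullet> b = g x" for b
    by (rule completion_ex_borel_measurable_real, rule borel_measurable_inner[OF F]) simp
  then obtain g where g: "\<And>b. g b \<in> borel_measurable lborel" "\<And>b. AE x in lborel. F x \<bullet> b = g b x" by metis
  show thesis
  proof (rule that[of "\<lambda>x. \<Sum>b\<in>Basis. g b x *\<^sub>R b"])
    note [measurable] = g(1)
    show "(\<lambda>x. \<Sum>b\<in>Basis. g b x *\<^sub>R b) \<in> borel_measurable borel"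
      using g(1) by (intro borel_measurable_sum borel_measurable_scaleR) simp_all
    have "AE x in lborel. \<forall>b\<in>Basis. F x \<bullet> b = g b x" using g(2) by (intro AE_finite_allI) simp_all
    then show "AE x in lborel. F x = (\<Sum>b\<in>Basis. g b x *\<^sub>R b)"
    proof eventually_elim
      case (elim x)
      have "F x = (\<Sum>b\<in>Basis. (F x \<bullet> b) *\<^sub>R b)" by (simp add: euclidean_representation)
      then show ?case using elim by simp
    qed
  qed
qed

text \<open>Measurability of \<open>F\<close> follows from completeness of Lebesgue measure, since
  \<open>F\<close> agrees almost everywhere with a Borel function.\<close>

lemma integral_mu_cong_AE:
  fixes F G :: "'a::euclidean_space \<Rightarrow> 'b::euclidean_space"
  assumes G: "G \<in> borel_measurable borel" and eq: "AE x in lborel. F x = G x"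
  shows "integral\<^sup>L mu F = (1 / (2 * pi) powr (real DIM('a) / 2)) *\<^sub>R integral\<^sup>L lborel G"
proof -
  have m: "G \<in> borel_measurable lebesgue"
    using G by (auto intro: measurable_completion)
  have "F \<in> borel_measurable lebesgue"
    by (rule borel_measurable_AE[OF m]) (use AE_completion[OF eq] in \<open>auto elim: eventually_mono\<close>)
  then have "integral\<^sup>L mu F = integral\<^sup>L mu G"
    using m eq by (intro integral_cong_AE) (simp_all add: AE_mu_iff)
  then show ?thesis using integral_mu[OF G] by simp
qed

lemma L2_quat_borel_version:
  fixes F :: "'a::euclidean_space \<Rightarrow> quat"
  assumes F: "F \<in> L2_quat" and nz: "\<not> (AE x in mu. F x = 0)"
  obtains G A where "G \<in> borel_measurable borel" "AE x in lborel. F x = G x" "0 < A"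
    "energy G = ennreal A"
proof -
  have Fm: "F \<in> borel_measurable lebesgue" and Fi: "integrable mu (\<lambda>x. (norm (F x))\<^sup>2)"
    using F by (auto simp: L2_quat_def)
  obtain G where G: "G \<in> borel_measurable borel" "AE x in lborel. F x = G x"
    using lebesgue_measurable_borel_version[OF Fm] by blast
  note [measurable] = G(1)
  define c where "c = 1 / (2 * pi) powr (real DIM('a) / 2)"
  have c: "0 < c" by (simp add: c_def)
  have "(\<integral>\<^sup>+x. ennreal ((norm (F x))\<^sup>2) \<partial>mu) = (\<integral>\<^sup>+x. ennreal ((norm (G x))\<^sup>2) \<partial>mu)"
    using G(2) by (intro nn_integral_cong_AE) (auto simp: AE_mu_iff elim: eventually_mono)
  also have "\<dots> = ennreal c * energy G"
    unfolding c_def by (rule nn_integral_mu) measurable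
  finally have "ennreal c * energy G < \<infinity>"
    using Fi by (simp add: integrable_iff_bounded)
  then have fin: "energy G < \<infinity>"
    using c by (auto simp: ennreal_mult_less_top)
  have pos: "energy G \<noteq> 0"
  proof
    assume "energy G = 0"
    then have "AE x in lborel. G x = 0" by (subst (asm) nn_integral_0_iff_AE) auto
    then have "AE x in lborel. F x = 0" using G(2) by eventually_elim simp
    then show False using nz by (simp add: AE_mu_iff)
  qed
  define A where "A = enn2real (energy G)"
  have A: "energy G = ennreal A" using fin by (simp add: A_def)
  have "0 < A" using pos A by (metis A_def enn2real_nonneg ennreal_0 order_le_less)
  then show thesis using that G A by blast
qed

text \<open>Being nonzero in the L2 sense means not vanishing almost everywhere. The bound
  \<open>\<epsilon> \<le> 1\<close> keeps the base of the real power nonnegative, and the conclusion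
  is in \<open>ennreal\<close> because \<open>U\<close> may have infinite measure.\<close>

theorem theorem7:
  fixes f g :: "(real^'n) \<times> (real^'n) \<Rightarrow> quat"
    and U :: "(((real^'n) \<times> (real^'n)) \<times> ((real^'n) \<times> (real^'n))) set"
    and \<epsilon> :: real
  assumes "g \<in> L2_quat" and "\<not> (AE x in mu. g x = 0)"
    and "f \<in> L2_quat" and "\<not> (AE x in mu. f x = 0)"
    and "U \<in> sets lebesgue"
    and "0 \<le> \<epsilon>" and "\<epsilon> \<le> 1"
    and "concentrated \<epsilon> U (qwft g f)"
  shows "\<forall>p>2. \<forall>q. 1 / p + 1 / q = 1 \<longrightarrow>
    ennreal (lieb_const CARD('n) p q powr (2 * p / (2 - p)) * (1 - \<epsilon>\<^sup>2) powr (p / (p - 2)))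
      \<le> emeasure mu U"
proof (intro allI impI)
  fix p q :: real
  assume p: "2 < p" and pq: "1 / p + 1 / q = 1"
  obtain g' B where g': "g' \<in> borel_measurable borel" "AE x in lborel. g x = g' x" "0 < B"
    "energy g' = ennreal B"
    using L2_quat_borel_version[OF assms(1,2)] by blast
  obtain f' A where f': "f' \<in> borel_measurable borel" "AE x in lborel. f x = f' x" "0 < A"
    "energy f' = ennreal A"
    using L2_quat_borel_version[OF assms(3,4)] by blast
  interpret L2_pair f' g' A B
    using f' g' by unfold_locales auto
  \<comment> \<open>\<open>c\<close> normalises the integral that defines the transform,
    \<open>C\<close> the measure on phase space. In the concentration inequality both
    cancel.\<close>
  define c where "c = 1 / (2 * pi) powr (real DIM((real^'n) \<times> (real^'n)) / 2)"
  define C where "C = 1 / (2 * pi) powr (real DIM(((real^'n) \<times> (real^'n)) \<times> ((real^'n) \<times> (real^'n))) / 2)"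
  have c: "0 < c" and C: "0 < C" by (simp_all add: c_def C_def)
  have C\<kappa>: "C = 1 / \<kappa>"
  proof -
    have "\<kappa> = (2 * pi) powr real DIM((real^'n) \<times> (real^'n))" unfolding \<kappa>_def by (rule powr_realpow[symmetric]) simp
    also have "real DIM((real^'n) \<times> (real^'n)) = real DIM(((real^'n) \<times> (real^'n)) \<times> ((real^'n) \<times> (real^'n))) / 2" by simp
    finally show ?thesis by (simp add: C_def)
  qed
  \<comment> \<open>The equality holds at every point: for each fixed \<open>x\<close> the
    integrands agree for almost all \<open>y\<close>, since a translate of a null set is
    null.\<close>
  have G: "qwft g f = (\<lambda>z. c *\<^sub>R \<G> z)"
  proof
    fix z :: "((real^'n) \<times> (real^'n)) \<times> ((real^'n) \<times> (real^'n))"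
    obtain x u v where z: "z = (x, (u, v))" by (metis surj_pair)
    have shift: "AE y in lborel. g (y - x) = g' (y - x)"
      using AE_lborel_translate[OF g'(2), of "- x"] by simp
    have "qwft g f z = (\<integral>y. (case y of (s, t) \<Rightarrow>
        exp (- (s \<bullet> u) *\<^sub>R quat_i) * f y * qcnj (g (y - x)) * exp (- (t \<bullet> v) *\<^sub>R quat_j)) \<partial>mu)"
      by (simp add: qwft_def z)
    also have "\<dots> = c *\<^sub>R (LBINT y. qker y (u, v) (windowed g' f' x y))"
      unfolding c_def
    proof (rule integral_mu_cong_AE)
      show "(\<lambda>y. qker y (u, v) (windowed g' f' x y)) \<in> borel_measurable borel"
        by (rule measurable_qker) measurable
      show "AE y in lborel. (case y of (s, t) \<Rightarrow>
        exp (- (s \<bullet> u) *\<^sub>R quat_i) * f y * qcnj (g (y - x)) * exp (- (t \<bullet> v) *\<^sub>R quat_j)) = qker y (u, v) (windowed g' f' x y)"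
        using shift f'(2)
      proof eventually_elim
        case (elim y)
        then show ?case by (simp add: qker_def windowed_def case_prod_beta' mult.assoc)
      qed
    qed
    finally show "qwft g f z = c *\<^sub>R \<G> z" by (simp add: z \<G>_def qft_def)
  qed
  \<comment> \<open>The Borel part of \<open>U\<close> in the completion; the rest lies in a null
    set, so neither the measure nor the integrals change.\<close>
  define U' where "U' = main_part lborel U"
  have U'[measurable]: "U' \<in> sets borel" unfolding U'_def using main_part_sets[OF assms(5)] unfolding sets_lborel .
  have eU: "emeasure mu U = ennreal C * emeasure lborel U'"
    using emeasure_mu[OF assms(5)] assms(5) by (simp add: C_def U'_def)
  have indU: "AE z in lborel. indicator (- U) z = (indicator (- U') z :: real)"
  proof -
    obtain N where N: "N \<in> null_sets lborel" "null_part lborel U \<subseteq> N" using null_part[OF assms(5)] by blast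
    have un: "U' \<union> null_part lborel U = U" unfolding U'_def by (rule main_part_null_part_Un[OF assms(5)])
    show ?thesis
    proof (rule AE_I'[OF N(1)])
      show "{z \<in> space lborel. indicator (- U) z \<noteq> (indicator (- U') z :: real)} \<subseteq> N"
        using un N(2) by (auto simp: indicator_def split: if_splits)
    qed
  qed
  define W where "W = \<kappa> * (A * B)"
  have W: "0 < W" using \<kappa>_pos f'(3) g'(3) by (simp add: W_def)
  have iW: "integrable lborel (\<lambda>z. (norm (\<G> z))\<^sup>2)" and eW: "(LBINT z. (norm (\<G> z))\<^sup>2) = W"
  proof -
    have "has_bochner_integral lborel (\<lambda>z. (norm (\<G> z))\<^sup>2) W"
      using nn_integral_\<G>_square W unfolding W_def[symmetric]
      by (intro has_bochner_integral_nn_integral) auto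
    then show "integrable lborel (\<lambda>z. (norm (\<G> z))\<^sup>2)" "(LBINT z. (norm (\<G> z))\<^sup>2) = W"
      by (auto simp: has_bochner_integral_iff)
  qed
  define I where "I = (LBINT z. indicator U' z * (norm (\<G> z))\<^sup>2)"
  have iI: "integrable lborel (\<lambda>z. indicator U' z * (norm (\<G> z))\<^sup>2)"
    by (rule Bochner_Integration.integrable_bound[OF iW]) (auto simp: indicator_def)
  have n2: "norm2 (qwft g f) = sqrt (C * c\<^sup>2 * W)"
  proof -
    have "(\<integral>z. (norm (qwft g f z))\<^sup>2 \<partial>mu) = C *\<^sub>R (LBINT z. (norm (c *\<^sub>R \<G> z))\<^sup>2)"
      unfolding G C_def by (rule integral_mu) measurable
    also have "\<dots> = C * c\<^sup>2 * W" using eW by (simp add: power_mult_distrib)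
    finally show ?thesis by (simp add: norm2_def)
  qed
  have nU: "(\<integral>z\<in>- U. (norm (qwft g f z))\<^sup>2 \<partial>mu) = C * c\<^sup>2 * (W - I)"
  proof -
    have "(\<integral>z\<in>- U. (norm (qwft g f z))\<^sup>2 \<partial>mu) = C *\<^sub>R (LBINT z. indicator (- U') z *\<^sub>R (norm (c *\<^sub>R \<G> z))\<^sup>2)"
      unfolding G C_def set_lebesgue_integral_def
    proof (rule integral_mu_cong_AE)
      show "AE z in lborel. indicator (- U) z *\<^sub>R (norm (c *\<^sub>R \<G> z))\<^sup>2 = indicator (- U') z *\<^sub>R (norm (c *\<^sub>R \<G> z))\<^sup>2"
        using indU by eventually_elim simp
    qed measurable
    also have "\<dots> = C * (LBINT z. c\<^sup>2 * ((norm (\<G> z))\<^sup>2 - indicator U' z * (norm (\<G> z))\<^sup>2))"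
      by (simp add: indicator_compl power_mult_distrib algebra_simps)
    also have "\<dots> = C * c\<^sup>2 * (W - I)"
      using iW iI by (simp add: eW I_def)
    finally show ?thesis .
  qed
  define \<delta> where "\<delta> = 1 - \<epsilon>\<^sup>2"
  have "sqrt (C * c\<^sup>2 * (W - I)) \<le> \<epsilon> * sqrt (C * c\<^sup>2 * W)"
    using assms(8) unfolding concentrated_def n2 nU .
  also have "\<dots> = sqrt (C * c\<^sup>2 * (\<epsilon>\<^sup>2 * W))" using assms(6) by (simp add: real_sqrt_mult)
  finally have "C * c\<^sup>2 * (W - I) \<le> C * c\<^sup>2 * (\<epsilon>\<^sup>2 * W)" by simp
  then have "W - I \<le> \<epsilon>\<^sup>2 * W" by (rule mult_left_le_imp_le) (use c C in simp)
  then have I: "\<delta> * W \<le> I" by (simp add: \<delta>_def algebra_simps)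
  have \<delta>0: "0 \<le> \<delta>" using assms(6,7) by (simp add: \<delta>_def power_le_one)
  note lc = lieb_const_young_const(1)[OF p pq, where d = "CARD('n)"] lieb_const_young_const(2-4)[OF p pq]
  show "ennreal (lieb_const CARD('n) p q powr (2 * p / (2 - p)) * (1 - \<epsilon>\<^sup>2) powr (p / (p - 2))) \<le> emeasure mu U"
  \<comment> \<open>Division by \<open>\<delta>\<close> and by the measure is legitimate only
    outside these two cases. For \<open>\<delta> = 0\<close> the lower bound is 0 because
    \<open>0 powr x = 0\<close>.\<close>
  proof (cases "\<delta> = 0 \<or> emeasure lborel U' = \<infinity>")
    case True
    then show ?thesis
    proof
      assume "\<delta> = 0" then show ?thesis unfolding \<delta>_def[symmetric] by simp
    next
      assume "emeasure lborel U' = \<infinity>" then show ?thesis unfolding eU using C by (simp add: ennreal_mult_top)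
    qed
  next
    case False
    then have \<delta>: "0 < \<delta>" and fin: "emeasure lborel U' < \<infinity>" using \<delta>0 by (auto simp: less_top)
    have "I \<le> \<kappa> powr (2 * (q / 2) - 1) * young_const (q / 2) ^ DIM((real^'n) \<times> (real^'n)) * (A * B) powr (q / 2) * (measure lborel U' * I) powr (1 - q / 2)"
      using energy_concentration[OF U' fin lc(3,4)] unfolding I_def by simp
    from powr_bound_from_energy[OF _ _ \<delta> \<kappa>_pos _ _ _ I[unfolded W_def] this]
    have "young_const (q / 2) powr (- real DIM((real^'n) \<times> (real^'n)) / (1 - q / 2)) * \<delta> powr ((q / 2) / (1 - q / 2)) \<le> measure lborel U' / \<kappa>"
      using lc(3,4) f'(3) g'(3) young_const_pos[of "q / 2"] by simp
    then have "lieb_const CARD('n) p q powr (2 * p / (2 - p)) * \<delta> powr (p / (p - 2)) \<le> C * measure lborel U'"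
      unfolding lc(1,2) C\<kappa> by simp
    then have "ennreal (lieb_const CARD('n) p q powr (2 * p / (2 - p)) * \<delta> powr (p / (p - 2))) \<le> ennreal (C * measure lborel U')"
      by (rule ennreal_leI)
    also have "\<dots> = emeasure mu U"
      unfolding eU using C fin by (simp add: ennreal_mult emeasure_eq_ennreal_measure)
    finally show ?thesis unfolding \<delta>_def .
  qed
qed

end
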